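(* Let $(X,d)$ be the complete metric space associated with the subsolution $(\rho_0,V_0,R_0)$ and the domain $P$ as defined in the context, and let $(\widehat{V},\widehat{U})\in X$ be a point of continuity of the identity map from $(X,d)$ to $L^2((0,T)\times\mathbb{T}^n)$. Then $$\frac{(V_0+\widehat{V})\otimes(V_0+\widehat{V})}{\rho_0}-(U_0+\widehat{U})=\frac{|V_0|^2}{n\rho_0}\,\mathrm{Id}_n+R_0\qquad\text{a.e. in }P.$$ In addition, there exists a positive number $C_0>0$ such that $$\int_0^T\int_{\mathbb{T}^n}\frac{|\widehat{V}|^2}{\rho_0}\,dx\,dt\le C_0\int_0^T\int_{\mathbb{T}^n}\operatorname{tr}R_0\,dx\,dt.$$
   Context: Let $n\in\{2,3\}$, $T>0$, $\gamma>1$, $\delta>0$. $\mathbb{S}^{n\times n}$ denotes the symmetric $n\times n$ real matrices, $\mathbb{S}^{n\times n}_0$ those that are also traceless, $\mathrm{Id}_n$ the identity matrix; inequalities between symmetric matrices are in the sense of quadratic forms. Standing setting: $(\rho_0,V_0,R_0)$ is a smooth subsolution on $[0,T]\times\mathbb{T}^n$, i.e. $\rho_0>0$ is scalar, $V_0$ is $\mathbb{R}^n$-valued, $R_0$ is $\mathbb{S}^{n\times n}$-valued with $R_0>0$, and $$\partial_t\rho_0+\operatorname{div}V_0=0,\qquad \partial_tV_0+\operatorname{div}U_0+\nabla\Big(\frac{\rho_0^\gamma}{\delta^2}+\frac{|V_0|^2}{n\rho_0}\Big)+\operatorname{div}R_0=0,\qquad U_0:=\frac{V_0\otimes V_0}{\rho_0}-\frac{|V_0|^2}{n\rho_0}\,\mathrm{Id}_n.$$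 $P\subset(0,T)\times\mathbb{T}^n$ is a prescribed open domain, and $0<\Lambda^{-2}\le\rho_0\le\Lambda^2$ on $P$ for a constant $\Lambda$. $X_0$ is the set of $(\widetilde{V},\widetilde{U})\in C_c^\infty(P;\mathbb{R}^n\times\mathbb{S}^{n\times n}_0)$ such that (a) $\operatorname{div}\widetilde{V}=0$ and $\partial_t\widetilde{V}+\operatorname{div}\widetilde{U}=0$; (b) $\displaystyle\left|\int_0^T\int_{\mathbb{T}^n}\frac{V_0\cdot\widetilde{V}}{\rho_0}\,dx\,dt\right|\le\frac18\int_0^T\int_{\mathbb{T}^n}\frac{|\widetilde{V}|^2}{\rho_0}\,dx\,dt$; (c) $\displaystyle\frac{(V_0+\widetilde{V})\otimes(V_0+\widetilde{V})}{\rho_0}-(U_0+\widetilde{U})<\frac{|V_0|^2}{n\rho_0}\,\mathrm{Id}_n+R_0$ on $P$. $X$ is the closure of $X_0$ in the weak-$*$ topology of $L^\infty$; it is bounded in $L^\infty$, so this topology is metrizable on $X$, and $d$ is a metric on $X$ inducing it, making $(X,d)$ a complete metric space. Functions on $P$ are extended by zero outside $P$. *)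

theory Defs
  imports "HOL-Analysis.Analysis"
begin

text \<open>
  The torus is the quotient of the Euclidean space by the integer lattice. Functions on the torus
  are functions on the Euclidean space of period 1 in each coordinate, subsets of the torus are
  periodic subsets, and integrals over the torus are integrals over the unit cell.
\<close>

type_synonym 'n point = "real \<times> (real^'n)"
type_synonym 'n state = "(real^'n) \<times> (real^'n^'n)"

definition slab :: "real \<Rightarrow> ('n::finite) point set" where
  "slab T = {0..T} \<times> UNIV"

definition space_periodic_on :: "real set \<Rightarrow> (('n::finite) point \<Rightarrow> 'b) \<Rightarrow> bool" where
  "space_periodic_on I f \<longleftrightarrow> (\<forall>t\<in>I. \<forall>x i. f (t, x + axis i 1) = f (t, x))"

definition spacetime :: "real \<Rightarrow> ('n::finite) point measure" where
  "spacetime T = lebesgue_on ({0<..<T} \<times> {x. \<forall>i. 0 \<le> x $ i \<and> x $ i < 1})"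


subsection \<open>Smooth functions and differential operators\<close>

text \<open>
  Derivatives are taken within \<open>S\<close>, so that on a closed slab smoothness is up to the boundary.
  The notion is only used for \<open>S = UNIV\<close> and for slabs of positive height, where the derivative
  within \<open>S\<close> is unique.
\<close>

primrec Ck_on :: "nat \<Rightarrow> 'a::euclidean_space set \<Rightarrow> ('a \<Rightarrow> 'b::real_normed_vector) \<Rightarrow> bool" where
  "Ck_on 0 S f \<longleftrightarrow> continuous_on S f"
| "Ck_on (Suc k) S f \<longleftrightarrow>
     (\<exists>f'. (\<forall>z\<in>S. (f has_derivative f' z) (at z within S)) \<and> (\<forall>v. Ck_on k S (\<lambda>z. f' z v)))"

definition smooth_fun_on :: "'a::euclidean_space set \<Rightarrow> ('a \<Rightarrow> 'b::real_normed_vector) \<Rightarrow> bool" where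
  "smooth_fun_on S f \<longleftrightarrow> (\<forall>k. Ck_on k S f)"

text \<open>One-sided at the end points of \<open>{0..T}\<close>.\<close>

definition time_deriv ::
    "real \<Rightarrow> (('n::finite) point \<Rightarrow> 'b::real_normed_vector) \<Rightarrow> 'n point \<Rightarrow> 'b" where
  "time_deriv T f z = vector_derivative (\<lambda>s. f (s, snd z)) (at (fst z) within {0..T})"

definition space_deriv ::
    "('n::finite) \<Rightarrow> ('n point \<Rightarrow> 'b::real_normed_vector) \<Rightarrow> 'n point \<Rightarrow> 'b" where
  "space_deriv i f z = vector_derivative (\<lambda>h. f (fst z, snd z + h *\<^sub>R axis i 1)) (at 0)"

definition gradient :: "(('n::finite) point \<Rightarrow> real) \<Rightarrow> 'n point \<Rightarrow> real^'n" where
  "gradient f z = (\<chi> i. space_deriv i f z)"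

definition vec_div :: "(('n::finite) point \<Rightarrow> real^'n) \<Rightarrow> 'n point \<Rightarrow> real" where
  "vec_div V z = (\<Sum>i\<in>UNIV. space_deriv i (\<lambda>y. V y $ i) z)"

definition mat_div :: "(('n::finite) point \<Rightarrow> real^'n^'n) \<Rightarrow> 'n point \<Rightarrow> real^'n" where
  "mat_div A z = (\<chi> i. \<Sum>j\<in>UNIV. space_deriv j (\<lambda>y. A y $ i $ j) z)"


subsection \<open>Symmetric matrices\<close>

definition Sym :: "(real^'n^'n) set" where
  "Sym = {A. transpose A = A}"

definition Sym0 :: "(real^('n::finite)^'n) set" where
  "Sym0 = {A \<in> Sym. trace A = 0}"

definition form_less :: "real^('n::finite)^'n \<Rightarrow> real^'n^'n \<Rightarrow> bool" (infix "\<prec>" 50) where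
  "A \<prec> B \<longleftrightarrow> (\<forall>x. x \<noteq> 0 \<longrightarrow> x \<bullet> (A *v x) < x \<bullet> (B *v x))"

definition tensor :: "real^'n \<Rightarrow> real^'n \<Rightarrow> real^'n^'n" (infixr "\<otimes>" 75) where
  "v \<otimes> w = (\<chi> i j. v $ i * w $ j)"


subsection \<open>Subsolutions\<close>

definition U_of :: "(('n::finite) point \<Rightarrow> real) \<Rightarrow> ('n point \<Rightarrow> real^'n) \<Rightarrow> 'n point \<Rightarrow> real^'n^'n" where
  "U_of \<rho> V z = (1 / \<rho> z) *\<^sub>R (V z \<otimes> V z)
     - ((norm (V z))\<^sup>2 / (real CARD('n) * \<rho> z)) *\<^sub>R mat 1"

definition pressure_of ::
    "real \<Rightarrow> real \<Rightarrow> (('n::finite) point \<Rightarrow> real) \<Rightarrow> ('n point \<Rightarrow> real^'n) \<Rightarrow> 'n point \<Rightarrow> real" where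
  "pressure_of \<gamma> \<delta> \<rho> V z = \<rho> z powr \<gamma> / \<delta>\<^sup>2 + (norm (V z))\<^sup>2 / (real CARD('n) * \<rho> z)"

definition smooth_subsolution ::
    "real \<Rightarrow> real \<Rightarrow> real \<Rightarrow> (('n::finite) point \<Rightarrow> real) \<Rightarrow> ('n point \<Rightarrow> real^'n)
      \<Rightarrow> ('n point \<Rightarrow> real^'n^'n) \<Rightarrow> bool" where
  "smooth_subsolution T \<gamma> \<delta> \<rho> V R \<longleftrightarrow>
     space_periodic_on {0..T} \<rho> \<and> space_periodic_on {0..T} V \<and> space_periodic_on {0..T} R \<and>
     smooth_fun_on (slab T) \<rho> \<and> smooth_fun_on (slab T) V \<and> smooth_fun_on (slab T) R \<and>
     (\<forall>z\<in>slab T. 0 < \<rho> z \<and> R z \<in> Sym \<and> 0 \<prec> R z) \<and>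
     (\<forall>z\<in>slab T. time_deriv T \<rho> z + vec_div V z = 0) \<and>
     (\<forall>z\<in>slab T. time_deriv T V z + mat_div (U_of \<rho> V) z
         + gradient (pressure_of \<gamma> \<delta> \<rho> V) z + mat_div R z = 0)"

definition open_region :: "real \<Rightarrow> ('n::finite) point set \<Rightarrow> bool" where
  "open_region T P \<longleftrightarrow> open P \<and> P \<subseteq> {0<..<T} \<times> UNIV \<and>
     space_periodic_on UNIV (\<lambda>z. z \<in> P)"

text \<open>
  Smooth functions with compact support in \<open>P\<close>, extended by zero. The support in the quotient is a
  closed subset of the compact product of \<open>{0..T}\<close> and the torus as soon as it is contained in \<open>P\<close>,
  so no separate compactness condition is needed.
\<close>

definition test_states :: "('n::finite) point set \<Rightarrow> ('n point \<Rightarrow> 'n state) set" where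
  "test_states P = {f. smooth_fun_on UNIV f \<and> space_periodic_on UNIV f \<and>
     (\<forall>z. snd (f z) \<in> Sym0) \<and> closure {z. f z \<noteq> 0} \<subseteq> P}"

definition X0 ::
    "real \<Rightarrow> ('n::finite) point set \<Rightarrow> ('n point \<Rightarrow> real) \<Rightarrow> ('n point \<Rightarrow> real^'n)
      \<Rightarrow> ('n point \<Rightarrow> real^'n^'n) \<Rightarrow> ('n point \<Rightarrow> 'n state) set" where
  "X0 T P \<rho> V R = {f \<in> test_states P.
     (let W = (\<lambda>z. fst (f z)); U = (\<lambda>z. snd (f z)) in
       (\<forall>z\<in>slab T. vec_div W z = 0 \<and> time_deriv T W z + mat_div U z = 0) \<and>
       \<bar>LINT z|spacetime T. (V z \<bullet> W z) / \<rho> z\<bar>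
         \<le> 1 / 8 * (LINT z|spacetime T. (norm (W z))\<^sup>2 / \<rho> z) \<and>
       (\<forall>z\<in>P. (1 / \<rho> z) *\<^sub>R ((V z + W z) \<otimes> (V z + W z)) - (U_of \<rho> V z + U z)
          \<prec> ((norm (V z))\<^sup>2 / (real CARD('n) * \<rho> z)) *\<^sub>R mat 1 + R z))}"


subsection \<open>The weak-star closure\<close>

definition Linf_fun :: "real \<Rightarrow> (('n::finite) point \<Rightarrow> 'n state) set" where
  "Linf_fun T = {f \<in> borel_measurable (spacetime T).
     (AE z in spacetime T. snd (f z) \<in> Sym0) \<and> (\<exists>C. AE z in spacetime T. norm (f z) \<le> C)}"

definition L1_fun :: "real \<Rightarrow> (('n::finite) point \<Rightarrow> 'n state) set" where
  "L1_fun T = {\<phi>. integrable (spacetime T) \<phi> \<and> (AE z in spacetime T. snd (\<phi> z) \<in> Sym0)}"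

definition ae_rel :: "real \<Rightarrow> ((('n::finite) point \<Rightarrow> 'n state) \<times> ('n point \<Rightarrow> 'n state)) set" where
  "ae_rel T = {(f, g). f \<in> Linf_fun T \<and> g \<in> Linf_fun T \<and> (AE z in spacetime T. f z = g z)}"

definition ae_class :: "real \<Rightarrow> (('n::finite) point \<Rightarrow> 'n state) \<Rightarrow> ('n point \<Rightarrow> 'n state) set" where
  "ae_class T f = ae_rel T `` {f}"

definition Linf :: "real \<Rightarrow> (('n::finite) point \<Rightarrow> 'n state) set set" where
  "Linf T = Linf_fun T // ae_rel T"

text \<open>The pairing below does not depend on the representative \<open>f\<close> of \<open>u\<close>.\<close>

definition weak_star :: "real \<Rightarrow> (('n::finite) point \<Rightarrow> 'n state) set topology" where
  "weak_star T = topology_generated_by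
     {{u \<in> Linf T. \<exists>f\<in>u. (LINT z|spacetime T. f z \<bullet> \<phi> z) \<in> G} | \<phi> G. \<phi> \<in> L1_fun T \<and> open G}"

text \<open>
  The closure is taken in the space of bounded functions on all of space-time; as the elements of
  \<open>X0\<close> vanish outside \<open>P\<close>, so do, almost everywhere, those of the closure.
\<close>

definition X ::
    "real \<Rightarrow> ('n::finite) point set \<Rightarrow> ('n point \<Rightarrow> real) \<Rightarrow> ('n point \<Rightarrow> real^'n)
      \<Rightarrow> ('n point \<Rightarrow> real^'n^'n) \<Rightarrow> ('n point \<Rightarrow> 'n state) set set" where
  "X T P \<rho> V R = weak_star T closure_of (ae_class T ` X0 T P \<rho> V R)"

definition complete_metric_for :: "'a topology \<Rightarrow> 'a set \<Rightarrow> ('a \<Rightarrow> 'a \<Rightarrow> real) \<Rightarrow> bool" where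
  "complete_metric_for \<tau> M d \<longleftrightarrow> Metric_space M d \<and>
     Metric_space.mtopology M d = subtopology \<tau> M \<and> Metric_space.mcomplete M d"

definition L2_dist ::
    "real \<Rightarrow> (('n::finite) point \<Rightarrow> 'n state) \<Rightarrow> ('n point \<Rightarrow> 'n state) \<Rightarrow> real" where
  "L2_dist T f g = sqrt (LINT z|spacetime T. (norm (f z - g z))\<^sup>2)"

definition L2_continuity_point ::
    "real \<Rightarrow> (('n::finite) point \<Rightarrow> 'n state) set set
      \<Rightarrow> (('n point \<Rightarrow> 'n state) set \<Rightarrow> ('n point \<Rightarrow> 'n state) set \<Rightarrow> real)
      \<Rightarrow> ('n point \<Rightarrow> 'n state) \<Rightarrow> bool" where
  "L2_continuity_point T M d f \<longleftrightarrow> ae_class T f \<in> M \<and>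
     (\<forall>\<epsilon>>0. \<exists>\<eta>>0. \<forall>g. ae_class T g \<in> M \<and> d (ae_class T f) (ae_class T g) < \<eta>
        \<longrightarrow> L2_dist T f g < \<epsilon>)"

end

theory Submission
  imports Defs
begin

text \<open>
  On \<open>X0\<close> the defect matrix, right minus left hand side of the asserted identity, is positive definite.
  Where it equals \<open>D\<close> and the velocity is \<open>v\<close>, choose \<open>a\<close> with \<open>a \<otimes> a \<le> D\<close> and \<open>|a|\<^sup>2\<close> comparable to
  \<open>trace D\<close>. A plane wave of velocity direction \<open>a\<close>, whose normal \<open>\<xi>\<close> and speed follow the component of
  \<open>v / \<rho>\<close> orthogonal to \<open>a\<close>, changes \<open>D\<close> only by a multiple of \<open>a \<otimes> a\<close>, so amplitudes up to a fixed
  multiple of \<open>trace D\<close> are admissible. Localising such waves by a third-order potential on disjoint small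
  balls (Vitali) and letting the frequency tend to infinity (Riemann--Lebesgue), every \<open>f\<close> in \<open>X0\<close> becomes a
  weak-star limit of elements of \<open>X0\<close> at squared \<open>L\<^sup>2\<close> distance at least \<open>\<kappa> \<integral> (trace D)\<^sup>2\<close>; adding energy
  only helps the condition on the mixed term. At a point of continuity of the identity this gap must
  vanish along an approximating sequence from \<open>X0\<close>, hence \<open>D = 0\<close> there. Integrating \<open>trace D \<ge> 0\<close> over
  space-time gives the energy estimate with constant \<open>4 / 3\<close>.
\<close>

subsection \<open>Smooth functions\<close>

text \<open>The obstacle is that the defect is quadratic in the velocity. Adding \<open>s\<close>
  times a wave of direction \<open>a\<close> to a velocity \<open>v\<close> creates
  \<open>s *\<^sub>R (v \<otimes> a + a \<otimes> v)\<close>, which has no sign. A plane wave with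
  phase \<open>\<xi> \<bullet> x - \<beta> t\<close> and \<open>\<xi>\<close> orthogonal to
  \<open>a\<close> solves the linear system with matrix part
  \<open>\<beta> *\<^sub>R (\<xi> \<otimes> a + a \<otimes> \<xi>)\<close>, so the choice of
  \<open>\<beta> *\<^sub>R \<xi>\<close> can absorb this term except for the component of
  \<open>v\<close> along \<open>a\<close>. What survives is \<open>a \<otimes> a\<close> with a
  coefficient still linear in \<open>s\<close>. Therefore the amplitude must be of the order of the
  trace, not of its square root, and the gap comes out quadratic in the trace. A plain cut-off would
  break the system; cutting off a potential keeps it exact and costs an error of order
  \<open>1 / N\<close>. Such errors are harmless because positive definiteness is an open condition.
  The factor \<kappa> must be the same for all of \<open>X0\<close>, since the approximating
  sequence varies; the uniformity comes from the trace of the defect, which bounds the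
  velocity.\<close>

text \<open>With the direction fixed, the derivative has the same type as the function, so higher
  derivatives are iterates \<open>ddir u (ddir v f)\<close> and no multilinear maps occur.\<close>

definition ddir :: "'a::euclidean_space \<Rightarrow> ('a \<Rightarrow> 'b::real_normed_vector) \<Rightarrow> 'a \<Rightarrow> 'b" where
  "ddir v f z = frechet_derivative f (at z) v"

abbreviation Ck :: "nat \<Rightarrow> ('a::euclidean_space \<Rightarrow> 'b::real_normed_vector) \<Rightarrow> bool" where
  "Ck k \<equiv> Ck_on k UNIV"

abbreviation smooth :: "('a::euclidean_space \<Rightarrow> 'b::real_normed_vector) \<Rightarrow> bool" where
  "smooth \<equiv> smooth_fun_on UNIV"

lemma ddir_eqI: "(f has_derivative f') (at z) \<Longrightarrow> ddir v f z = f' v"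
  unfolding ddir_def using frechet_derivative_at by metis

text \<open>On the whole space the derivative is unique, so the existential in \<open>Ck_on\<close>
  can be replaced by \<open>frechet_derivative\<close>.\<close>

lemma Ck_Suc_iff: "Ck (Suc k) f \<longleftrightarrow> (\<forall>z. f differentiable (at z)) \<and> (\<forall>v. Ck k (ddir v f))"
proof
  assume "Ck (Suc k) f"
  then obtain f' where f': "\<And>z. (f has_derivative f' z) (at z)" "\<And>v. Ck k (\<lambda>z. f' z v)"
    by auto
  then have "ddir v f = (\<lambda>z. f' z v)" for v
    using ddir_eqI by fastforce
  with f' show "(\<forall>z. f differentiable (at z)) \<and> (\<forall>v. Ck k (ddir v f))"
    by (auto simp: differentiable_def)
next
  assume r: "(\<forall>z. f differentiable (at z)) \<and> (\<forall>v. Ck k (ddir v f))"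
  then have "\<forall>z\<in>UNIV. (f has_derivative frechet_derivative f (at z)) (at z within UNIV)"
    by (simp add: frechet_derivative_works)
  moreover have "\<forall>v. Ck k (\<lambda>z. frechet_derivative f (at z) v)"
    using r unfolding ddir_def by simp
  ultimately show "Ck (Suc k) f" unfolding Ck_on.simps
    by (intro exI[of _ "\<lambda>z. frechet_derivative f (at z)"] conjI)
qed

lemma Ck_SucI:
  assumes "\<And>z. (f has_derivative f' z) (at z)" "\<And>v. Ck k (\<lambda>z. f' z v)"
  shows "Ck (Suc k) f"
  using assms by auto

declare Ck_on.simps(2) [simp del]

lemma Ck_continuous: "Ck k f \<Longrightarrow> continuous_on UNIV f"
  by (cases k) (auto simp: Ck_Suc_iff differentiable_imp_continuous_within continuous_at_imp_continuous_on)

lemma Ck_Suc_imp: "Ck (Suc k) f \<Longrightarrow> Ck k f"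
proof (induction k arbitrary: f)
  case 0
  then show ?case using Ck_continuous by fastforce
next
  case (Suc k)
  then show ?case using Ck_Suc_iff by blast
qed

lemma Ck_const: "Ck k (\<lambda>z. c)"
proof (induction k arbitrary: c)
  case (Suc k)
  show ?case by (rule Ck_SucI[where f' = "\<lambda>z v. 0"]) (auto intro: Suc)
qed simp

lemma Ck_bounded_linear_comp:
  assumes "bounded_linear L" "Ck k f"
  shows "Ck k (\<lambda>z. L (f z))"
  using assms(2)
proof (induction k arbitrary: f)
  case 0
  then show ?case using assms(1) linear_continuous_on_compose by (auto intro: linear_continuous_on_compose bounded_linear.continuous_on)
next
  case (Suc k)
  have d: "(f has_derivative frechet_derivative f (at z)) (at z)" for z
    using Suc.prems Ck_Suc_iff frechet_derivative_works by blast
  show ?case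
  proof (rule Ck_SucI[where f' = "\<lambda>z v. L (frechet_derivative f (at z) v)"])
    show "((\<lambda>z. L (f z)) has_derivative (\<lambda>v. L (frechet_derivative f (at z) v))) (at z)" for z
      using bounded_linear.has_derivative[OF assms(1) d] .
    show "Ck k (\<lambda>z. L (frechet_derivative f (at z) v))" for v
      using Suc.IH[of "ddir v f"] Suc.prems unfolding Ck_Suc_iff ddir_def by blast
  qed
qed

lemma Ck_add: "Ck k f \<Longrightarrow> Ck k g \<Longrightarrow> Ck k (\<lambda>z. f z + g z)"
proof (induction k arbitrary: f g)
  case 0
  then show ?case by (auto intro: continuous_on_add)
next
  case (Suc k)
  have d: "(f has_derivative frechet_derivative f (at z)) (at z)"
     "(g has_derivative frechet_derivative g (at z)) (at z)" for z
    using Suc.prems Ck_Suc_iff frechet_derivative_works by blast+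
  show ?case
  proof (rule Ck_SucI)
    show "((\<lambda>z. f z + g z) has_derivative (\<lambda>v. frechet_derivative f (at z) v + frechet_derivative g (at z) v)) (at z)" for z
      by (intro has_derivative_add d)
    show "Ck k (\<lambda>z. frechet_derivative f (at z) v + frechet_derivative g (at z) v)" for v
      using Suc.IH[of "ddir v f" "ddir v g"] Suc.prems unfolding Ck_Suc_iff ddir_def by blast
  qed
qed

lemma Ck_scaleR:
  fixes f :: "'a::euclidean_space \<Rightarrow> real"
  shows "Ck k f \<Longrightarrow> Ck k g \<Longrightarrow> Ck k (\<lambda>z. f z *\<^sub>R g z)"
proof (induction k arbitrary: f g)
  case 0
  then show ?case by (auto intro: continuous_on_scaleR)
next
  case (Suc k)
  have d: "(f has_derivative frechet_derivative f (at z)) (at z)"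
     "(g has_derivative frechet_derivative g (at z)) (at z)" for z
    using Suc.prems Ck_Suc_iff frechet_derivative_works by blast+
  show ?case
  proof (rule Ck_SucI)
    show "((\<lambda>z. f z *\<^sub>R g z) has_derivative (\<lambda>v. f z *\<^sub>R frechet_derivative g (at z) v + frechet_derivative f (at z) v *\<^sub>R g z)) (at z)" for z
      by (intro has_derivative_scaleR d)
    show "Ck k (\<lambda>z. f z *\<^sub>R frechet_derivative g (at z) v + frechet_derivative f (at z) v *\<^sub>R g z)" for v
    proof (rule Ck_add)
      have *: "Ck k f" "Ck k g" "Ck k (ddir v f)" "Ck k (ddir v g)"
        using Suc.prems Ck_Suc_imp Ck_Suc_iff by blast+
      show "Ck k (\<lambda>z. f z *\<^sub>R frechet_derivative g (at z) v)" 
        using Suc.IH[of f "ddir v g"] * unfolding ddir_def by blast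
      show "Ck k (\<lambda>z. frechet_derivative f (at z) v *\<^sub>R g z)"
        using Suc.IH[of "ddir v f" g] * unfolding ddir_def by blast
    qed
  qed
qed

text \<open>The derivative contains \<open>ddir 1 h\<close> composed with \<open>f\<close>, hence
  the induction runs over all \<open>f\<close> and \<open>h\<close> together. The outer functions
  that occur are the bump profile, the sine and the cosine, all on the real line.\<close>

lemma Ck_compose_real:
  fixes f :: "'a::euclidean_space \<Rightarrow> real" and h :: "real \<Rightarrow> real"
  shows "Ck k h \<Longrightarrow> Ck k f \<Longrightarrow> Ck k (\<lambda>z. h (f z))"
proof (induction k arbitrary: f h)
  case 0
  then show ?case by (auto intro: continuous_on_compose2)
next
  case (Suc k)
  have d: "(f has_derivative frechet_derivative f (at z)) (at z)" for z
    using Suc.prems Ck_Suc_iff frechet_derivative_works by blast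
  have h: "(h has_derivative frechet_derivative h (at z)) (at z)" for z
    using Suc.prems Ck_Suc_iff frechet_derivative_works by blast
  have h2: "frechet_derivative h (at z) t = t *\<^sub>R ddir 1 h z" for z t
    using linear_cmul[OF has_derivative_linear[OF h], of z t 1] by (simp add: ddir_def)
  show ?case
  proof (rule Ck_SucI)
    show "((\<lambda>z. h (f z)) has_derivative (\<lambda>v. frechet_derivative f (at z) v *\<^sub>R ddir 1 h (f z))) (at z)" for z
      using has_derivative_compose[OF d h] unfolding h2 .
    have *: "Ck k f" "Ck k (ddir v f)" "Ck k (ddir 1 h)" for v
        using Suc.prems Ck_Suc_imp Ck_Suc_iff by blast+
    show "Ck k (\<lambda>z. frechet_derivative f (at z) v *\<^sub>R ddir 1 h (f z))" for v
      using Ck_scaleR[OF *(2) Suc.IH[OF *(3) *(1)]] unfolding ddir_def .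
  qed
qed

lemma Ck_translate: "Ck k f \<Longrightarrow> Ck k (\<lambda>z. f (z + c))"
proof (induction k arbitrary: f)
  case 0
  then show ?case by (auto intro!: continuous_on_compose2[of UNIV f] continuous_intros)
next
  case (Suc k)
  have d: "(f has_derivative frechet_derivative f (at z)) (at z)" for z
    using Suc.prems Ck_Suc_iff frechet_derivative_works by blast
  show ?case
  proof (rule Ck_SucI)
    have "((\<lambda>z. z + c) has_derivative (\<lambda>v. v)) (at z)" for z
      by (auto intro!: derivative_eq_intros)
    from has_derivative_compose[OF this d]
    show "((\<lambda>z. f (z + c)) has_derivative (\<lambda>v. frechet_derivative f (at (z + c)) v)) (at z)" for z
      by simp
    show "Ck k (\<lambda>z. frechet_derivative f (at (z + c)) v)" for v
      using Suc.IH[of "ddir v f"] Suc.prems unfolding Ck_Suc_iff ddir_def by blast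
  qed
qed

lemma Ck_bounded_linear: "bounded_linear L \<Longrightarrow> Ck k L"
proof (cases k)
  case 0
  then show "bounded_linear L \<Longrightarrow> ?thesis" by (simp add: linear_continuous_on)
next
  case (Suc j)
  assume L: "bounded_linear L"
  show ?thesis unfolding Suc
    by (rule Ck_SucI[where f' = "\<lambda>z v. L v"])
       (use L in \<open>auto intro!: bounded_linear_imp_has_derivative Ck_const\<close>)
qed

lemma ddir_cong:
  assumes "open S" "z \<in> S" "\<And>y. y \<in> S \<Longrightarrow> f y = g y"
  shows "ddir v f z = ddir v g z"
proof -
  have "(f has_derivative D) (at z) \<longleftrightarrow> (g has_derivative D) (at z)" for D
    using has_derivative_transform_within_open[OF _ assms(1,2), of f D UNIV g]
      has_derivative_transform_within_open[OF _ assms(1,2), of g D UNIV f] assms(3) by auto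
  then show ?thesis unfolding ddir_def frechet_derivative_def by simp
qed

text \<open>Serves the periodisation below, where one function agrees with different translates of a
  smooth function near different points.\<close>

lemma Ck_locally:
  assumes "\<And>z. \<exists>S g. open S \<and> z \<in> S \<and> Ck k g \<and> (\<forall>y\<in>S. f y = g y)"
  shows "Ck k f"
  using assms
proof (induction k arbitrary: f)
  case 0
  have "isCont f z" for z
  proof -
    obtain S g where S: "open S" "z \<in> S" "continuous_on UNIV g" "\<forall>y\<in>S. f y = g y"
      using 0[of z] by auto
    then have "continuous_on S f"
      using continuous_on_cong[of S S f g] continuous_on_subset by blast
    then show ?thesis using S continuous_on_eq_continuous_at by blast
  qed
  then show ?case by (simp add: continuous_at_imp_continuous_on)
next
  case (Suc k)
  show ?case unfolding Ck_Suc_iff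
  proof (intro conjI allI)
    fix z
    obtain S g where S: "open S" "z \<in> S" "Ck (Suc k) g" "\<forall>y\<in>S. f y = g y"
      using Suc.prems[of z] by auto
    then obtain D where "(g has_derivative D) (at z)"
      unfolding Ck_Suc_iff differentiable_def by blast
    then have "(f has_derivative D) (at z)"
      using has_derivative_transform_within_open[OF _ S(1,2), of g D UNIV f] S(4) by auto
    then show "f differentiable at z" unfolding differentiable_def by blast
  next
    fix v
    show "Ck k (ddir v f)"
    proof (rule Suc.IH)
      fix z
      obtain S g where S: "open S" "z \<in> S" "Ck (Suc k) g" "\<forall>y\<in>S. f y = g y"
        using Suc.prems[of z] by auto
      have "\<forall>y\<in>S. ddir v f y = ddir v g y"
        using ddir_cong[OF S(1), of _ f g v] S(4) by blast
      then show "\<exists>S g. open S \<and> z \<in> S \<and> Ck k g \<and> (\<forall>y\<in>S. ddir v f y = g y)"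
        using S(1,2,3) unfolding Ck_Suc_iff by blast
    qed
  qed
qed

section \<open>Calculus of smooth functions\<close>

lemma smooth_iff: "smooth f \<longleftrightarrow> (\<forall>k. Ck k f)"
  by (simp add: smooth_fun_on_def)

lemma smooth_differentiable: "smooth f \<Longrightarrow> f differentiable (at z)"
  unfolding smooth_iff using Ck_Suc_iff by blast

lemma smooth_has_derivative: "smooth f \<Longrightarrow> (f has_derivative (\<lambda>v. ddir v f z)) (at z)"
  unfolding ddir_def using smooth_differentiable frechet_derivative_works by blast

lemma smooth_ddir: "smooth f \<Longrightarrow> smooth (ddir v f)"
  unfolding smooth_iff using Ck_Suc_iff by blast

lemma smooth_continuous: "smooth f \<Longrightarrow> continuous_on S f"
  unfolding smooth_iff using Ck_continuous continuous_on_subset by blast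

lemma smooth_const: "smooth (\<lambda>z. c)"
  by (simp add: smooth_iff Ck_const)
lemma smooth_add: "smooth f \<Longrightarrow> smooth g \<Longrightarrow> smooth (\<lambda>z. f z + g z)"
  by (simp add: smooth_iff Ck_add)
lemma smooth_bounded_linear_comp: "bounded_linear L \<Longrightarrow> smooth f \<Longrightarrow> smooth (\<lambda>z. L (f z))"
  by (simp add: smooth_iff Ck_bounded_linear_comp)
lemma smooth_scaleR: "smooth f \<Longrightarrow> smooth g \<Longrightarrow> smooth (\<lambda>z. f z *\<^sub>R g z)"
  by (simp add: smooth_iff Ck_scaleR)
lemma smooth_mult: 
  fixes f g :: "'a::euclidean_space \<Rightarrow> real"
  shows "smooth f \<Longrightarrow> smooth g \<Longrightarrow> smooth (\<lambda>z. f z * g z)"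
  using smooth_scaleR[of f g] by simp
lemma smooth_compose_real:
  fixes f :: "'a::euclidean_space \<Rightarrow> real" and h :: "real \<Rightarrow> real"
  shows "smooth h \<Longrightarrow> smooth f \<Longrightarrow> smooth (\<lambda>z. h (f z))"
  by (simp add: smooth_iff Ck_compose_real)
lemma smooth_bounded_linear: "bounded_linear L \<Longrightarrow> smooth L"
  by (simp add: smooth_iff Ck_bounded_linear)
lemma smooth_translate: "smooth f \<Longrightarrow> smooth (\<lambda>z. f (z + c))"
  by (simp add: smooth_iff Ck_translate)
lemma smooth_locally:
  assumes "\<And>z. \<exists>S g. open S \<and> z \<in> S \<and> smooth g \<and> (\<forall>y\<in>S. f y = g y)"
  shows "smooth f"
  unfolding smooth_iff
proof
  fix k show "Ck k f"
  proof (rule Ck_locally)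
    fix z 
    show "\<exists>S g. open S \<and> z \<in> S \<and> Ck k g \<and> (\<forall>y\<in>S. f y = g y)"
      using assms[of z] unfolding smooth_iff by blast
  qed
qed
lemma smooth_minus: "smooth f \<Longrightarrow> smooth (\<lambda>z. - f z)"
  by (rule smooth_bounded_linear_comp[OF bounded_linear_minus[OF bounded_linear_ident]])
lemma smooth_diff: "smooth f \<Longrightarrow> smooth g \<Longrightarrow> smooth (\<lambda>z. f z - g z)"
  using smooth_add[OF _ smooth_minus, of f g] by simp

lemma ddir_add: "smooth f \<Longrightarrow> smooth g \<Longrightarrow> ddir v (\<lambda>z. f z + g z) = (\<lambda>z. ddir v f z + ddir v g z)"
  by (rule ext, rule ddir_eqI, rule has_derivative_add) (rule smooth_has_derivative, assumption)+

lemma ddir_bounded_linear_comp: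
  "bounded_linear L \<Longrightarrow> smooth f \<Longrightarrow> ddir v (\<lambda>z. L (f z)) = (\<lambda>z. L (ddir v f z))"
  by (rule ext, rule ddir_eqI, rule bounded_linear.has_derivative) (assumption, rule smooth_has_derivative)

lemma ddir_mult:
  fixes f g :: "'a::euclidean_space \<Rightarrow> real"
  shows "smooth f \<Longrightarrow> smooth g \<Longrightarrow> ddir v (\<lambda>z. f z * g z) = (\<lambda>z. ddir v f z * g z + f z * ddir v g z)"
  using ddir_eqI[OF has_derivative_mult[OF smooth_has_derivative smooth_has_derivative], of f g v]
  by (auto simp: fun_eq_iff)

lemma ddir_linear: "smooth f \<Longrightarrow> linear (\<lambda>v. ddir v f z)"
  using smooth_has_derivative has_derivative_linear by blast

lemma ddir_const: "ddir v (\<lambda>z. c) = (\<lambda>z. 0)"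
  by (intro ext ddir_eqI) simp

text \<open>All members gain one order at once: if every \<open>F j\<close> is C^k, so is each
  derivative \<open>F' i\<close>, and then every \<open>F i\<close> is C^(k+1). No closed formula
  for higher derivatives is needed.\<close>

lemma Ck_real_family:
  fixes F :: "'i \<Rightarrow> real \<Rightarrow> real"
  assumes "\<And>i x. (F i has_real_derivative F' i x) (at x)"
    and "\<And>i k. (\<And>j. Ck k (F j)) \<Longrightarrow> Ck k (F' i)"
  shows "smooth (F i)"
proof -
  have "Ck k (F i)" for k
  proof (induction k arbitrary: i)
    case 0
    have "isCont (F i) x" for x using assms(1) DERIV_isCont by blast
    then show ?case by (simp add: continuous_at_imp_continuous_on)
  next
    case (Suc k)
    show ?case
    proof (rule Ck_SucI)
      show "(F i has_derivative (\<lambda>v. v *\<^sub>R F' i x)) (at x)" for x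
      proof -
        have "(\<lambda>v. v *\<^sub>R F' i x) = (*) (F' i x)" by (auto simp: mult.commute)
        then show ?thesis using assms(1)[of i x] unfolding has_field_derivative_def by simp
      qed
      show "Ck k (\<lambda>x. v *\<^sub>R F' i x)" for v
        by (rule Ck_scaleR[OF Ck_const assms(2)[OF Suc]])
    qed
  qed
  then show ?thesis by (simp add: smooth_iff)
qed

lemma smooth_sin: "smooth (sin :: real \<Rightarrow> real)" and smooth_cos: "smooth (cos :: real \<Rightarrow> real)"
proof -
  \<comment> \<open>Differentiating the sine is a shift by a quarter period, so these shifts form a
    family closed under differentiation; the members 0 and 1 are sine and cosine.\<close>
  define F :: "nat \<Rightarrow> real \<Rightarrow> real" where "F = (\<lambda>i x. sin (x + real i * pi / 2))"
  have shift: "cos (x + real i * pi/2) = F (Suc i) x" for i x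
  proof -
    have "x + real (Suc i) * pi / 2 = (x + real i * pi/2) + pi/2" by (simp add: field_simps)
    then show ?thesis unfolding F_def by (simp only: sin_add[of _ "pi/2"]) simp
  qed
  have "smooth (F i)" for i
  proof (rule Ck_real_family[where F' = "\<lambda>i. F (Suc i)"])
    fix i x show "(F i has_real_derivative F (Suc i) x) (at x)"
      unfolding F_def by (auto intro!: derivative_eq_intros) (use shift[of x i] in \<open>simp add: F_def\<close>)
  qed
  from this[of 0] this[of 1] show "smooth (sin :: real \<Rightarrow> real)" "smooth (cos :: real \<Rightarrow> real)"
    unfolding F_def by (simp_all add: sin_add)
qed

section \<open>Derivatives along lines and the symmetry of mixed derivatives\<close>

lemma smooth_has_line_derivative:
  assumes "smooth f"
  shows "((\<lambda>t. f (z + t *\<^sub>R v)) has_vector_derivative ddir v f (z + t *\<^sub>R v)) (at t within S)"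
proof -
  have "((\<lambda>t. z + t *\<^sub>R v) has_derivative (\<lambda>h. h *\<^sub>R v)) (at t)"
    by (auto intro!: derivative_eq_intros)
  from has_derivative_compose[OF this smooth_has_derivative[OF assms]]
  have "((\<lambda>t. f (z + t *\<^sub>R v)) has_derivative (\<lambda>h. h *\<^sub>R ddir v f (z + t *\<^sub>R v))) (at t)"
    by (simp add: linear_cmul[OF ddir_linear[OF assms]])
  then show ?thesis unfolding has_vector_derivative_def by (rule has_derivative_at_withinI)
qed

lemma line_mean_value:
  fixes f :: "'a::euclidean_space \<Rightarrow> real"
  assumes "smooth f" "0 < h"
  obtains s where "0 < s" "s < h" "f (z + h *\<^sub>R v) - f z = h * ddir v f (z + s *\<^sub>R v)"
proof -
  have "\<exists>s. s > 0 \<and> s < h \<and> f (z + h *\<^sub>R v) - f (z + 0 *\<^sub>R v) = (h - 0) * ddir v f (z + s *\<^sub>R v)"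
    using smooth_has_line_derivative[OF assms(1), of z v]
    by (intro MVT2) (auto simp: assms has_real_derivative_iff_has_vector_derivative)
  then show ?thesis using that by auto
qed

lemma ddir_translate: "smooth f \<Longrightarrow> ddir v (\<lambda>z. f (z + k)) = (\<lambda>z. ddir v f (z + k))"
proof (rule ext, rule ddir_eqI)
  fix z assume f: "smooth f"
  have "((\<lambda>z. z + k) has_derivative (\<lambda>v. v)) (at z)" by (auto intro!: derivative_eq_intros)
  from has_derivative_compose[OF this smooth_has_derivative[OF f]]
  show "((\<lambda>z. f (z + k)) has_derivative (\<lambda>v. ddir v f (z + k))) (at z)" .
qed

text \<open>Both mixed derivatives are limits of the same second-order difference quotient.\<close>

lemma ddir_commute:
  fixes f :: "'a::euclidean_space \<Rightarrow> real"
  assumes f: "smooth f"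
  shows "ddir u (ddir v f) = ddir v (ddir u f)"
proof
  fix z
  define \<Delta> where "\<Delta> h = f (z + h *\<^sub>R u + h *\<^sub>R v) - f (z + h *\<^sub>R u) - f (z + h *\<^sub>R v) + f z" for h
  \<comment> \<open>Two applications of the mean value theorem: along \<open>v\<close> for the
    increment of \<open>f\<close> in direction \<open>h *\<^sub>R u\<close>, then along
    \<open>u\<close> for the increment of \<open>ddir v f\<close>.\<close>
  have key: "\<exists>s t. 0 < s \<and> s < h \<and> 0 < t \<and> t < h \<and>
      f (z + h *\<^sub>R u + h *\<^sub>R v) - f (z + h *\<^sub>R u) - f (z + h *\<^sub>R v) + f z = h * h * ddir u (ddir v f) (z + s *\<^sub>R v + t *\<^sub>R u)"
    if hpos: "h > 0" for h u v
  proof -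
    have sm: "smooth (\<lambda>z. f (z + h *\<^sub>R u) - f z)"
      by (intro smooth_diff smooth_translate f)
    obtain s where s: "0 < s" "s < h" 
      "(f (z + h *\<^sub>R v + h *\<^sub>R u) - f (z + h *\<^sub>R v)) - (f (z + h *\<^sub>R u) - f z) = h * ddir v (\<lambda>z. f (z + h *\<^sub>R u) - f z) (z + s *\<^sub>R v)"
      by (rule line_mean_value[OF sm hpos])
    have d: "ddir v (\<lambda>z. f (z + h *\<^sub>R u) - f z) y = ddir v f (y + h *\<^sub>R u) - ddir v f y" for y
      using ddir_add[OF smooth_translate[OF f] smooth_minus[OF f], of v "h *\<^sub>R u"]
        ddir_bounded_linear_comp[OF bounded_linear_minus[OF bounded_linear_ident] f, of v]
      by (simp add: ddir_translate[OF f] fun_eq_iff)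
    obtain t where t: "0 < t" "t < h" "ddir v f (z + s *\<^sub>R v + h *\<^sub>R u) - ddir v f (z + s *\<^sub>R v) = h * ddir u (ddir v f) (z + s *\<^sub>R v + t *\<^sub>R u)"
      by (rule line_mean_value[OF smooth_ddir[OF f] hpos])
    show ?thesis
      using s t unfolding d by (intro exI[of _ s] exI[of _ t]) (simp add: algebra_simps)
  qed
  have lim: "\<exists>D. (\<forall>n::nat. D n = \<Delta> (1 / real (Suc n)) / (1 / real (Suc n) * (1 / real (Suc n)))) \<and> D \<longlonglongrightarrow> ddir u (ddir v f) z"
    if \<Delta>: "\<And>h. \<Delta> h = f (z + h *\<^sub>R u + h *\<^sub>R v) - f (z + h *\<^sub>R u) - f (z + h *\<^sub>R v) + f z" for u v
  proof -
    define h where "h n = 1 / real (Suc n)" for n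
    have h: "h n > 0" for n by (simp add: h_def)
    have h0: "h \<longlonglongrightarrow> 0" unfolding h_def by (rule LIMSEQ_Suc) (rule lim_1_over_n)
    have "\<forall>n. \<exists>s t. 0 < s \<and> s < h n \<and> 0 < t \<and> t < h n \<and> \<Delta> (h n) = h n * h n * ddir u (ddir v f) (z + s *\<^sub>R v + t *\<^sub>R u)"
      using key[OF h] unfolding \<Delta> by blast
    then obtain s t where st: "\<And>n. 0 < s n \<and> s n < h n \<and> 0 < t n \<and> t n < h n \<and> \<Delta> (h n) = h n * h n * ddir u (ddir v f) (z + s n *\<^sub>R v + t n *\<^sub>R u)"
      by metis
    have "s \<longlonglongrightarrow> 0" "t \<longlonglongrightarrow> 0"
      by (rule tendsto_sandwich[OF _ _ tendsto_const h0], use st in \<open>auto intro: always_eventually less_imp_le\<close>)+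
    then have "(\<lambda>n. z + s n *\<^sub>R v + t n *\<^sub>R u) \<longlonglongrightarrow> z"
      by (auto intro!: tendsto_eq_intros)
    moreover have "isCont (ddir u (ddir v f)) z"
      using smooth_continuous[OF smooth_ddir[OF smooth_ddir[OF f]], of UNIV] continuous_on_eq_continuous_at by blast
    ultimately have "(\<lambda>n. ddir u (ddir v f) (z + s n *\<^sub>R v + t n *\<^sub>R u)) \<longlonglongrightarrow> ddir u (ddir v f) z"
      using isCont_tendsto_compose by blast
    moreover have "ddir u (ddir v f) (z + s n *\<^sub>R v + t n *\<^sub>R u) = \<Delta> (h n) / (h n * h n)" for n
      using st[of n] h[of n] by simp
    ultimately show ?thesis unfolding h_def by auto
  qed
  \<comment> \<open>\<open>\<Delta>\<close> is symmetric in \<open>u\<close> and \<open>v\<close>,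
    so one sequence of quotients has both mixed derivatives as its limit.\<close>
  obtain D where D: "\<And>n::nat. D n = \<Delta> (1 / real (Suc n)) / (1 / real (Suc n) * (1 / real (Suc n)))" "D \<longlonglongrightarrow> ddir u (ddir v f) z"
    using lim[OF \<Delta>_def] by blast
  obtain D' where D': "\<And>n::nat. D' n = \<Delta> (1 / real (Suc n)) / (1 / real (Suc n) * (1 / real (Suc n)))" "D' \<longlonglongrightarrow> ddir v (ddir u f) z"
    using lim[of v u] unfolding \<Delta>_def by (auto simp: algebra_simps)
  have "D = D'" using D D' by auto
  then show "ddir u (ddir v f) z = ddir v (ddir u f) z"
    using D(2) D'(2) LIMSEQ_unique by blast
qed

subsection \<open>A bump function\<close>

text \<open>\<open>flat 0\<close> is the classical function that vanishes to infinite order at 0.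
  The powers in the denominator are carried along because its derivatives are combinations of these
  functions.\<close>

definition flat :: "nat \<Rightarrow> real \<Rightarrow> real" where
  "flat k x = (if x > 0 then exp (- 1 / x) / x ^ k else 0)"

text \<open>A single term \<open>(1/x) ^ k / fact k\<close> of the exponential series lies below
  \<open>exp (1/x)\<close>.\<close>

lemma flat_le: "flat k x \<le> fact k" and flat_nonneg: "0 \<le> flat k x"
proof -
  show "0 \<le> flat k x" by (simp add: flat_def)
  show "flat k x \<le> fact k"
  proof (cases "x > 0")
    case True
    have "(1/x) ^ k / fact k \<le> exp (1 / x)"
    proof -
      have "(\<Sum>n\<in>{k}. (1/x) ^ n /\<^sub>R fact n) \<le> (\<Sum>n. (1/x) ^ n /\<^sub>R fact n)"
        by (rule sum_le_suminf) (use True summable_exp[of "1/x"] in \<open>auto\<close>)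
      then show ?thesis by (simp add: exp_def field_simps)
    qed
    then have "exp (- 1 / x) * ((1/x) ^ k / fact k) \<le> exp (- 1 / x) * exp (1/x)"
      by (intro mult_left_mono) auto
    also have "\<dots> = 1" by (simp flip: exp_add)
    finally show ?thesis using True by (simp add: flat_def field_simps power_one_over)
  qed (simp add: flat_def)
qed

lemma flat_has_derivative:
  "(flat k has_real_derivative flat (k + 2) x - real k * flat (k + 1) x) (at x)"
proof -
  consider "x > 0" | "x < 0" | "x = 0" by linarith
  then show ?thesis
  proof cases
    case 1
    have "((\<lambda>x. exp (- 1 / x) / x ^ k) has_real_derivative flat (k + 2) x - real k * flat (k + 1) x) (at x)"
    proof (cases k)
      case 0
      then show ?thesis using 1 by (auto intro!: derivative_eq_intros simp: flat_def power2_eq_square)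
    next
      case (Suc j)
      have "j = 0 \<or> x ^ j = x * x ^ (j - Suc 0)" by (cases j) auto
      with Suc show ?thesis using 1
        by (auto intro!: derivative_eq_intros simp: flat_def divide_simps power2_eq_square algebra_simps)
    qed
    then show ?thesis
      by (rule has_field_derivative_transform_within_open[where S = "{0<..}"]) (use 1 in \<open>auto simp: flat_def\<close>)
  next
    case 2
    have "((\<lambda>x. 0) has_real_derivative flat (k + 2) x - real k * flat (k + 1) x) (at x)"
      using 2 by (auto simp: flat_def)
    then show ?thesis
      by (rule has_field_derivative_transform_within_open[where S = "{..<0}"]) (use 2 in \<open>auto simp: flat_def\<close>)
  next
    case 3
    \<comment> \<open>For positive \<open>h\<close> the quotient \<open>flat k h / h\<close> equals
      \<open>flat (k + 2) h * h\<close>, and the first factor is bounded by \<open>flat_le\<close>;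
      so the difference quotient at 0 tends to 0.\<close>
    have b: "\<bar>flat k h / h\<bar> \<le> fact (k + 2) * \<bar>h\<bar>" for h
    proof (cases "h > 0")
      case True
      have "flat k h / h = flat (k + 2) h * h" using True by (simp add: flat_def field_simps)
      then show ?thesis using flat_le[of "k+2" h] flat_nonneg[of "k+2" h] by (simp add: abs_mult mult_right_mono)
    next
      case False
      then have "flat k h = 0" by (simp add: flat_def)
      moreover have "0 \<le> fact (k + 2) * \<bar>h\<bar>" by (intro mult_nonneg_nonneg) (auto simp del: fact_Suc)
      ultimately show ?thesis by (simp del: fact_Suc)
    qed
    have "(\<lambda>h. flat k h / h) \<midarrow>0\<rightarrow> 0"
      by (rule Lim_null_comparison[where g = "\<lambda>h. fact (k+2) * \<bar>h\<bar>"])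
         (use b in \<open>auto intro!: always_eventually tendsto_eq_intros\<close>)
    then show ?thesis unfolding 3 DERIV_def by (simp add: flat_def)
  qed
qed

lemma smooth_flat: "smooth (flat k)"
proof (rule Ck_real_family[OF flat_has_derivative])
  fix i m assume "\<And>j. Ck m (flat j)"
  then have "Ck m (\<lambda>x. flat (i + 2) x + (- real i) *\<^sub>R flat (i + 1) x)"
    by (intro Ck_add Ck_bounded_linear_comp[OF bounded_linear_scaleR_right])
  then show "Ck m (\<lambda>x. flat (i + 2) x - real i * flat (i + 1) x)"
    by simp
qed

definition bump :: "'a::euclidean_space \<Rightarrow> real \<Rightarrow> 'a \<Rightarrow> real" where
  "bump c r z = flat 0 (1 - ((z - c) \<bullet> (z - c)) / r\<^sup>2)"

lemma smooth_inner_self: "smooth (\<lambda>z::'a::euclidean_space. (z - c) \<bullet> (z - c))"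
proof -
  \<comment> \<open>One order is given away, so that only the directional derivatives have to be
    C^k, and these are affine.\<close>
  have "Ck k (\<lambda>z::'a. (z - c) \<bullet> (z - c))" for k
  proof (rule Ck_Suc_imp, rule Ck_SucI)
    show "((\<lambda>z::'a. (z - c) \<bullet> (z - c)) has_derivative (\<lambda>v. 2 * ((z - c) \<bullet> v))) (at z)" for z
      by (auto intro!: derivative_eq_intros simp: inner_commute)
    show "Ck k (\<lambda>z. 2 * ((z - c) \<bullet> v))" for v
      using Ck_add[OF Ck_bounded_linear[of "\<lambda>z. 2 * (z \<bullet> v)"] Ck_const, of k "- 2 * (c \<bullet> v)"]
      by (simp add: inner_diff_left algebra_simps bounded_linear_mult_left[THEN bounded_linear_compose] bounded_linear_inner_left)
  qed
  then show ?thesis by (simp add: smooth_iff)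
qed

lemma smooth_bump: "smooth (bump c r)"
  unfolding bump_def[abs_def] divide_inverse
  by (rule smooth_compose_real[OF smooth_flat])
     (intro smooth_diff smooth_const smooth_bounded_linear_comp[OF bounded_linear_mult_left] smooth_inner_self)

lemma bump_nonneg: "0 \<le> bump c r z" and bump_le_1: "bump c r z \<le> 1"
  using flat_nonneg[of 0] flat_le[of 0] by (auto simp: bump_def)

lemma bump_outside:
  assumes "z \<notin> cball c r" "r > 0" shows "bump c r z = 0"
proof -
  have "r\<^sup>2 \<le> (dist c z)\<^sup>2" by (rule power_mono) (use assms in auto)
  then have "r\<^sup>2 \<le> (z - c) \<bullet> (z - c)" by (simp add: dist_norm norm_minus_commute[of c] power2_norm_eq_inner)
  then have "1 \<le> (z - c) \<bullet> (z - c) / r\<^sup>2" using assms by simp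
  then show ?thesis by (simp add: bump_def flat_def)
qed

lemma bump_inside:
  assumes "z \<in> ball c (r / 2)" "r > 0" shows "exp (- 2) \<le> bump c r z"
proof -
  have "(dist c z)\<^sup>2 \<le> (r / 2)\<^sup>2" by (rule power_mono) (use assms in auto)
  then have "(z - c) \<bullet> (z - c) \<le> r\<^sup>2 / 4" by (simp add: dist_norm norm_minus_commute[of c] power2_norm_eq_inner power_divide)
  then have *: "(z - c) \<bullet> (z - c) / r\<^sup>2 \<le> 1/4" using assms by (simp add: divide_simps)
  define y where "y = 1 - (z - c) \<bullet> (z - c) / r\<^sup>2"
  have y: "y \<ge> 3/4" using * by (simp add: y_def)
  \<comment> \<open>The exact bound is 4/3; the rounder 2 leads to the \<open>exp (- 2)\<close> of
    the statement.\<close>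
  then have "1 / y \<le> 2" by (simp add: divide_simps)
  then show ?thesis using y by (simp add: bump_def flat_def flip: y_def)
qed

subsection \<open>Periodisation\<close>

text \<open>Composition with \<open>wrap\<close> makes any function periodic in space. It jumps
  wherever a coordinate is an integer, so smoothness survives only for functions supported away from
  the faces of the cell.\<close>

definition wrap :: "('n::finite) point \<Rightarrow> 'n point" where
  "wrap z = (fst z, \<chi> i. frac (snd z $ i))"

definition open_cell :: "('n::finite) point set" where
  "open_cell = {z. \<forall>i. 0 < snd z $ i \<and> snd z $ i < 1}"

lemma fst_wrap [simp]: "fst (wrap z) = fst z" by (simp add: wrap_def)

lemma wrap_axis: "wrap (t, x + axis i 1) = wrap (t, x)"
proof -
  have "frac ((x + axis i 1) $ j) = frac (x $ j)" for j
    by (cases "j = i") (auto simp: axis_def frac_1_eq)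
  then show ?thesis by (simp add: wrap_def)
qed

lemma open_halfspaces_point:
  fixes c :: real
  shows "open {z::('n::finite) point. snd z $ i < c}" "open {z::('n::finite) point. c < snd z $ i}"
  by (intro open_Collect_less continuous_intros)+

lemma open_open_cell: "open (open_cell :: ('n::finite) point set)"
proof -
  have "open_cell = (\<Inter>i\<in>UNIV. {z::'n point. 0 < snd z $ i} \<inter> {z. snd z $ i < 1})"
    by (auto simp: open_cell_def)
  moreover have "open \<dots>"
    by (intro open_INT open_Int open_halfspaces_point finite ballI)
  ultimately show ?thesis by simp
qed

lemma wrap_open_cell: "z \<in> open_cell \<Longrightarrow> wrap z = z"
  by (cases z) (auto simp: wrap_def open_cell_def vec_eq_iff frac_eq less_imp_le)

text \<open>If no coordinate of \<open>z\<close> is an integer, all floors are constant near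
  \<open>z\<close> and \<open>wrap\<close> is a translation. Otherwise some coordinate is an
  integer, nearby points wrap close to a face of the cell, and \<open>K\<close> keeps a positive
  distance from the faces.\<close>

lemma wrap_locally:
  fixes K :: "('n::finite) point set"
  assumes K: "compact K" "K \<subseteq> open_cell"
  obtains (shift) S k where "open S" "z \<in> S" "\<And>y. y \<in> S \<Longrightarrow> wrap y = y + k"
    | (away) S where "open S" "z \<in> S" "\<And>y. y \<in> S \<Longrightarrow> wrap y \<notin> K"
proof (cases "\<exists>i. snd z $ i \<in> \<int>")
  case False
  define S :: "'n point set" where "S = (\<Inter>i\<in>UNIV. {y. of_int \<lfloor>snd z $ i\<rfloor> < snd y $ i} \<inter> {y. snd y $ i < of_int \<lfloor>snd z $ i\<rfloor> + 1})"
  define k :: "'n point" where "k = (0, \<chi> i. - of_int \<lfloor>snd z $ i\<rfloor>)"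
  have "open S" unfolding S_def by (auto intro!: open_INT open_Int open_halfspaces_point)
  moreover have "of_int \<lfloor>snd z $ i\<rfloor> < snd z $ i" for i
    using False by (metis Ints_of_int floor_correct order_le_less)
  then have "z \<in> S" by (auto simp: S_def)
  moreover have "wrap y = y + k" if "y \<in> S" for y
  proof -
    have "\<lfloor>snd y $ i\<rfloor> = \<lfloor>snd z $ i\<rfloor>" for i
      using that by (intro floor_unique) (auto simp: S_def less_imp_le)
    then show ?thesis by (simp add: wrap_def k_def prod_eq_iff vec_eq_iff frac_def)
  qed
  ultimately show ?thesis using shift by blast
next
  case True
  then obtain i where i: "snd z $ i \<in> \<int>" by blast
  show ?thesis
  proof (cases "K = {}")
    case True
    then show ?thesis using away[of UNIV] by auto
  next
    case False
    have cont: "continuous_on K (\<lambda>y. snd y $ i)" by (intro continuous_intros)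
    obtain u where u: "u \<in> K" "\<And>y. y \<in> K \<Longrightarrow> snd u $ i \<le> snd y $ i"
      using continuous_attains_inf[OF K(1) False cont] by blast
    obtain v where v: "v \<in> K" "\<And>y. y \<in> K \<Longrightarrow> snd y $ i \<le> snd v $ i"
      using continuous_attains_sup[OF K(1) False cont] by blast
    \<comment> \<open>The distance of \<open>K\<close> from the two faces orthogonal to the i-th
      axis, attained by compactness.\<close>
    define \<delta> where "\<delta> = min (snd u $ i) (1 - snd v $ i)"
    have \<delta>: "\<delta> > 0" "\<And>y. y \<in> K \<Longrightarrow> \<delta> \<le> snd y $ i \<and> snd y $ i \<le> 1 - \<delta>"
      using u v K(2) by (force simp: \<delta>_def open_cell_def)+
    define S where "S = {y::'n point. snd z $ i - \<delta> < snd y $ i} \<inter> {y. snd y $ i < snd z $ i + \<delta>}"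
    have "open S" unfolding S_def by (intro open_Int open_halfspaces_point)
    moreover have "z \<in> S" using \<delta> by (simp add: S_def)
    moreover have "wrap y \<notin> K" if "y \<in> S" for y
    proof
      assume "wrap y \<in> K"
      then have "\<delta> \<le> frac (snd y $ i)" "frac (snd y $ i) \<le> 1 - \<delta>"
        using \<delta>(2)[of "wrap y"] by (auto simp: wrap_def)
      moreover obtain m where "snd z $ i = of_int m" using i Ints_cases by blast
      moreover have "of_int \<lfloor>snd y $ i\<rfloor> + frac (snd y $ i) = snd y $ i" by (simp add: frac_def)
      \<comment> \<open>These put the integer \<open>m\<close> strictly between
        \<open>\<lfloor>snd y $ i\<rfloor>\<close> and its successor.\<close>
      ultimately have "of_int m - \<delta> < of_int \<lfloor>snd y $ i\<rfloor> + (1 - \<delta>)"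
        "of_int \<lfloor>snd y $ i\<rfloor> + \<delta> < of_int m + \<delta>"
        using that unfolding S_def by auto
      then have "of_int m < (of_int (\<lfloor>snd y $ i\<rfloor> + 1) :: real)" "(of_int \<lfloor>snd y $ i\<rfloor> :: real) < of_int m"
        by auto
      then show False unfolding of_int_less_iff by linarith
    qed
    ultimately show ?thesis using away by blast
  qed
qed

lemma smooth_periodisation:
  fixes f :: "('n::finite) point \<Rightarrow> 'b::real_normed_vector"
  assumes "compact K" "K \<subseteq> open_cell" "smooth f" "\<And>z. z \<notin> K \<Longrightarrow> f z = 0"
  shows "smooth (\<lambda>z. f (wrap z))"
proof (rule smooth_locally)
  fix z :: "'n point"
  show "\<exists>S g. open S \<and> z \<in> S \<and> smooth g \<and> (\<forall>y\<in>S. f (wrap y) = g y)"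
  proof (rule wrap_locally[OF assms(1,2), of z])
    fix S k assume "open S" "z \<in> S" "\<And>y. y \<in> S \<Longrightarrow> wrap y = y + k"
    then show ?thesis using smooth_translate[OF assms(3), of k] by (intro exI[of _ S] exI[of _ "\<lambda>y. f (y + k)"]) auto
  next
    fix S assume "open S" "z \<in> S" "\<And>y. y \<in> S \<Longrightarrow> wrap y \<notin> K"
    then show ?thesis using smooth_const[of 0] assms(4) by (intro exI[of _ S] exI[of _ "\<lambda>y. 0"]) auto
  qed
qed

text \<open>The set is the union of all integer translates of \<open>K\<close>, which is unbounded,
  so closedness has to be checked locally. It will contain the supports of the periodised
  waves.\<close>

lemma closed_wrap_vimage:
  fixes K :: "('n::finite) point set"
  assumes "compact K" "K \<subseteq> open_cell"
  shows "closed {z. wrap z \<in> K}"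
proof -
  have "open (- {z. wrap z \<in> K})"
  proof (rule Topological_Spaces.openI)
    fix z :: "'n point" assume z: "z \<in> - {z. wrap z \<in> K}"
    show "\<exists>A. open A \<and> z \<in> A \<and> A \<subseteq> - {z. wrap z \<in> K}"
    proof (cases rule: wrap_locally[OF assms, of z])
      case S: (1 S k)
      have "closed {y. y + k \<in> K}"
        using continuous_closed_vimage[OF compact_imp_closed[OF assms(1)], of "\<lambda>y. y + k"]
        by (auto simp: vimage_def intro!: continuous_intros)
      then have "open (S \<inter> - {y. y + k \<in> K})" using S(1) by auto
      then show ?thesis using S z by (intro exI[of _ "S \<inter> - {y. y + k \<in> K}"]) auto
    next
      case (2 S)
      then show ?thesis by (intro exI[of _ S]) auto
    qed
  qed
  then show ?thesis by (simp add: closed_def)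
qed

subsection \<open>A potential for the linear system\<close>

lemma ddir_minus: "smooth f \<Longrightarrow> ddir v (\<lambda>z. - f z) = (\<lambda>z. - ddir v f z)"
  by (rule ddir_bounded_linear_comp[OF bounded_linear_minus[OF bounded_linear_ident]])
lemma ddir_diff: "smooth f \<Longrightarrow> smooth g \<Longrightarrow> ddir v (\<lambda>z. f z - g z) = (\<lambda>z. ddir v f z - ddir v g z)"
  using ddir_add[OF _ smooth_minus, of f g v] by (simp add: ddir_minus)
lemma ddir_cmult: 
  fixes f :: "'a::euclidean_space \<Rightarrow> real"
  shows "smooth f \<Longrightarrow> ddir v (\<lambda>z. c * f z) = (\<lambda>z. c * ddir v f z)"
  by (rule ddir_bounded_linear_comp[OF bounded_linear_mult_right])
lemma smooth_cmult: 
  fixes f :: "'a::euclidean_space \<Rightarrow> real"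
  shows "smooth f \<Longrightarrow> smooth (\<lambda>z. c * f z)"
  by (rule smooth_bounded_linear_comp[OF bounded_linear_mult_right])

lemma space_deriv_smooth: "smooth f \<Longrightarrow> space_deriv i f z = ddir (0, axis i 1) f z"
proof -
  assume f: "smooth f"
  have "(\<lambda>h. f (fst z, snd z + h *\<^sub>R axis i 1)) = (\<lambda>t. f (z + t *\<^sub>R (0, axis i 1)))"
    by (auto simp: plus_prod_def)
  with smooth_has_line_derivative[OF f, of z "(0, axis i 1)" 0 UNIV]
  show ?thesis unfolding space_deriv_def by (simp add: vector_derivative_at flip: zero_prod_def)
qed

text \<open>The derivative within \<open>{0..T}\<close> is one-sided at the end points; it is still
  unique because \<open>T > 0\<close>, and so it agrees with the full derivative of a function that
  is smooth on the whole space.\<close>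

lemma time_deriv_smooth:
  assumes "smooth f" "T > 0" "z \<in> slab T"
  shows "time_deriv T f z = ddir (1, 0) f z"
proof -
  have "((\<lambda>s. f (z + (s - fst z) *\<^sub>R (1,0))) has_vector_derivative ddir (1,0) f z) (at (fst z) within {0..T})"
  proof -
    have "((\<lambda>s. s - fst z) has_vector_derivative 1) (at (fst z) within {0..T})"
      by (auto intro!: derivative_eq_intros)
    from vector_diff_chain_within[OF this smooth_has_line_derivative[OF assms(1)], of z "(1, 0)"]
    show ?thesis by (simp add: o_def flip: zero_prod_def)
  qed
  moreover have "(\<lambda>s. f (z + (s - fst z) *\<^sub>R (1,0))) = (\<lambda>s. f (s, snd z))"
    by (auto simp: plus_prod_def)
  ultimately have "((\<lambda>s. f (s, snd z)) has_vector_derivative ddir (1,0) f z) (at (fst z) within {0..T})"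
    by simp
  then show ?thesis unfolding time_deriv_def
    using assms by (intro vector_derivative_within_cbox[unfolded box_real]) (auto simp: slab_def)
qed

lemma smooth_nth: "smooth V \<Longrightarrow> smooth (\<lambda>z. V z $ i)"
  by (rule smooth_bounded_linear_comp[OF bounded_linear_vec_nth])

lemma smooth_Pair:
  assumes "smooth f" "smooth g"
  shows "smooth (\<lambda>z. (f z, g z))"
proof -
  have "bounded_linear (\<lambda>x. (x, 0))" "bounded_linear (\<lambda>x. (0, x))"
    by (auto intro!: bounded_linear_Pair bounded_linear_ident bounded_linear_zero)
  from smooth_add[OF smooth_bounded_linear_comp[OF this(1) assms(1)] smooth_bounded_linear_comp[OF this(2) assms(2)]]
  show ?thesis by simp
qed

lemma smooth_fst: "smooth f \<Longrightarrow> smooth (\<lambda>z. fst (f z))"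
  by (rule smooth_bounded_linear_comp[OF bounded_linear_fst])
lemma smooth_snd: "smooth f \<Longrightarrow> smooth (\<lambda>z. snd (f z))"
  by (rule smooth_bounded_linear_comp[OF bounded_linear_snd])

text \<open>The linear part of the conditions in \<open>X0\<close>, isolated because it is preserved
  by sums while the other two conditions are not linear.\<close>

definition solves :: "real \<Rightarrow> (('n::finite) point \<Rightarrow> 'n state) \<Rightarrow> bool" where
  "solves T f \<longleftrightarrow> (\<forall>z\<in>slab T. vec_div (\<lambda>z. fst (f z)) z = 0 \<and>
     time_deriv T (\<lambda>z. fst (f z)) z + mat_div (\<lambda>z. snd (f z)) z = 0)"

text \<open>Passing to scalar components makes \<open>ddir_commute\<close>, which is about
  real-valued functions, applicable.\<close>

lemma solves_iff_ddir:
  assumes f: "smooth f" and T: "T > 0"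
  shows "solves T f \<longleftrightarrow> (\<forall>z\<in>slab T.
     (\<Sum>i\<in>UNIV. ddir (0, axis i 1) (\<lambda>y. fst (f y) $ i) z) = 0 \<and>
     (\<forall>i. ddir (1, 0) (\<lambda>y. fst (f y) $ i) z +
        (\<Sum>j\<in>UNIV. ddir (0, axis j 1) (\<lambda>y. snd (f y) $ i $ j) z) = 0))"
proof -
  note s = smooth_nth[OF smooth_fst[OF f]] smooth_nth[OF smooth_nth[OF smooth_snd[OF f]]]
  have "time_deriv T (\<lambda>z. fst (f z)) z $ i = ddir (1, 0) (\<lambda>y. fst (f y) $ i) z" if "z \<in> slab T" for z i
    using time_deriv_smooth[OF smooth_fst[OF f] T that]
      ddir_bounded_linear_comp[OF bounded_linear_vec_nth smooth_fst[OF f], of "(1,0)" i] by simp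
  then show ?thesis unfolding solves_def vec_div_def mat_div_def
    by (auto simp: vec_eq_iff space_deriv_smooth s)
qed

lemma solves_add:
  assumes "smooth f" "smooth g" "solves T f" "solves T g" "T > 0"
  shows "solves T (\<lambda>z. f z + g z)"
proof -
  note s = smooth_nth[OF smooth_fst] smooth_nth[OF smooth_nth[OF smooth_snd]]
  show ?thesis using assms(3,4)
    unfolding solves_iff_ddir[OF assms(1,5)] solves_iff_ddir[OF assms(2,5)]
      solves_iff_ddir[OF smooth_add[OF assms(1,2)] assms(5)]
    by (auto simp: ddir_add[OF s(1)[OF assms(1)] s(1)[OF assms(2)]] ddir_add[OF s(2)[OF assms(1)] s(2)[OF assms(2)]]
      sum.distrib algebra_simps)
qed

text \<open>Turns the divergence of a scalar function times a constant vector into one directional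
  derivative, by linearity in the direction.\<close>

lemma sum_axis_ddir:
  fixes f :: "('n::finite) point \<Rightarrow> real"
  assumes "smooth f"
  shows "(\<Sum>i\<in>UNIV. c $ i * ddir (0, axis i 1) f z) = (ddir (0, c) f z :: real)"
proof -
  have c: "(0::real, c) = (\<Sum>i\<in>UNIV. c $ i *\<^sub>R (0, axis i 1))"
    by (simp add: prod_eq_iff fst_sum snd_sum vec_eq_iff axis_def if_distrib[of "\<lambda>x. _ * x"] cong: if_cong)
  then have "ddir (0, c) f z = ddir (\<Sum>i\<in>UNIV. c $ i *\<^sub>R (0, axis i 1)) f z" by (simp only: c)
  also have "\<dots> = (\<Sum>i\<in>UNIV. c $ i *\<^sub>R ddir (0, axis i 1) f z)"
    by (subst linear_sum[OF ddir_linear[OF assms]]) (simp only: linear_cmul[OF ddir_linear[OF assms]])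
  finally show ?thesis by simp
qed

text \<open>Write x, y, t for derivatives along \<open>\<xi>\<close>, \<open>a\<close> and time. The
  velocity is the rotated gradient, in the plane of \<open>\<xi>\<close> and \<open>a\<close>, of
  the stream function \<phi>_xx + \<phi>_yy; the matrix is chosen so that its divergence cancels the
  time derivative of this velocity identically. Every entry has order three, which is why the waves
  below carry the factor \<open>1 / N ^ 3\<close>.\<close>

definition state_of_potential ::
    "real^'n \<Rightarrow> real^'n \<Rightarrow> (('n::finite) point \<Rightarrow> real) \<Rightarrow> 'n point \<Rightarrow> 'n state" where
  "state_of_potential \<xi> a \<phi> z =
     (let D = (\<lambda>u v w. ddir u (ddir v (ddir w \<phi>)) z); t = (1, 0); x = (0, \<xi>); y = (0, a) in
      ((D x x x + D x y y) *\<^sub>R a - (D y x x + D y y y) *\<^sub>R \<xi>,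
       (2 * D t x y) *\<^sub>R (\<xi> \<otimes> \<xi> - a \<otimes> a) + (D t y y - D t x x) *\<^sub>R (\<xi> \<otimes> a + a \<otimes> \<xi>)))"

lemma smooth_state_of_potential: "smooth \<phi> \<Longrightarrow> smooth (state_of_potential \<xi> a \<phi>)"
  unfolding state_of_potential_def[abs_def] Let_def
  by (intro smooth_Pair smooth_diff smooth_add smooth_bounded_linear_comp[OF bounded_linear_scaleR_left]
      smooth_cmult smooth_ddir)

lemma tensor_nth [simp]: "(v \<otimes> w) $ i $ j = v $ i * w $ j"
  by (simp add: tensor_def)

lemma solves_state_of_potential:
  assumes \<phi>: "smooth \<phi>" and T: "T > 0"
  shows "solves T (state_of_potential \<xi> a \<phi>)"
  unfolding solves_iff_ddir[OF smooth_state_of_potential[OF \<phi>] T]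
proof (intro ballI conjI allI)
  fix z :: "'a point" assume "z \<in> slab T"
  define D where "D u v w = ddir u (ddir v (ddir w \<phi>))" for u v w :: "'a point"
  define x y t :: "'a point" where "x = (0, \<xi>)" and "y = (0, a)" and "t = (1, 0)"
  have sD: "smooth (D u v w)" for u v w unfolding D_def by (intro smooth_ddir \<phi>)
  \<comment> \<open>Used as permutative rewrite rules: the simplifier sorts the directions, so equal
    fourth derivatives become identical terms and cancel.\<close>
  have c1: "ddir u (ddir v (ddir w (ddir r \<phi>))) = ddir v (ddir u (ddir w (ddir r \<phi>)))"
     "ddir u (ddir v (ddir w \<phi>)) = ddir v (ddir u (ddir w \<phi>))"
     "ddir u (ddir v \<phi>) = ddir v (ddir u \<phi>)" for u v w r
    by (intro ddir_commute smooth_ddir \<phi>)+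
  have st: "state_of_potential \<xi> a \<phi> = (\<lambda>z. ((D x x x z + D x y y z) *\<^sub>R a - (D y x x z + D y y y z) *\<^sub>R \<xi>,
       (2 * D t x y z) *\<^sub>R (\<xi> \<otimes> \<xi> - a \<otimes> a) + (D t y y z - D t x x z) *\<^sub>R (\<xi> \<otimes> a + a \<otimes> \<xi>)))"
    by (rule ext) (simp add: state_of_potential_def Let_def D_def x_def y_def t_def)
  have V: "(\<lambda>z. fst (state_of_potential \<xi> a \<phi> z) $ i) = (\<lambda>z. a $ i * (D x x x z + D x y y z) - \<xi> $ i * (D y x x z + D y y y z))" for i
    unfolding st by (auto simp: algebra_simps)
  have U: "(\<lambda>z. snd (state_of_potential \<xi> a \<phi> z) $ i $ j) = (\<lambda>z. (\<xi> $ i * \<xi> $ j - a $ i * a $ j) * (2 * D t x y z) +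
       (\<xi> $ i * a $ j + a $ i * \<xi> $ j) * (D t y y z - D t x x z))" for i j
    unfolding st by (auto simp: algebra_simps)
  note sm = sD smooth_add[OF sD sD] smooth_diff[OF sD sD] smooth_cmult[OF sD] smooth_cmult[OF smooth_add[OF sD sD]]
     smooth_cmult[OF smooth_cmult[OF sD]] smooth_cmult[OF smooth_diff[OF sD sD]]
  note dd = ddir_add ddir_diff ddir_cmult sm
  have dV: "ddir v (\<lambda>z. fst (state_of_potential \<xi> a \<phi> z) $ i) z =
     a $ i * (ddir v (D x x x) z + ddir v (D x y y) z) - \<xi> $ i * (ddir v (D y x x) z + ddir v (D y y y) z)" for v i
    unfolding V by (simp add: dd)
  have dU: "ddir v (\<lambda>z. snd (state_of_potential \<xi> a \<phi> z) $ i $ j) z =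
     (\<xi> $ i * \<xi> $ j - a $ i * a $ j) * (2 * ddir v (D t x y) z) +
       (\<xi> $ i * a $ j + a $ i * \<xi> $ j) * (ddir v (D t y y) z - ddir v (D t x x) z)" for v i j
    unfolding U by (simp add: dd)
  have sx: "(\<Sum>i\<in>UNIV. \<xi> $ i * ddir (0, axis i 1) (D u v w) z) = ddir x (D u v w) z"
    "(\<Sum>i\<in>UNIV. a $ i * ddir (0, axis i 1) (D u v w) z) = ddir y (D u v w) z" for u v w
    using sum_axis_ddir[OF sD] by (auto simp: x_def y_def)
  show "(\<Sum>i\<in>UNIV. ddir (0, axis i 1) (\<lambda>y. fst (state_of_potential \<xi> a \<phi> y) $ i) z) = 0"
    unfolding dV by (simp add: ring_distribs sum.distrib sum_subtractf sx) (simp add: D_def c1)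
  fix i
  have "(\<Sum>j\<in>UNIV. ddir (0, axis j 1) (\<lambda>y. snd (state_of_potential \<xi> a \<phi> y) $ i $ j) z) =
    (\<Sum>j\<in>UNIV. (2 * \<xi> $ i) * (\<xi> $ j * ddir (0, axis j 1) (D t x y) z) - (2 * a $ i) * (a $ j * ddir (0, axis j 1) (D t x y) z)
      + \<xi> $ i * (a $ j * ddir (0, axis j 1) (D t y y) z) - \<xi> $ i * (a $ j * ddir (0, axis j 1) (D t x x) z)
      + a $ i * (\<xi> $ j * ddir (0, axis j 1) (D t y y) z) - a $ i * (\<xi> $ j * ddir (0, axis j 1) (D t x x) z))"
    unfolding dU by (intro sum.cong) (auto simp: algebra_simps)
  also have "\<dots> = 2 * \<xi> $ i * ddir x (D t x y) z - 2 * a $ i * ddir y (D t x y) z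
      + \<xi> $ i * ddir y (D t y y) z - \<xi> $ i * ddir y (D t x x) z
      + a $ i * ddir x (D t y y) z - a $ i * ddir x (D t x x) z"
    by (simp add: sum.distrib sum_subtractf sx flip: sum_distrib_left)
  finally show "ddir (1, 0) (\<lambda>y. fst (state_of_potential \<xi> a \<phi> y) $ i) z +
     (\<Sum>j\<in>UNIV. ddir (0, axis j 1) (\<lambda>y. snd (state_of_potential \<xi> a \<phi> y) $ i $ j) z) = 0"
    unfolding dV by (simp add: D_def c1 algebra_simps flip: t_def) 
qed

text \<open>The traces of \<open>\<xi> \<otimes> \<xi>\<close> and \<open>a \<otimes> a\<close> are
  both 1 and cancel; those of the mixed tensors are \<open>\<xi> \<bullet> a = 0\<close>.\<close>

lemma state_of_potential_Sym0:
  assumes "norm \<xi> = 1" "norm a = 1" "\<xi> \<bullet> a = 0"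
  shows "snd (state_of_potential \<xi> a \<phi> z) \<in> Sym0"
proof -
  have "trace (\<xi> \<otimes> \<xi>) = 1" "trace (a \<otimes> a) = 1" "trace (\<xi> \<otimes> a) = 0" "trace (a \<otimes> \<xi>) = 0"
    using assms by (simp_all add: trace_def norm_eq_1 inner_vec_def mult.commute)
  moreover have "trace (c *\<^sub>R A) = c * trace A" for c and A :: "real^'a^'a"
    by (simp add: trace_def sum_distrib_left)
  ultimately have "trace (snd (state_of_potential \<xi> a \<phi> z)) = 0"
    by (simp add: state_of_potential_def Let_def trace_add trace_sub)
  then show ?thesis
    by (simp add: Sym0_def Sym_def state_of_potential_def Let_def transpose_def vec_eq_iff algebra_simps)
qed

lemma state_of_potential_cong:
  assumes "open S" "z \<in> S" "\<And>y. y \<in> S \<Longrightarrow> \<phi> y = \<psi> y"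
  shows "state_of_potential \<xi> a \<phi> z = state_of_potential \<xi> a \<psi> z"
proof -
  have "ddir w \<phi> y = ddir w \<psi> y" if "y \<in> S" for w y
    using ddir_cong[OF assms(1) that assms(3)] .
  then have "ddir v (ddir w \<phi>) y = ddir v (ddir w \<psi>) y" if "y \<in> S" for v w y
    using ddir_cong[OF assms(1) that] by blast
  then have "ddir u (ddir v (ddir w \<phi>)) z = ddir u (ddir v (ddir w \<psi>)) z" for u v w
    using ddir_cong[OF assms(1,2)] by blast
  then show ?thesis by (simp add: state_of_potential_def)
qed

lemma state_of_potential_zero: "state_of_potential \<xi> a (\<lambda>z. 0) z = 0"
  by (simp add: state_of_potential_def ddir_const Let_def zero_prod_def)

subsection \<open>Localised plane waves\<close>

lemma bounded_of_compact_support: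
  fixes f :: "'a::euclidean_space \<Rightarrow> real"
  assumes "smooth f" "compact K" "\<And>z. z \<notin> K \<Longrightarrow> f z = 0"
  shows "\<exists>C\<ge>0. \<forall>z. \<bar>f z\<bar> \<le> C"
proof -
  have "bounded (f ` K)"
    using compact_continuous_image[OF smooth_continuous[OF assms(1)] assms(2)] compact_imp_bounded by blast
  then obtain C where C: "\<And>z. z \<in> K \<Longrightarrow> \<bar>f z\<bar> \<le> C" unfolding bounded_iff by auto
  have "\<bar>f z\<bar> \<le> max C 0" for z using C[of z] assms(3)[of z] by (cases "z \<in> K") auto
  then show ?thesis by (intro exI[of _ "max C 0"]) auto
qed

lemma ddir_outside:
  assumes "compact K" "\<And>z. z \<notin> K \<Longrightarrow> f z = 0" "z \<notin> K"
  shows "ddir v f z = 0"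
proof -
  have "open (- K)" using assms(1) compact_imp_closed by blast
  then have "ddir v f z = ddir v (\<lambda>z. 0) z"
    using assms by (intro ddir_cong[where S = "- K"]) auto
  then show ?thesis by (simp add: ddir_const)
qed

lemma smooth_phase: "smooth h \<Longrightarrow> smooth (\<lambda>z. h (N * (\<nu> \<bullet> z)))" for h :: "real \<Rightarrow> real"
  by (erule smooth_compose_real)
     (rule smooth_bounded_linear[OF bounded_linear_const_mult[OF bounded_linear_inner_right]])

lemma ddir_phase:
  fixes h :: "real \<Rightarrow> real"
  assumes "\<And>x. (h has_real_derivative h' x) (at x)"
  shows "ddir v (\<lambda>z. h (N * (\<nu> \<bullet> z))) = (\<lambda>z. h' (N * (\<nu> \<bullet> z)) * (N * (\<nu> \<bullet> v)))"
proof
  fix z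
  have "((\<lambda>z. N * (\<nu> \<bullet> z)) has_derivative (\<lambda>v. N * (\<nu> \<bullet> v))) (at z)"
    by (intro bounded_linear_imp_has_derivative bounded_linear_const_mult bounded_linear_inner_right)
  from ddir_eqI[OF has_derivative_compose[OF this assms[unfolded has_field_derivative_def]]]
  show "ddir v (\<lambda>z. h (N * (\<nu> \<bullet> z))) z = h' (N * (\<nu> \<bullet> z)) * (N * (\<nu> \<bullet> v))" .
qed

text \<open>Leibniz rule: if all three derivatives fall on the sine, they produce
  \<open>N ^ 3\<close> and cancel the denominator. In each of the seven other terms at least one
  falls on \<open>g\<close>, which leaves a factor of at most \<open>1 / N\<close>.\<close>

lemma third_derivative_wave:
  fixes g :: "'a::euclidean_space \<Rightarrow> real"
  assumes g: "smooth g" "compact K" "\<And>z. z \<notin> K \<Longrightarrow> g z = 0"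
  shows "\<exists>C\<ge>0. \<forall>N\<ge>1. \<forall>z. \<bar>ddir u (ddir v (ddir w (\<lambda>z. g z * (sin (N * (\<nu> \<bullet> z)) / N ^ 3)))) z
     - (\<nu> \<bullet> u) * (\<nu> \<bullet> v) * (\<nu> \<bullet> w) * (g z * - cos (N * (\<nu> \<bullet> z)))\<bar> \<le> C / N"
proof -
  have bd: "\<exists>C\<ge>0. \<forall>z. \<bar>f z\<bar> \<le> C" if "smooth f" "\<And>z. z \<notin> K \<Longrightarrow> f z = 0" for f :: "'a \<Rightarrow> real"
    using bounded_of_compact_support[OF that(1) g(2) that(2)] .
  note out1 = ddir_outside[OF g(2,3)] 
  note out2 = ddir_outside[OF g(2) out1] 
  note out3 = ddir_outside[OF g(2) out2]
  note sm1 = smooth_ddir[OF g(1)]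
  note sm2 = smooth_ddir[OF sm1]
  note sm3 = smooth_ddir[OF sm2]
  obtain M where M: "M \<ge> 0" 
     "\<And>z. \<bar>ddir u (ddir v (ddir w g)) z\<bar> \<le> M" 
     "\<And>z. \<bar>ddir u (ddir v g) z\<bar> \<le> M" "\<And>z. \<bar>ddir u (ddir w g) z\<bar> \<le> M" "\<And>z. \<bar>ddir v (ddir w g) z\<bar> \<le> M"
     "\<And>z. \<bar>ddir u g z\<bar> \<le> M" "\<And>z. \<bar>ddir v g z\<bar> \<le> M" "\<And>z. \<bar>ddir w g z\<bar> \<le> M"
  proof -
    obtain C1 where "C1 \<ge> 0" "\<forall>z. \<bar>ddir u (ddir v (ddir w g)) z\<bar> \<le> C1" using bd[OF sm3 out3] by blast
    moreover obtain C2 where "C2 \<ge> 0" "\<forall>z. \<bar>ddir u (ddir v g) z\<bar> \<le> C2" using bd[OF sm2 out2] by blast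
    moreover obtain C3 where "C3 \<ge> 0" "\<forall>z. \<bar>ddir u (ddir w g) z\<bar> \<le> C3" using bd[OF sm2 out2] by blast
    moreover obtain C4 where "C4 \<ge> 0" "\<forall>z. \<bar>ddir v (ddir w g) z\<bar> \<le> C4" using bd[OF sm2 out2] by blast
    moreover obtain C5 where "C5 \<ge> 0" "\<forall>z. \<bar>ddir u g z\<bar> \<le> C5" using bd[OF sm1 out1] by blast
    moreover obtain C6 where "C6 \<ge> 0" "\<forall>z. \<bar>ddir v g z\<bar> \<le> C6" using bd[OF sm1 out1] by blast
    moreover obtain C7 where "C7 \<ge> 0" "\<forall>z. \<bar>ddir w g z\<bar> \<le> C7" using bd[OF sm1 out1] by blast
    ultimately show ?thesis by (intro that[of "C1 + C2 + C3 + C4 + C5 + C6 + C7"]) (auto intro: order_trans)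
  qed
  \<comment> \<open>The summand 1 gives \<open>A \<ge> 1\<close>, so that \<open>A * A\<close> also
    bounds products with fewer than two direction factors.\<close>
  define A where "A = 1 + \<bar>\<nu> \<bullet> u\<bar> + \<bar>\<nu> \<bullet> v\<bar> + \<bar>\<nu> \<bullet> w\<bar>"
  have A: "1 \<le> A" "\<bar>\<nu> \<bullet> u\<bar> \<le> A" "\<bar>\<nu> \<bullet> v\<bar> \<le> A" "\<bar>\<nu> \<bullet> w\<bar> \<le> A" by (auto simp: A_def)
  show ?thesis
  proof (intro exI[of _ "7 * (M * (A * A))"] conjI allI impI)
    show "0 \<le> 7 * (M * (A * A))" using M A by simp
    fix N :: real and z assume N: "1 \<le> N"
    define e0 where "e0 = (\<lambda>z. - cos (N * (\<nu> \<bullet> z)))"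
    define e1 where "e1 = (\<lambda>z. - sin (N * (\<nu> \<bullet> z)) / N)"
    define e2 where "e2 = (\<lambda>z. cos (N * (\<nu> \<bullet> z)) / N\<^sup>2)"
    define e3 where "e3 = (\<lambda>z. sin (N * (\<nu> \<bullet> z)) / N ^ 3)"
    have se: "smooth e1" "smooth e2" "smooth e3"
      unfolding e1_def e2_def e3_def divide_inverse
      by (intro smooth_bounded_linear_comp[OF bounded_linear_mult_left] smooth_minus smooth_phase smooth_sin smooth_cos)+
    have d1: "ddir v e1 = (\<lambda>z. (\<nu> \<bullet> v) * e0 z)" for v
      unfolding e1_def e0_def using N
      by (subst ddir_phase[where h = "\<lambda>x. - sin x / N" and h' = "\<lambda>x. - cos x / N"]) (auto intro!: derivative_eq_intros simp: field_simps)
    have d2: "ddir v e2 = (\<lambda>z. (\<nu> \<bullet> v) * e1 z)" for v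
      unfolding e1_def e2_def using N
      by (subst ddir_phase[where h = "\<lambda>x. cos x / N\<^sup>2" and h' = "\<lambda>x. - sin x / N\<^sup>2"]) (auto intro!: derivative_eq_intros simp: field_simps power2_eq_square)
    have d3: "ddir v e3 = (\<lambda>z. (\<nu> \<bullet> v) * e2 z)" for v
      unfolding e3_def e2_def using N
      by (subst ddir_phase[where h = "\<lambda>x. sin x / N^3" and h' = "\<lambda>x. cos x / N^3"]) (auto intro!: derivative_eq_intros simp: field_simps power2_eq_square power3_eq_cube)
    note S = se g(1) sm1 sm2 smooth_mult smooth_add smooth_cmult
    note R = ddir_mult ddir_add ddir_cmult d1 d2 d3 S
    \<comment> \<open>The factors 1 pad all seven remainders to the same shape, so that the single
      estimate \<open>p\<close> covers them.\<close>
    have "ddir u (ddir v (ddir w (\<lambda>z. g z * e3 z))) z - (\<nu> \<bullet> u) * (\<nu> \<bullet> v) * (\<nu> \<bullet> w) * (g z * e0 z)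
      = ddir u (ddir v (ddir w g)) z * 1 * 1 * e3 z
      + (ddir u (ddir v g) z * (\<nu> \<bullet> w) * 1 * e2 z + ddir u (ddir w g) z * (\<nu> \<bullet> v) * 1 * e2 z + ddir v (ddir w g) z * (\<nu> \<bullet> u) * 1 * e2 z)
      + (ddir u g z * (\<nu> \<bullet> v) * (\<nu> \<bullet> w) * e1 z + ddir v g z * (\<nu> \<bullet> u) * (\<nu> \<bullet> w) * e1 z + ddir w g z * (\<nu> \<bullet> u) * (\<nu> \<bullet> v) * e1 z)"
      by (simp add: R ring_distribs)
    also have "\<bar>\<dots>\<bar> \<le> 7 * (M * A * A * (1 / N))"
    proof -
      have e: "\<bar>e1 z\<bar> \<le> 1 / N" "\<bar>e2 z\<bar> \<le> 1 / N" "\<bar>e3 z\<bar> \<le> 1 / N"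
      proof -
        have "1 / N\<^sup>2 \<le> 1 / N" "1 / N ^ 3 \<le> 1 / N"
          using N self_le_power[of N 2] self_le_power[of N 3] by (auto intro!: divide_left_mono)
        moreover have "\<bar>e1 z\<bar> \<le> 1 / N" "\<bar>e2 z\<bar> \<le> 1 / N\<^sup>2" "\<bar>e3 z\<bar> \<le> 1 / N ^ 3"
          using N unfolding e1_def e2_def e3_def by (auto simp: abs_divide intro!: divide_right_mono)
        ultimately show "\<bar>e1 z\<bar> \<le> 1 / N" "\<bar>e2 z\<bar> \<le> 1 / N" "\<bar>e3 z\<bar> \<le> 1 / N" by linarith+
      qed
      have p: "\<bar>a * b * c * d\<bar> \<le> M * A * A * (1 / N)" if "\<bar>a\<bar> \<le> M" "\<bar>b\<bar> \<le> A" "\<bar>c\<bar> \<le> A" "\<bar>d\<bar> \<le> 1 / N" for a b c d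
        unfolding abs_mult using that M(1) A(1) N by (intro mult_mono) auto
      have t: "\<bar>x1 + (x2 + x3 + x4) + (x5 + x6 + x7)\<bar> \<le> 7 * B" if "\<bar>x1\<bar> \<le> B" "\<bar>x2\<bar> \<le> B" "\<bar>x3\<bar> \<le> B"
         "\<bar>x4\<bar> \<le> B" "\<bar>x5\<bar> \<le> B" "\<bar>x6\<bar> \<le> B" "\<bar>x7\<bar> \<le> B" for x1 x2 x3 x4 x5 x6 x7 B :: real
        using that by linarith
      show ?thesis by (intro t p M e A) (use A(1) in auto)
    qed
    finally show "\<bar>ddir u (ddir v (ddir w (\<lambda>z. g z * (sin (N * (\<nu> \<bullet> z)) / N ^ 3)))) z
     - (\<nu> \<bullet> u) * (\<nu> \<bullet> v) * (\<nu> \<bullet> w) * (g z * - cos (N * (\<nu> \<bullet> z)))\<bar> \<le> 7 * (M * (A * A)) / N"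
      by (simp add: e0_def e3_def mult.assoc)
  qed
qed

text \<open>The phase has derivative 1 along \<open>\<xi>\<close>, 0 along \<open>a\<close> and
  \<open>- \<beta>\<close> in time. To leading order only the derivatives xxx and txx of the
  potential survive; the first contributes \<open>a\<close>, the second the matrix part.\<close>

lemma state_of_potential_wave:
  fixes g :: "('n::finite) point \<Rightarrow> real" and \<beta> :: real
  assumes g: "smooth g" "compact K" "\<And>z. z \<notin> K \<Longrightarrow> g z = 0"
    and fr: "norm \<xi> = 1" "\<xi> \<bullet> a = 0"
  defines "\<nu> \<equiv> (- \<beta>, \<xi>)"
  shows "\<exists>C\<ge>0. \<forall>N\<ge>1. \<forall>z. norm (state_of_potential \<xi> a (\<lambda>z. g z * (sin (N * (\<nu> \<bullet> z)) / N ^ 3)) z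
     - (g z * - cos (N * (\<nu> \<bullet> z))) *\<^sub>R (a, \<beta> *\<^sub>R (\<xi> \<otimes> a + a \<otimes> \<xi>))) \<le> C / N"
proof -
  define x y t :: "'n point" where "x = (0, \<xi>)" and "y = (0, a)" and "t = (1, 0)"
  have n: "\<nu> \<bullet> x = 1" "\<nu> \<bullet> y = 0" "\<nu> \<bullet> t = - \<beta>"
    using fr by (simp_all add: \<nu>_def x_def y_def t_def norm_eq_1)
  define \<phi> where "\<phi> N = (\<lambda>z. g z * (sin (N * (\<nu> \<bullet> z)) / N ^ 3))" for N
  define D where "D N u v w z = ddir u (ddir v (ddir w (\<phi> N))) z" for N u v w z
  define E where "E N z = g z * - cos (N * (\<nu> \<bullet> z))" for N z
  have b: "\<exists>C\<ge>0. \<forall>N\<ge>1. \<forall>z. \<bar>D N u v w z - (\<nu> \<bullet> u) * (\<nu> \<bullet> v) * (\<nu> \<bullet> w) * E N z\<bar> \<le> C / N" for u v w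
    using third_derivative_wave[OF g, of u v w \<nu>] unfolding D_def E_def \<phi>_def .
  obtain C1 where C1: "C1 \<ge> 0" "\<And>N z. N \<ge> 1 \<Longrightarrow> \<bar>D N x x x z - E N z\<bar> \<le> C1 / N" using b[of x x x] unfolding n by auto
  obtain C2 where C2: "C2 \<ge> 0" "\<And>N z. N \<ge> 1 \<Longrightarrow> \<bar>D N x y y z\<bar> \<le> C2 / N" using b[of x y y] unfolding n by auto
  obtain C3 where C3: "C3 \<ge> 0" "\<And>N z. N \<ge> 1 \<Longrightarrow> \<bar>D N y x x z\<bar> \<le> C3 / N" using b[of y x x] unfolding n by auto
  obtain C4 where C4: "C4 \<ge> 0" "\<And>N z. N \<ge> 1 \<Longrightarrow> \<bar>D N y y y z\<bar> \<le> C4 / N" using b[of y y y] unfolding n by auto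
  obtain C5 where C5: "C5 \<ge> 0" "\<And>N z. N \<ge> 1 \<Longrightarrow> \<bar>D N t x y z\<bar> \<le> C5 / N" using b[of t x y] unfolding n by auto
  obtain C6 where C6: "C6 \<ge> 0" "\<And>N z. N \<ge> 1 \<Longrightarrow> \<bar>D N t y y z\<bar> \<le> C6 / N" using b[of t y y] unfolding n by auto
  obtain C7 where C7: "C7 \<ge> 0" "\<And>N z. N \<ge> 1 \<Longrightarrow> \<bar>D N t x x z + \<beta> * E N z\<bar> \<le> C7 / N" using b[of t x x] unfolding n by auto
  define C where "C = (C1 + C2) * norm a + (C3 + C4) * norm \<xi> + (2 * C5) * norm (\<xi> \<otimes> \<xi> - a \<otimes> a) + (C6 + C7) * norm (\<xi> \<otimes> a + a \<otimes> \<xi>)"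
  show ?thesis unfolding \<phi>_def[symmetric] E_def[symmetric]
  proof (intro exI[of _ C] conjI allI impI)
    show "0 \<le> C" using C1 C2 C3 C4 C5 C6 C7 by (simp add: C_def)
    fix N :: real and z assume N: "1 \<le> N"
    have eq: "state_of_potential \<xi> a (\<phi> N) z - E N z *\<^sub>R (a, \<beta> *\<^sub>R (\<xi> \<otimes> a + a \<otimes> \<xi>)) =
      (((D N x x x z - E N z) + D N x y y z) *\<^sub>R a + (- (D N y x x z + D N y y y z)) *\<^sub>R \<xi>,
       (2 * D N t x y z) *\<^sub>R (\<xi> \<otimes> \<xi> - a \<otimes> a) + (D N t y y z - (D N t x x z + \<beta> * E N z)) *\<^sub>R (\<xi> \<otimes> a + a \<otimes> \<xi>))"
      by (simp add: state_of_potential_def Let_def D_def x_def y_def t_def algebra_simps)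
    have np: "norm (p *\<^sub>R A + q *\<^sub>R B) \<le> P * norm A + Q * norm B" if "\<bar>p\<bar> \<le> P" "\<bar>q\<bar> \<le> Q" for p q P Q and A B :: "'b::real_normed_vector"
      using norm_triangle_ineq[of "p *\<^sub>R A" "q *\<^sub>R B"] mult_right_mono[OF that(1), of "norm A"] mult_right_mono[OF that(2), of "norm B"]
      by simp
    have "norm (state_of_potential \<xi> a (\<phi> N) z - E N z *\<^sub>R (a, \<beta> *\<^sub>R (\<xi> \<otimes> a + a \<otimes> \<xi>)))
      \<le> ((C1 / N + C2 / N) * norm a + (C3 / N + C4 / N) * norm \<xi>)
       + (2 * (C5 / N) * norm (\<xi> \<otimes> \<xi> - a \<otimes> a) + (C6 / N + C7 / N) * norm (\<xi> \<otimes> a + a \<otimes> \<xi>))"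
      unfolding eq
    proof (rule order_trans[OF norm_Pair_le add_mono[OF np np]])
      show "\<bar>D N x x x z - E N z + D N x y y z\<bar> \<le> C1 / N + C2 / N"
        using C1(2)[OF N, of z] C2(2)[OF N, of z] by linarith
      show "\<bar>- (D N y x x z + D N y y y z)\<bar> \<le> C3 / N + C4 / N"
        using C3(2)[OF N, of z] C4(2)[OF N, of z] by linarith
      show "\<bar>2 * D N t x y z\<bar> \<le> 2 * (C5 / N)"
        using C5(2)[OF N, of z] by linarith
      show "\<bar>D N t y y z - (D N t x x z + \<beta> * E N z)\<bar> \<le> C6 / N + C7 / N"
        using C6(2)[OF N, of z] C7(2)[OF N, of z] by linarith
    qed
    also have "\<dots> = C / N" using N by (simp add: C_def field_simps)
    finally show "norm (state_of_potential \<xi> a (\<phi> N) z - E N z *\<^sub>R (a, \<beta> *\<^sub>R (\<xi> \<otimes> a + a \<otimes> \<xi>))) \<le> C / N" .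
  qed
qed

subsection \<open>The Riemann--Lebesgue lemma\<close>

lemma integral_lborel_shift:
  fixes h :: "'a::euclidean_space \<Rightarrow> real"
  assumes "h \<in> borel_measurable borel"
  shows "(LINT z|lborel. h (c + z)) = (LINT z|lborel. h z)"
proof -
  have "(LINT z|lborel. h z) = (LINT z|distr lborel borel ((+) c). h z)"
    by (simp add: lborel_distr_plus)
  also have "\<dots> = (LINT z|lborel. h (c + z))"
    using assms by (intro integral_distr) auto
  finally show ?thesis by simp
qed

lemma integrable_continuous_compact_support:
  fixes f :: "'a::euclidean_space \<Rightarrow> real"
  assumes "continuous_on UNIV f" "compact K" "\<And>z. z \<notin> K \<Longrightarrow> f z = 0"
  shows "integrable lborel f"
proof -
  have "integrable lborel (\<lambda>z. indicator K z *\<^sub>R f z)"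
    using borel_integrable_compact[OF assms(2)] assms(1) continuous_on_subset by blast
  moreover have "(\<lambda>z. indicator K z *\<^sub>R f z) = f"
    using assms(3) by (auto simp: indicator_def fun_eq_iff)
  ultimately show ?thesis by simp
qed

text \<open>Shifting by half a period changes the sign of the oscillating factor.\<close>

lemma Riemann_Lebesgue_continuous:
  fixes f :: "'a::euclidean_space \<Rightarrow> real"
  assumes f: "continuous_on UNIV f" "\<And>z. z \<notin> cball 0 R \<Longrightarrow> f z = 0" and nu: "\<nu> \<noteq> 0"
  shows "(\<lambda>N::nat. LINT z|lborel. f z * cos (real N * (\<nu> \<bullet> z))) \<longlonglongrightarrow> 0"
proof (rule LIMSEQ_I)
  fix r :: real assume r: "r > 0"
  define K where "K = cball (0::'a) (R + 1)"
  \<comment> \<open>The 1 keeps the divisor positive. The radius of \<open>K\<close> exceeds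
    \<open>R\<close> by 1 so that \<open>K\<close> also contains the support after a shift of length
    below 1.\<close>
  define m where "m = measure lborel K + 1"
  have m: "m > 0" by (simp add: m_def add_nonneg_pos)
  have "uniformly_continuous_on (cball 0 (R + 2)) f"
    by (rule compact_uniformly_continuous[OF continuous_on_subset[OF f(1)]]) auto
  then obtain d where d: "d > 0" "\<And>x x'. x \<in> cball 0 (R + 2) \<Longrightarrow> x' \<in> cball 0 (R+2) \<Longrightarrow> dist x' x < d \<Longrightarrow> dist (f x') (f x) < r / m"
    using divide_pos_pos[OF r m] unfolding uniformly_continuous_on_def by blast
  define q where "q = pi / norm \<nu>"
  have "(\<lambda>N. q / real N) \<longlonglongrightarrow> 0" by (rule lim_const_over_n)
  then have "\<forall>\<^sub>F N in sequentially. \<bar>q / real N\<bar> < min d 1"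
    using tendstoD[of "\<lambda>N. q / real N" 0 sequentially "min d 1"] d(1) by (simp add: dist_real_def)
  then obtain N0 where N0: "\<And>N. N \<ge> N0 \<Longrightarrow> \<bar>q / real N\<bar> < min d 1" by (auto simp: eventually_sequentially)
  show "\<exists>no. \<forall>N\<ge>no. norm ((LINT z|lborel. f z * cos (real N * (\<nu> \<bullet> z))) - 0) < r"
  proof (intro exI[of _ "max N0 1"] allI impI)
    fix N assume N: "N \<ge> max N0 1"
    \<comment> \<open>The shift along \<nu> that advances the phase
      \<open>N * (\<nu> \<bullet> z)\<close> by exactly \<pi>.\<close>
    define s where "s = (pi / (real N * (\<nu> \<bullet> \<nu>))) *\<^sub>R \<nu>"
    have ns: "norm s = \<bar>q / real N\<bar>"
      using nu N by (simp add: s_def q_def power2_eq_square flip: power2_norm_eq_inner)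
    then have sd: "norm s < d" "norm s < 1" using N0[of N] N by auto
    have ph: "real N * (\<nu> \<bullet> (s + z)) = real N * (\<nu> \<bullet> z) + pi" for z
      using nu N by (simp add: s_def inner_add_right field_simps)
    define h where "h = (\<lambda>z. f z * cos (real N * (\<nu> \<bullet> z)))"
    have hc: "continuous_on UNIV h" unfolding h_def by (intro continuous_intros f)
    have hi: "integrable lborel h"
      by (rule integrable_continuous_compact_support[OF hc compact_cball[of 0 R]]) (use f(2) in \<open>auto simp: h_def\<close>)
    have hs: "(LINT z|lborel. h (s + z)) = (LINT z|lborel. h z)"
      by (rule integral_lborel_shift) (use hc in \<open>simp add: borel_measurable_continuous_onI\<close>)
    have hsi: "integrable lborel (\<lambda>z. h (s + z))"
    proof (rule integrable_continuous_compact_support)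
      show "continuous_on UNIV (\<lambda>z. h (s + z))" by (intro continuous_on_compose2[OF hc] continuous_intros) auto
      show "h (s + z) = 0" if "z \<notin> K" for z
      proof -
        have "norm z \<le> norm (s + z) + norm s" using norm_triangle_ineq4[of "s + z" s] by simp
        then have "s + z \<notin> cball 0 R" using that sd by (auto simp: K_def)
        then show ?thesis using f(2) by (simp add: h_def)
      qed
    qed (simp add: K_def)
    \<comment> \<open>The shifted integral has the same value and the opposite cosine, so only the
      difference \<open>f z - f (s + z)\<close> remains, which is uniformly small.\<close>
    have "2 * (LINT z|lborel. h z) = (LINT z|lborel. h z + h (s + z))"
      using hi hsi hs by simp
    also have "norm \<dots> \<le> (LINT z|lborel. r / m * indicator K z)"
    proof (rule Bochner_Integration.integral_norm_bound_integral)
      show "integrable lborel (\<lambda>z. h z + h (s + z))" using hi hsi by simp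
      show "integrable lborel (\<lambda>z. r / m * indicator K z)"
        unfolding K_def
        by (intro integrable_mult_right integrable_real_indicator) (auto intro: emeasure_lborel_cball_finite[unfolded infinity_ennreal_def])
      fix z
      have eq: "h z + h (s + z) = (f z - f (s + z)) * cos (real N * (\<nu> \<bullet> z))"
        unfolding h_def ph by (simp add: algebra_simps)
      show "norm (h z + h (s + z)) \<le> r / m * indicator K z"
      proof (cases "z \<in> K")
        case True
        then have "z \<in> cball 0 (R + 2)" "s + z \<in> cball 0 (R + 2)"
          using sd norm_triangle_ineq[of s z] by (auto simp: K_def)
        then have "\<bar>f z - f (s + z)\<bar> \<le> r / m"
          using d(2)[of z "s + z"] sd by (auto simp: dist_norm dist_real_def abs_minus_commute)
        then have "\<bar>f z - f (s + z)\<bar> * \<bar>cos (real N * (\<nu> \<bullet> z))\<bar> \<le> (r / m) * 1"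
          using r m by (intro mult_mono) auto
        then show ?thesis using True unfolding eq by (simp add: abs_mult)
      next
        case False
        have "norm z \<le> norm (s + z) + norm s" using norm_triangle_ineq4[of "s + z" s] by simp
        then have "z \<notin> cball 0 R" "s + z \<notin> cball 0 R" using False sd by (auto simp: K_def)
        then show ?thesis using False f(2) unfolding eq by simp
      qed
    qed
    also have "\<dots> = r / m * measure lborel K" by (simp add: K_def)
    also have "\<dots> < r * 2" using r m by (simp add: field_simps m_def mult_less_cancel_left add_strict_increasing) 
    finally show "norm ((LINT z|lborel. f z * cos (real N * (\<nu> \<bullet> z))) - 0) < r" by (simp add: h_def)
  qed
qed

definition clamp :: "real \<Rightarrow> real \<Rightarrow> real" where "clamp k x = max (- k) (min k x)"

text \<open>Two dominated convergences: \<open>f\<close> is first truncated in range and domain,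
  then the truncation is approximated almost everywhere by continuous functions that obey the same
  truncation and are therefore dominated.\<close>

lemma continuous_dense_L1:
  fixes f :: "'a::euclidean_space \<Rightarrow> real"
  assumes f: "integrable lebesgue f" and e: "e > 0"
  obtains g R where "continuous_on UNIV g" "\<And>z. z \<notin> cball 0 R \<Longrightarrow> g z = 0"
    "integrable lebesgue g" "(LINT z|lebesgue. \<bar>f z - g z\<bar>) < e"
proof -
  have [measurable]: "f \<in> borel_measurable lebesgue" using f by auto
  define F where "F k z = indicator (cball 0 (real k)) z * clamp (real k) (f z)" for k :: nat and z
  have cl: "\<bar>clamp (real k) x\<bar> \<le> real k" "\<bar>clamp (real k) x\<bar> \<le> \<bar>x\<bar>" for k x by (auto simp: clamp_def)
  have [measurable]: "cball (0::'a) r \<in> sets lebesgue" for r by simp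
  have Fm[measurable]: "F k \<in> borel_measurable lebesgue" for k
    unfolding F_def[abs_def] clamp_def by measurable
  have FL: "(\<lambda>k. LINT z|lebesgue. \<bar>f z - F k z\<bar>) \<longlonglongrightarrow> (LINT z|(lebesgue::'a measure). 0)"
  proof (rule integral_dominated_convergence[where w = "\<lambda>z. 2 * \<bar>f z\<bar>"])
    show "integrable lebesgue (\<lambda>z. 2 * \<bar>f z\<bar>)" using f by auto
    show "AE z in lebesgue. (\<lambda>k. \<bar>f z - F k z\<bar>) \<longlonglongrightarrow> 0"
    proof (rule AE_I2, rule tendsto_eventually)
      fix z :: 'a
      obtain k0 :: nat where k0: "real k0 \<ge> norm z + \<bar>f z\<bar>" using real_arch_simple by blast
      show "\<forall>\<^sub>F k in sequentially. \<bar>f z - F k z\<bar> = 0"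
        using eventually_ge_at_top[of k0]
      proof eventually_elim
        case (elim k)
        then have "real k \<ge> norm z + \<bar>f z\<bar>" using k0 by linarith
        then have "norm z \<le> real k" "\<bar>f z\<bar> \<le> real k" using norm_ge_zero[of z] by linarith+
        then show ?case by (auto simp: F_def clamp_def)
      qed
    qed
    show "AE z in lebesgue. norm \<bar>f z - F k z\<bar> \<le> 2 * \<bar>f z\<bar>" for k
    proof (rule AE_I2)
      fix z show "norm \<bar>f z - F k z\<bar> \<le> 2 * \<bar>f z\<bar>"
        using cl(2)[of k "f z"] by (auto simp: F_def indicator_def)
    qed
  qed (measurable; simp)+
  have "(\<lambda>k. LINT z|lebesgue. \<bar>f z - F k z\<bar>) \<longlonglongrightarrow> 0" using FL by simp
  then have "\<forall>\<^sub>F k in sequentially. (LINT z|lebesgue. \<bar>f z - F k z\<bar>) < e / 2"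
    using e by (intro order_tendstoD(2)) auto
  then obtain k where k: "(LINT z|lebesgue. \<bar>f z - F k z\<bar>) < e / 2" by (auto simp: eventually_sequentially)
  \<comment> \<open>A Lebesgue measurable function is almost everywhere a limit of continuous
    functions; these carry no bound and no support condition yet.\<close>
  have "F k measurable_on UNIV" by (rule lebesgue_measurable_imp_measurable_on) auto
  then obtain N g where Ng: "negligible N" "\<And>n::nat. continuous_on UNIV (g n)" "\<And>x. x \<notin> N \<Longrightarrow> (\<lambda>n. g n x) \<longlonglongrightarrow> F k x"
    unfolding measurable_on_def by auto
  \<comment> \<open>Equal to 1 on the ball of radius \<open>k\<close>, where \<open>F k\<close>
    lives, and 0 outside the ball of radius \<open>k + 1\<close>. Cutting and clamping thus fix the
    limit \<open>F k\<close> while bounding the approximants.\<close>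
  define cut where "cut z = max 0 (min 1 (real k + 1 - norm z))" for z :: 'a
  define G where "G n z = cut z * clamp (real k) (g n z)" for n z
  have Gc: "continuous_on UNIV (G n)" for n
    unfolding G_def cut_def clamp_def by (intro continuous_intros Ng(2))
  have G0: "G n z = 0" if "z \<notin> cball 0 (real k + 1)" for n z
    using that by (auto simp: G_def cut_def)
  have cut: "0 \<le> cut z" "cut z \<le> 1" for z by (auto simp: cut_def)
  have Gb: "\<bar>G n z\<bar> \<le> real k * indicator (cball 0 (real k + 1)) z" for n z
  proof (cases "z \<in> cball 0 (real k + 1)")
    case True
    have "\<bar>cut z\<bar> * \<bar>clamp (real k) (g n z)\<bar> \<le> 1 * real k" using cut[of z] cl by (intro mult_mono) auto
    then show ?thesis using True by (simp add: G_def abs_mult)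
  qed (simp add: G0)
  have Fb: "\<bar>F k z\<bar> \<le> real k * indicator (cball 0 (real k + 1)) z" for z
    using cl(1)[of k "f z"] by (auto simp: F_def indicator_def)
  have Gi: "integrable lborel (G n)" for n
    by (rule integrable_continuous_compact_support[OF Gc compact_cball G0])
  then have Gi': "integrable lebesgue (G n)" for n
    using integrable_completion[of "G n" lborel] by auto
  have Gm[measurable]: "G n \<in> borel_measurable lebesgue" for n using Gi' by auto
  have ind: "integrable lebesgue (\<lambda>z::'a. real k * indicator (cball 0 (real k + 1)) z)"
    by (intro integrable_mult_right integrable_real_indicator) (auto intro: emeasure_lborel_cball_finite[unfolded infinity_ennreal_def])
  have GL: "(\<lambda>n. LINT z|lebesgue. \<bar>F k z - G n z\<bar>) \<longlonglongrightarrow> (LINT z|(lebesgue::'a measure). 0)"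
  proof (rule integral_dominated_convergence[where w = "\<lambda>z. 2 * (real k * indicator (cball 0 (real k + 1)) z)"])
    show "integrable lebesgue (\<lambda>z::'a. 2 * (real k * indicator (cball 0 (real k + 1)) z))" by (rule integrable_mult_right) (rule ind)
    have "AE z in lebesgue. z \<notin> N" using Ng(1) by (auto simp: negligible_iff_null_sets intro: AE_not_in)
    then show "AE z in lebesgue. (\<lambda>n. \<bar>F k z - G n z\<bar>) \<longlonglongrightarrow> 0"
    proof eventually_elim
      case (elim z)
      have "(\<lambda>n. G n z) \<longlonglongrightarrow> cut z * clamp (real k) (F k z)"
        unfolding G_def clamp_def by (intro tendsto_intros Ng(3) elim)
      moreover have "cut z * clamp (real k) (F k z) = F k z"
        by (auto simp: F_def clamp_def cut_def indicator_def)
      ultimately show ?case using tendsto_rabs[OF tendsto_diff[OF tendsto_const], of "\<lambda>n. G n z" "F k z" sequentially "F k z"] by simp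
    qed
    show "AE z in lebesgue. norm \<bar>F k z - G n z\<bar> \<le> 2 * (real k * indicator (cball 0 (real k + 1)) z)" for n
    proof (rule AE_I2)
      fix z show "norm \<bar>F k z - G n z\<bar> \<le> 2 * (real k * indicator (cball 0 (real k + 1)) z)"
        unfolding real_norm_def using Gb[of n z] Fb[of z] by linarith
    qed
  qed (measurable; simp)+
  then have "\<forall>\<^sub>F n in sequentially. (LINT z|lebesgue. \<bar>F k z - G n z\<bar>) < e / 2"
    using e by (intro order_tendstoD(2)) auto
  then obtain n where n: "(LINT z|lebesgue. \<bar>F k z - G n z\<bar>) < e / 2" by (auto simp: eventually_sequentially)
  have Fi: "integrable lebesgue (F k)"
    by (rule Bochner_Integration.integrable_bound[OF ind]) (use Fb in \<open>auto simp: abs_mult\<close>)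
  have "(LINT z|lebesgue. \<bar>f z - G n z\<bar>) \<le> (LINT z|lebesgue. \<bar>f z - F k z\<bar> + \<bar>F k z - G n z\<bar>)"
    by (intro integral_mono) (use f Fi Gi' in auto)
  also have "\<dots> = (LINT z|lebesgue. \<bar>f z - F k z\<bar>) + (LINT z|lebesgue. \<bar>F k z - G n z\<bar>)"
    using f Fi Gi' by (intro Bochner_Integration.integral_add) auto
  finally have "(LINT z|lebesgue. \<bar>f z - G n z\<bar>) < e" using k n by linarith
  then show ?thesis using that[OF Gc G0 Gi'] by blast
qed

text \<open>Since the cosine is bounded by 1, an approximation in L^1 perturbs the integrals by at
  most its error, uniformly in the frequency.\<close>

lemma Riemann_Lebesgue:
  fixes f :: "'a::euclidean_space \<Rightarrow> real"
  assumes f: "integrable lebesgue f" and nu: "\<nu> \<noteq> 0"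
  shows "(\<lambda>N::nat. LINT z|lebesgue. f z * cos (real N * (\<nu> \<bullet> z))) \<longlonglongrightarrow> 0"
proof (rule LIMSEQ_I)
  fix r :: real assume r: "r > 0"
  obtain g R where g: "continuous_on UNIV g" "\<And>z. z \<notin> cball 0 R \<Longrightarrow> g z = 0" "integrable lebesgue g"
    "(LINT z|lebesgue. \<bar>f z - g z\<bar>) < r / 2"
    using continuous_dense_L1[OF f, of "r / 2"] r by auto
  have cm: "(\<lambda>z. cos (real N * (\<nu> \<bullet> z))) \<in> borel_measurable borel" for N
    by (intro borel_measurable_continuous_onI continuous_intros)
  have gm: "g \<in> borel_measurable borel" using g(1) by (rule borel_measurable_continuous_onI)
  have "(\<lambda>N::nat. LINT z|lebesgue. g z * cos (real N * (\<nu> \<bullet> z))) \<longlonglongrightarrow> 0"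
    using Riemann_Lebesgue_continuous[OF g(1,2) nu] cm gm by (simp add: integral_completion)
  then obtain N0 where N0: "\<And>N. N \<ge> N0 \<Longrightarrow> \<bar>LINT z|lebesgue. g z * cos (real N * (\<nu> \<bullet> z))\<bar> < r / 2"
    using r LIMSEQ_D[of _ 0 "r/2"] by fastforce
  have cl[measurable]: "(\<lambda>z. cos (real N * (\<nu> \<bullet> z))) \<in> borel_measurable lebesgue" for N
    using measurable_completion[of "\<lambda>z. cos (real N * (\<nu> \<bullet> z))" lborel borel] cm by simp
  have int: "integrable lebesgue (\<lambda>z. h z * cos (real N * (\<nu> \<bullet> z)))" if "integrable lebesgue h" for h N
    by (rule Bochner_Integration.integrable_bound[OF that]) (use that in \<open>auto simp: abs_mult mult_left_le\<close>)
  show "\<exists>no. \<forall>N\<ge>no. norm ((LINT z|lebesgue. f z * cos (real N * (\<nu> \<bullet> z))) - 0) < r"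
  proof (intro exI[of _ N0] allI impI)
    fix N assume N: "N \<ge> N0"
    have "(LINT z|lebesgue. f z * cos (real N * (\<nu> \<bullet> z))) - (LINT z|lebesgue. g z * cos (real N * (\<nu> \<bullet> z)))
        = (LINT z|lebesgue. (f z - g z) * cos (real N * (\<nu> \<bullet> z)))"
      by (subst Bochner_Integration.integral_diff[symmetric]) (auto intro!: int f g simp: algebra_simps)
    also have "norm \<dots> \<le> (LINT z|lebesgue. \<bar>f z - g z\<bar>)"
      by (rule Bochner_Integration.integral_norm_bound_integral) (use int[of "\<lambda>z. f z - g z"] f g in \<open>auto simp: abs_mult mult_left_le\<close>)
    finally show "norm ((LINT z|lebesgue. f z * cos (real N * (\<nu> \<bullet> z))) - 0) < r"
      using N0[OF N] g(4) by simp
  qed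
qed

subsection \<open>Positive definite matrices and the defect matrix\<close>

lemma quad_tensor: "x \<bullet> ((u \<otimes> w) *v x) = (u \<bullet> x) * (w \<bullet> x)" for x :: "real^'n::finite"
proof -
  have "(u \<otimes> w) *v x = (w \<bullet> x) *\<^sub>R u"
    by (simp add: vec_eq_iff matrix_vector_mult_def inner_vec_def sum_distrib_left mult_ac)
  then show ?thesis by (simp add: inner_commute)
qed

lemma quad_scaleR: "x \<bullet> ((c *\<^sub>R A) *v x) = c * (x \<bullet> (A *v x))" for A :: "real^'n::finite^'n"
  by (simp add: scaleR_matrix_vector_assoc[symmetric])

lemma quad_add: "x \<bullet> ((A + B) *v x) = x \<bullet> (A *v x) + x \<bullet> (B *v x)" for A :: "real^'n::finite^'n"
  by (simp add: matrix_vector_mult_add_rdistrib inner_add_right)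

lemma quad_diff: "x \<bullet> ((A - B) *v x) = x \<bullet> (A *v x) - x \<bullet> (B *v x)" for A :: "real^'n::finite^'n"
  by (simp add: matrix_vector_mult_diff_rdistrib inner_diff_right)

lemmas quad_simps = quad_tensor quad_scaleR quad_add quad_diff

lemma form_less_iff: "A \<prec> B \<longleftrightarrow> 0 \<prec> B - A" for A :: "real^'n::finite^'n"
  unfolding form_less_def by (simp add: quad_diff)

lemma form_less_zero_iff: "0 \<prec> A \<longleftrightarrow> (\<forall>x. x \<noteq> 0 \<longrightarrow> 0 < x \<bullet> (A *v x))" for A :: "real^'n::finite^'n"
  unfolding form_less_def by simp

lemma quad_axis: "axis i 1 \<bullet> (A *v axis j 1) = A $ i $ j" for A :: "real^'n::finite^'n"
  by (simp add: inner_axis' matrix_vector_mult_basis column_def)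

lemma quad_le_norm: "\<bar>x \<bullet> (A *v x)\<bar> \<le> real CARD('n) * real CARD('n) * norm A * (norm x)\<^sup>2" for A :: "real^'n::finite^'n"
proof -
  have "x \<bullet> (A *v x) = (\<Sum>i\<in>UNIV. \<Sum>j\<in>UNIV. x $ i * (A $ i $ j * x $ j))"
    by (simp add: inner_vec_def matrix_vector_mult_def sum_distrib_left)
  also have "\<bar>\<dots>\<bar> \<le> (\<Sum>i\<in>(UNIV::'n set). \<Sum>j\<in>(UNIV::'n set). norm x * (norm A * norm x))"
  proof (intro order_trans[OF sum_abs] sum_mono)
    fix i j
    have "\<bar>A $ i $ j\<bar> \<le> norm A" using component_le_norm_cart[of "A $ i" j] Finite_Cartesian_Product.norm_nth_le[of A i] by simp
    then show "\<bar>x $ i * (A $ i $ j * x $ j)\<bar> \<le> norm x * (norm A * norm x)"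
      unfolding abs_mult by (intro mult_mono component_le_norm_cart) auto
  qed
  also have "\<dots> = real CARD('n) * real CARD('n) * norm A * (norm x)\<^sup>2"
    by (simp add: power2_eq_square)
  finally show ?thesis .
qed

text \<open>On the unit sphere the quadratic form has a positive minimum \<open>m\<close>; a change
  of the matrix of norm below \<open>m\<close> divided by the square of the dimension moves the form
  by less than \<open>m\<close>.\<close>

lemma open_posdef: "open {A :: real^'n::finite^'n. 0 \<prec> A}"
proof (rule Topological_Spaces.openI)
  fix A :: "real^'n^'n" assume "A \<in> {A. 0 \<prec> A}"
  then have A: "\<And>x. x \<noteq> 0 \<Longrightarrow> 0 < x \<bullet> (A *v x)" by (simp add: form_less_zero_iff)
  have "continuous_on (sphere 0 1) (\<lambda>x::real^'n. x \<bullet> (A *v x))"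
    by (intro continuous_intros matrix_vector_mult_linear_continuous_on)
  moreover have "sphere (0::real^'n) 1 \<noteq> {}" by simp
  ultimately obtain x0 where x0: "x0 \<in> sphere 0 1" "\<And>x. x \<in> sphere 0 1 \<Longrightarrow> x0 \<bullet> (A *v x0) \<le> x \<bullet> (A *v x)"
    using continuous_attains_inf[OF compact_sphere] by blast
  define m where "m = x0 \<bullet> (A *v x0)"
  have m: "m > 0" unfolding m_def using x0 by (intro A) auto
  define n2 where "n2 = real CARD('n) * real CARD('n)"
  have n2: "n2 > 0" by (simp add: n2_def)
  have "ball A (m / n2) \<subseteq> {A. 0 \<prec> A}"
  proof
    fix B assume "B \<in> ball A (m / n2)"
    then have B: "n2 * norm (B - A) < m" using n2 by (simp add: dist_norm norm_minus_commute field_simps)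
    have "0 < x \<bullet> (B *v x)" if "x \<noteq> 0" for x
    proof -
      define y where "y = (1 / norm x) *\<^sub>R x"
      have y: "norm y = 1" "x = norm x *\<^sub>R y" using that by (auto simp: y_def)
      have "m \<le> y \<bullet> (A *v y)" using x0(2)[of y] y unfolding m_def by simp
      moreover have "\<bar>y \<bullet> ((B - A) *v y)\<bar> \<le> n2 * norm (B - A)"
        using quad_le_norm[of y "B - A"] y by (simp add: n2_def)
      ultimately have "0 < y \<bullet> (B *v y)" using B unfolding quad_diff by linarith
      moreover have "x \<bullet> (B *v x) = (norm x)\<^sup>2 * (y \<bullet> (B *v y))"
        by (subst (1 2) y(2)) (simp add: matrix_vector_mult_scaleR power2_eq_square)
      ultimately show ?thesis using that by simp
    qed
    then show "B \<in> {A. 0 \<prec> A}" by (simp add: form_less_zero_iff)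
  qed
  then show "\<exists>T. open T \<and> A \<in> T \<and> T \<subseteq> {A. 0 \<prec> A}"
    using m n2 by (intro exI[of _ "ball A (m / n2)"]) auto
qed

lemma Sym_inner: "A \<in> Sym \<Longrightarrow> x \<bullet> (A *v y) = y \<bullet> (A *v x)" for A :: "real^'n::finite^'n"
  unfolding Sym_def using dot_lmul_matrix[of y A x] by (simp add: vector_transpose_matrix[symmetric] transpose_matrix_vector inner_commute)

lemma posdef_diag: "0 \<prec> A \<Longrightarrow> 0 < A $ i $ i" for A :: "real^'n::finite^'n"
  unfolding form_less_zero_iff using quad_axis[of i A i] by (metis axis_eq_0_iff zero_neq_one)

lemma posdef_trace_pos: "0 \<prec> A \<Longrightarrow> 0 < trace A" for A :: "real^'n::finite^'n"
  unfolding trace_def by (intro sum_pos posdef_diag) auto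

text \<open>Testing the form on the sum and the difference of two basis vectors bounds an entry by
  the mean of two diagonal entries. In the limit it lets the vanishing of the trace force the whole
  matrix to vanish.\<close>

lemma posdef_entry_le_trace:
  fixes A :: "real^'n::finite^'n"
  assumes "A \<in> Sym" "0 \<prec> A"
  shows "\<bar>A $ i $ j\<bar> \<le> trace A"
proof -
  have q: "0 \<le> x \<bullet> (A *v x)" for x
    using assms(2) unfolding form_less_zero_iff by (cases "x = 0") (auto simp: less_imp_le)
  have "A $ k $ k \<le> trace A" for k
    unfolding trace_def using member_le_sum[of k UNIV "\<lambda>k. A $ k $ k"] posdef_diag[OF assms(2)] by (auto simp: less_imp_le)
  from this[of i] this[of j] q[of "axis i 1 + axis j 1"] q[of "axis i 1 - axis j 1"]
  show ?thesis using Sym_inner[OF assms(1), of "axis i 1" "axis j 1"]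
    by (simp add: matrix_vector_right_distrib matrix_vector_mult_diff_distrib inner_add_left inner_diff_left inner_add_right inner_diff_right quad_axis)
qed

text \<open>The vector is a multiple of the column of \<open>D\<close> through its largest diagonal entry.\<close>

lemma posdef_dominates_square:
  fixes D :: "real^'n::finite^'n"
  assumes S: "D \<in> Sym" and P: "0 \<prec> D"
  obtains a where "\<And>x. (a \<bullet> x)\<^sup>2 \<le> x \<bullet> (D *v x)" "trace D / real CARD('n) \<le> (norm a)\<^sup>2" "(norm a)\<^sup>2 \<le> trace D"
proof -
  have "Max (range (\<lambda>i. D $ i $ i)) \<in> range (\<lambda>i. D $ i $ i)" by (rule Max_in) auto
  then obtain i where i: "D $ i $ i = Max (range (\<lambda>i. D $ i $ i))" by force
  then have le: "D $ j $ j \<le> D $ i $ i" for j by simp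
  define e :: "real^'n" where "e = axis i 1"
  define d where "d = D $ i $ i"
  have d: "d > 0" unfolding d_def by (rule posdef_diag[OF P])
  have ed: "e \<bullet> (D *v e) = d" by (simp add: e_def d_def quad_axis)
  \<comment> \<open>The scaling makes \<open>(a \<bullet> x)\<^sup>2\<close> equal to
    \<open>(e \<bullet> (D *v x))\<^sup>2 / (e \<bullet> (D *v e))\<close>, so the claim is the
    Cauchy-Schwarz inequality for the form of \<open>D\<close>.\<close>
  define a where "a = (1 / sqrt d) *\<^sub>R (D *v e)"
  have ax: "a \<bullet> x = (e \<bullet> (D *v x)) / sqrt d" for x
    using Sym_inner[OF S, of x e] by (simp add: a_def inner_commute)
  have q: "0 \<le> x \<bullet> (D *v x)" for x
    using P unfolding form_less_zero_iff by (cases "x = 0") (auto simp: less_imp_le)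
  have main: "(a \<bullet> x)\<^sup>2 \<le> x \<bullet> (D *v x)" for x
  proof -
    \<comment> \<open>The minimiser of the form along the line
      \<open>x - t *\<^sub>R e\<close>.\<close>
    define t where "t = (e \<bullet> (D *v x)) / d"
    have "0 \<le> (x - t *\<^sub>R e) \<bullet> (D *v (x - t *\<^sub>R e))" by (rule q)
    also have "\<dots> = x \<bullet> (D *v x) - 2 * t * (e \<bullet> (D *v x)) + t\<^sup>2 * d"
      using Sym_inner[OF S, of x e] ed
      by (simp add: matrix_vector_mult_diff_distrib matrix_vector_mult_scaleR inner_diff_left inner_diff_right power2_eq_square algebra_simps)
    also have "\<dots> = x \<bullet> (D *v x) - (a \<bullet> x)\<^sup>2"
      using d by (simp add: ax t_def power_divide power2_eq_square field_simps)
    finally show ?thesis by simp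
  qed
  have na: "(norm a)\<^sup>2 = (\<Sum>j\<in>UNIV. (a $ j)\<^sup>2)"
    by (simp only: power2_norm_eq_inner) (simp add: inner_vec_def power2_eq_square)
  have aj: "(a $ j)\<^sup>2 \<le> D $ j $ j" for j
    using main[of "axis j 1"] by (simp add: quad_axis inner_axis)
  show ?thesis
  proof (rule that[OF main])
    show "(norm a)\<^sup>2 \<le> trace D" unfolding na trace_def by (intro sum_mono aj)
    have "trace D \<le> (\<Sum>j\<in>(UNIV::'n set). d)" unfolding trace_def d_def by (intro sum_mono le)
    then have "trace D / real CARD('n) \<le> d" by (simp add: field_simps)
    also have "d = (a $ i)\<^sup>2"
    proof -
      have "a $ i = a \<bullet> e" by (simp add: e_def inner_axis)
      then show ?thesis using d unfolding ax ed by (simp add: power_divide power2_eq_square)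
    qed
    also have "\<dots> \<le> (norm a)\<^sup>2" unfolding na by (rule member_le_sum) auto
    finally show "trace D / real CARD('n) \<le> (norm a)\<^sup>2" .
  qed
qed

text \<open>The wave speed \<open>\<beta>\<close> makes the first-order change of the quadratic form a multiple of
  \<open>a \<otimes> a\<close>, which the matrix \<open>D\<close> can absorb.\<close>

lemma admissible_wave:
  fixes D :: "real^'n::finite^'n" and v :: "real^'n"
  assumes n: "CARD('n) \<ge> 2" and S: "D \<in> Sym" and P: "0 \<prec> D"
    and m: "0 < m" "m \<le> r" and K: "norm v \<le> K" "trace D \<le> K'"
    and c: "c > 0" "c\<^sup>2 * K' + 2 * c * K \<le> m / 2"
  obtains \<xi> a \<beta> A where "norm \<xi> = 1" "norm a = 1" "\<xi> \<bullet> a = 0" "c * trace D / real CARD('n) \<le> A"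
    "\<And>s. \<bar>s\<bar> \<le> A \<Longrightarrow> 0 \<prec> D + (s * \<beta>) *\<^sub>R (\<xi> \<otimes> a + a \<otimes> \<xi>) - (1 / r) *\<^sub>R (s *\<^sub>R (v \<otimes> a + a \<otimes> v) + s\<^sup>2 *\<^sub>R (a \<otimes> a))"
proof -
  obtain b where b: "\<And>x. (b \<bullet> x)\<^sup>2 \<le> x \<bullet> (D *v x)" "trace D / real CARD('n) \<le> (norm b)\<^sup>2" "(norm b)\<^sup>2 \<le> trace D"
    using posdef_dominates_square[OF S P] by blast
  have tp: "trace D > 0" by (rule posdef_trace_pos[OF P])
  then have "0 < trace D / real CARD('n)" by simp
  then have b0: "b \<noteq> 0" using b(2) by auto
  define \<mu> where "\<mu> = (norm b)\<^sup>2"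
  have \<mu>: "\<mu> > 0" using b0 by (simp add: \<mu>_def)
  define a where "a = (1 / norm b) *\<^sub>R b"
  have a: "norm a = 1" using b0 by (simp add: a_def)
  then have aa: "a \<bullet> a = 1" by (simp add: norm_eq_1)
  have ax: "\<mu> * (a \<bullet> x)\<^sup>2 \<le> x \<bullet> (D *v x)" for x
    using b(1)[of x] b0 by (simp add: a_def \<mu>_def power_mult_distrib power_divide)
  have r: "r > 0" using m by linarith
  \<comment> \<open>The component of \<open>v / r\<close> orthogonal to \<open>a\<close>; it is to
    be written as \<open>\<beta> *\<^sub>R \<xi>\<close>.\<close>
  define w where "w = (1 / r) *\<^sub>R (v - (v \<bullet> a) *\<^sub>R a)"
  have wa: "w \<bullet> a = 0" by (simp add: w_def inner_diff_left aa)
  obtain \<xi> \<beta> where \<xi>: "norm \<xi> = 1" "\<xi> \<bullet> a = 0" "\<beta> *\<^sub>R \<xi> = w"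
  proof (cases "w = 0")
    case True
    \<comment> \<open>Here \<open>v\<close> is parallel to \<open>a\<close> and nothing has to be
      compensated: any unit normal will do, with speed 0. It exists because the dimension is at
      least 2.\<close>
    have "2 \<le> DIM(real^'n)" using n by simp
    then obtain y where y: "y \<noteq> 0" "orthogonal a y" using orthogonal_to_vector_exists by blast
    show ?thesis
      by (rule that[of "(1 / norm y) *\<^sub>R y" 0]) (use y True in \<open>auto simp: orthogonal_def inner_commute\<close>)
  next
    case False
    show ?thesis
      by (rule that[of "(1 / norm w) *\<^sub>R w" "norm w"]) (use False wa in auto)
  qed
  \<comment> \<open>Proportional to the square of \<open>norm b\<close>: the remainder
    \<open>2 * A * K\<close>, linear in the amplitude, has to stay below a multiple of
    \<mu>.\<close>
  define A where "A = c * \<mu>"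
  have A: "A > 0" using c \<mu> by (simp add: A_def)
  have K0: "0 \<le> K" "0 \<le> K'" using K tp norm_ge_zero[of v] by linarith+
  have "A\<^sup>2 + 2 * A * K \<le> \<mu> * (c\<^sup>2 * K' + 2 * c * K)"
  proof -
    have "c\<^sup>2 * \<mu> * \<mu> \<le> c\<^sup>2 * \<mu> * K'" using b(3) K(2) c \<mu> unfolding \<mu>_def by (intro mult_left_mono) auto
    then show ?thesis by (simp add: A_def power2_eq_square algebra_simps)
  qed
  also have "\<dots> \<le> \<mu> * (m / 2)" using c \<mu> by (intro mult_left_mono) auto
  also have "\<dots> \<le> \<mu> * r / 2" using m \<mu> by simp
  finally have Ab: "A\<^sup>2 + 2 * A * K \<le> \<mu> * r / 2" .
  show ?thesis
  proof (rule that[OF \<xi>(1) a \<xi>(2)])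
    have "c * (trace D / real CARD('n)) \<le> c * \<mu>" using b(2) c unfolding \<mu>_def by (intro mult_left_mono) auto
    then show "c * trace D / real CARD('n) \<le> A" by (simp add: A_def)
    fix s :: real assume s: "\<bar>s\<bar> \<le> A"
    let ?E = "D + (s * \<beta>) *\<^sub>R (\<xi> \<otimes> a + a \<otimes> \<xi>) - (1 / r) *\<^sub>R (s *\<^sub>R (v \<otimes> a + a \<otimes> v) + s\<^sup>2 *\<^sub>R (a \<otimes> a))"
    show "0 \<prec> ?E"
      unfolding form_less_zero_iff
    proof (intro allI impI)
      fix x :: "real^'n" assume x: "x \<noteq> 0"
      have bx: "\<beta> * (\<xi> \<bullet> x) = (v \<bullet> x - (v \<bullet> a) * (a \<bullet> x)) / r"
      proof -
        have "\<beta> * (\<xi> \<bullet> x) = w \<bullet> x" using \<xi>(3) by (metis inner_scaleR_left)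
        then show ?thesis by (simp add: w_def inner_diff_left)
      qed
      have "x \<bullet> (?E *v x)
        = x \<bullet> (D *v x) + 2 * s * (\<beta> * (\<xi> \<bullet> x)) * (a \<bullet> x) - (2 * s * (v \<bullet> x) * (a \<bullet> x) + s\<^sup>2 * (a \<bullet> x)\<^sup>2) / r"
        by (simp add: quad_simps algebra_simps power2_eq_square add_divide_distrib)
      \<comment> \<open>The speed term cancels the part of \<open>v \<bullet> x\<close> orthogonal
        to \<open>a\<close>; what is left of the first-order change is a multiple of
        \<open>(a \<bullet> x)\<^sup>2\<close>.\<close>
      also have "\<dots> = x \<bullet> (D *v x) - (s\<^sup>2 + 2 * s * (v \<bullet> a)) * (a \<bullet> x)\<^sup>2 / r"
        unfolding bx using r by (simp add: field_simps power2_eq_square)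
      finally have eq: "x \<bullet> (?E *v x)
        = x \<bullet> (D *v x) - (s\<^sup>2 + 2 * s * (v \<bullet> a)) * (a \<bullet> x)\<^sup>2 / r" .
      have "s\<^sup>2 + 2 * s * (v \<bullet> a) \<le> A\<^sup>2 + 2 * A * K"
      proof -
        have "s\<^sup>2 \<le> A\<^sup>2" using s by (simp add: abs_le_square_iff[symmetric])
        moreover have "\<bar>v \<bullet> a\<bar> \<le> K" using Cauchy_Schwarz_ineq2[of v a] a K(1) by simp
        then have "\<bar>s\<bar> * \<bar>v \<bullet> a\<bar> \<le> A * K" using s by (intro mult_mono) auto
        then have "s * (v \<bullet> a) \<le> A * K" by (metis abs_le_D1 abs_mult)
        ultimately show ?thesis by simp
      qed
      then have "(s\<^sup>2 + 2 * s * (v \<bullet> a)) * (a \<bullet> x)\<^sup>2 / r \<le> (\<mu> * r / 2) * (a \<bullet> x)\<^sup>2 / r"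
        using Ab r by (intro divide_right_mono mult_right_mono) auto
      also have "\<dots> = (\<mu> * (a \<bullet> x)\<^sup>2) / 2" using r by simp
      also have "\<dots> \<le> (x \<bullet> (D *v x)) / 2" using ax by simp
      also have "\<dots> < x \<bullet> (D *v x)" using P x unfolding form_less_zero_iff by auto
      finally show "0 < x \<bullet> (?E *v x)"
        unfolding eq by simp
    qed
  qed
qed

section \<open>The defect matrix\<close>

text \<open>Right minus left hand side of the asserted identity as a function of the state
  \<open>s\<close>. The multiple of the identity in \<open>U_of\<close> cancels the one on the
  right, see \<open>defect_eq\<close>.\<close>

definition defect :: "(('n::finite) point \<Rightarrow> real) \<Rightarrow> ('n point \<Rightarrow> real^'n) \<Rightarrow> ('n point \<Rightarrow> real^'n^'n) \<Rightarrow> 'n point \<Rightarrow> 'n state \<Rightarrow> real^'n^'n" where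
  "defect \<rho> V R z s = R z + (1 / \<rho> z) *\<^sub>R (V z \<otimes> V z) + snd s - (1 / \<rho> z) *\<^sub>R ((V z + fst s) \<otimes> (V z + fst s))"

lemma defect_eq: "defect \<rho> V R z s = ((norm (V z))\<^sup>2 / (real CARD('n) * \<rho> z)) *\<^sub>R mat 1 + R z
    - ((1 / \<rho> z) *\<^sub>R ((V z + fst s) \<otimes> (V z + fst s)) - (U_of \<rho> V z + snd s))"
  for \<rho> :: "('n::finite) point \<Rightarrow> real"
  by (simp add: defect_def U_of_def)

lemma tensor_add: "(u + u') \<otimes> w = u \<otimes> w + u' \<otimes> w" "w \<otimes> (u + u') = w \<otimes> u + w \<otimes> u'"
  by (simp_all add: vec_eq_iff algebra_simps)

lemma tensor_scaleR: "(c *\<^sub>R u) \<otimes> w = c *\<^sub>R (u \<otimes> w)" "w \<otimes> (c *\<^sub>R u) = c *\<^sub>R (w \<otimes> u)"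
  by (simp_all add: vec_eq_iff algebra_simps)

lemma trace_tensor: "trace (u \<otimes> w) = u \<bullet> w" for u :: "real^'n::finite"
  by (simp add: trace_def inner_vec_def)

lemma trace_scaleR: "trace (c *\<^sub>R A) = c * trace A" for A :: "real^'n::finite^'n"
  by (simp add: trace_def sum_distrib_left)

lemma defect_add: "defect \<rho> V R z (s + (c *\<^sub>R (a, B))) = defect \<rho> V R z s + c *\<^sub>R B
   - (1 / \<rho> z) *\<^sub>R (c *\<^sub>R ((V z + fst s) \<otimes> a + a \<otimes> (V z + fst s)) + c\<^sup>2 *\<^sub>R (a \<otimes> a))"
  by (simp add: defect_def tensor_add tensor_scaleR scaleR_add_right power2_eq_square add.assoc[symmetric])

text \<open>The matrix component of the state is traceless and drops out, which leaves an energy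
  balance for the velocity alone. It yields both the uniform bounds on \<open>X0\<close> and the
  final estimate.\<close>

lemma trace_defect:
  assumes "snd s \<in> Sym0"
  shows "trace (defect \<rho> V R z s) = trace (R z) - 2 * (V z \<bullet> fst s) / \<rho> z - (norm (fst s))\<^sup>2 / \<rho> z"
  using assms unfolding defect_def Sym0_def
  by (simp add: trace_add trace_sub trace_scaleR trace_tensor power2_norm_eq_inner inner_add_left inner_add_right inner_commute add_divide_distrib)

lemma defect_Sym: "R z \<in> Sym \<Longrightarrow> snd s \<in> Sym0 \<Longrightarrow> defect \<rho> V R z s \<in> Sym"
  unfolding Sym0_def Sym_def defect_def transpose_def by (simp add: vec_eq_iff mult.commute)

lemma continuous_on_tensor: "continuous_on S f \<Longrightarrow> continuous_on S g \<Longrightarrow> continuous_on S (\<lambda>z. f z \<otimes> g z)"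
  unfolding tensor_def by (intro continuous_intros)

lemma continuous_on_trace: "continuous_on S f \<Longrightarrow> continuous_on S (\<lambda>z. trace (f z :: real^'n::finite^'n))"
  unfolding trace_def by (intro continuous_intros)

text \<open>Continuity jointly in the point and the state: admissible pairs then form an open set,
  and a wave may be tested at a frozen centre.\<close>

lemma continuous_on_defect:
  fixes \<rho> :: "('n::finite) point \<Rightarrow> real"
  assumes "continuous_on P \<rho>" "continuous_on P V" "continuous_on P R" "\<And>z. z \<in> P \<Longrightarrow> \<rho> z \<noteq> 0"
  shows "continuous_on (P \<times> UNIV) (\<lambda>y. defect \<rho> V R (fst y) (snd y))"
proof -
  have c: "continuous_on (P \<times> UNIV) (\<lambda>y. g (fst y))" if "continuous_on P g" for g :: "'n point \<Rightarrow> 'c::topological_space"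
    by (rule continuous_on_compose2[OF that]) (auto intro: continuous_on_fst continuous_on_id)
  note c' = c[OF assms(1)] c[OF assms(2)] c[OF assms(3)]
  show ?thesis unfolding defect_def
    by (intro continuous_intros continuous_on_tensor c') (use assms(4) in auto)
qed

subsection \<open>The unit cell\<close>

definition unit_cell :: "real \<Rightarrow> ('n::finite) point set" where
  "unit_cell T = {0<..<T} \<times> {x. \<forall>i. 0 \<le> x $ i \<and> x $ i < 1}"

definition closed_unit_cell :: "real \<Rightarrow> ('n::finite) point set" where
  "closed_unit_cell T = {0..T} \<times> cbox 0 1"

lemma spacetime_eq: "spacetime T = lebesgue_on (unit_cell T)"
  by (simp add: spacetime_def unit_cell_def)

lemma unit_cell_subset: "unit_cell T \<subseteq> closed_unit_cell T" "closed_unit_cell T \<subseteq> slab T"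
  by (auto simp: unit_cell_def closed_unit_cell_def slab_def mem_box_cart less_imp_le)

lemma compact_closed_unit_cell: "compact (closed_unit_cell T)"
  unfolding closed_unit_cell_def by (intro compact_Times compact_Icc compact_cbox)

lemma unit_cell_borel: "unit_cell T \<in> sets (borel :: ('n::finite) point measure)"
proof -
  have "unit_cell T = ({0<..<T} \<times> UNIV) \<inter> (\<Inter>i\<in>UNIV. {z::'n point. 0 \<le> snd z $ i} \<inter> {z. snd z $ i < 1})"
    by (auto simp: unit_cell_def)
  moreover have "{z::'n point. 0 \<le> snd z $ i} \<in> sets borel" for i
    by (intro borel_closed closed_Collect_le continuous_intros)
  moreover have "{z::'n point. snd z $ i < 1} \<in> sets borel" for i
    by (intro borel_open open_halfspaces_point)
  moreover have "({0<..<T} \<times> UNIV :: 'n point set) \<in> sets borel"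
    by (intro borel_open open_Times) auto
  ultimately show ?thesis by (simp add: sets.finite_INT)
qed

lemma unit_cell_lebesgue [measurable]: "unit_cell T \<in> sets (lebesgue :: ('n::finite) point measure)"
  using unit_cell_borel by (metis sets_completionI_sets sets_lborel)

lemma space_spacetime: "space (spacetime T) = unit_cell T"
  by (simp add: spacetime_eq)

lemma finite_measure_spacetime: "finite_measure (spacetime T :: ('n::finite) point measure)"
proof
  have "emeasure lebesgue (unit_cell T :: 'n point set) \<le> emeasure lebesgue (closed_unit_cell T :: 'n point set)"
    using compact_closed_unit_cell[of T] by (intro emeasure_mono unit_cell_subset fmeasurableD lmeasurable_compact)
  also have "\<dots> < \<infinity>"
    using fmeasurableD2[OF lmeasurable_compact[OF compact_closed_unit_cell]] by (simp add: top.not_eq_extremum)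
  finally show "emeasure (spacetime T) (space (spacetime T :: 'n point measure)) \<noteq> \<infinity>"
    by (simp add: spacetime_eq emeasure_restrict_space)
qed

lemma measurable_spacetime:
  fixes f :: "('n::finite) point \<Rightarrow> 'b::euclidean_space"
  assumes "continuous_on S f" "unit_cell T \<subseteq> S"
  shows "f \<in> borel_measurable (spacetime T)"
  unfolding spacetime_eq
  by (rule continuous_imp_measurable_on_sets_lebesgue[OF continuous_on_subset[OF assms]]) measurable

lemma integrable_spacetime_bounded:
  fixes f :: "('n::finite) point \<Rightarrow> 'b::euclidean_space"
  assumes "f \<in> borel_measurable (spacetime T)" "AE z in spacetime T. norm (f z) \<le> C"
  shows "integrable (spacetime T) f"
  using finite_measure.integrable_const_bound[OF finite_measure_spacetime assms(2,1)] .

lemma continuous_slab_bounded: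
  fixes f :: "('n::finite) point \<Rightarrow> 'b::euclidean_space"
  assumes "continuous_on (slab T) f"
  obtains C where "C \<ge> 0" "\<And>z. z \<in> closed_unit_cell T \<Longrightarrow> norm (f z) \<le> C"
proof -
  have "bounded (f ` closed_unit_cell T)"
    using compact_continuous_image[OF continuous_on_subset[OF assms unit_cell_subset(2)] compact_closed_unit_cell]
    by (rule compact_imp_bounded)
  then obtain C where "\<And>z. z \<in> closed_unit_cell T \<Longrightarrow> norm (f z) \<le> C" unfolding bounded_iff by auto
  then show ?thesis using that[of "max C 0"] by fastforce
qed

lemma integrable_spacetime_continuous:
  fixes f :: "('n::finite) point \<Rightarrow> 'b::euclidean_space"
  assumes "continuous_on (slab T) f"
  shows "integrable (spacetime T) f"
proof -
  obtain C where C: "\<And>z. z \<in> closed_unit_cell T \<Longrightarrow> norm (f z) \<le> C"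
    using continuous_slab_bounded[OF assms] by blast
  show ?thesis
  proof (rule integrable_spacetime_bounded)
    show "f \<in> borel_measurable (spacetime T)"
      by (rule measurable_spacetime[OF assms]) (use unit_cell_subset in blast)
    show "AE z in spacetime T. norm (f z) \<le> C"
      using C unit_cell_subset(1) by (intro AE_I2) (auto simp: space_spacetime)
  qed
qed

lemma smooth_measurable: 
  fixes f :: "('n::finite) point \<Rightarrow> 'b::euclidean_space"
  shows "smooth f \<Longrightarrow> f \<in> borel_measurable (spacetime T)"
  by (rule measurable_spacetime[of UNIV]) (auto intro: smooth_continuous)

lemma wrap_unit_cell: "fst z \<in> {0<..<T} \<Longrightarrow> wrap z \<in> unit_cell T"
  by (auto simp: wrap_def unit_cell_def frac_lt_1)

section \<open>Periodic functions and the unit cell\<close>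

lemma periodic_shift:
  assumes "space_periodic_on I f" "t \<in> I"
  shows "f (t, x + of_int m *\<^sub>R axis i 1) = f (t, x)"
proof -
  have p: "f (t, x + axis i 1) = f (t, x)" for x using assms by (simp add: space_periodic_on_def)
  show ?thesis
  proof (induction m rule: int_induct[where k = 0])
    case (step1 m)
    then show ?case using p[of "x + of_int m *\<^sub>R axis i 1"] by (simp add: algebra_simps)
  next
    case (step2 m)
    then show ?case using p[of "x + of_int (m - 1) *\<^sub>R axis i 1"] by (simp add: algebra_simps)
  qed simp
qed

text \<open>Wrapping subtracts an integer multiple of every basis vector, one coordinate after the
  other.\<close>

lemma periodic_wrap:
  fixes f :: "('n::finite) point \<Rightarrow> 'b"
  assumes "space_periodic_on I f" "fst z \<in> I"
  shows "f (wrap z) = f z"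
proof -
  have "f (fst z, snd z + (\<Sum>i\<in>S. of_int (m i) *\<^sub>R axis i 1)) = f z" for S :: "'n set" and m
  proof (induction S rule: infinite_finite_induct)
    case (insert j S)
    then show ?case
      using periodic_shift[OF assms, of "snd z + (\<Sum>i\<in>S. of_int (m i) *\<^sub>R axis i 1)" "m j" j] by (simp add: algebra_simps)
  qed simp_all
  from this[of "\<lambda>i. - \<lfloor>snd z $ i\<rfloor>" UNIV] 
  have "f (fst z, snd z + (\<Sum>i\<in>UNIV. of_int (- \<lfloor>snd z $ i\<rfloor>) *\<^sub>R axis i 1)) = f z" .
  moreover have "snd z + (\<Sum>i\<in>UNIV. of_int (- \<lfloor>snd z $ i\<rfloor>) *\<^sub>R axis i 1) = (\<chi> i. frac (snd z $ i))"
    by (simp add: vec_eq_iff frac_def axis_def if_distrib[of "\<lambda>x. _ * x"] sum_negf cong: if_cong)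
  ultimately show ?thesis by (simp add: wrap_def)
qed

lemma state_of_potential_translate:
  "smooth \<phi> \<Longrightarrow> state_of_potential \<xi> a (\<lambda>z. \<phi> (z + k)) z = state_of_potential \<xi> a \<phi> (z + k)"
  unfolding state_of_potential_def by (simp add: ddir_translate smooth_ddir)

lemma periodic_state_of_potential:
  fixes \<phi> :: "('n::finite) point \<Rightarrow> real"
  assumes "smooth (\<lambda>z. \<phi> (wrap z))"
  shows "space_periodic_on UNIV (state_of_potential \<xi> a (\<lambda>z. \<phi> (wrap z)))"
  unfolding space_periodic_on_def
proof (intro ballI allI)
  fix t x and i :: 'n
  have "wrap (z + (0, axis i 1)) = wrap z" for z :: "'n point"
    using wrap_axis[of "fst z" "snd z" i] by (simp add: plus_prod_def)
  then show "state_of_potential \<xi> a (\<lambda>z. \<phi> (wrap z)) (t, x + axis i 1) = state_of_potential \<xi> a (\<lambda>z. \<phi> (wrap z)) (t, x)"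
    using state_of_potential_translate[OF assms, of \<xi> a "(0, axis i 1)" "(t, x)"] by simp
qed

subsection \<open>Perturbations of a subsolution\<close>

locale subsolution =
  fixes T :: real and \<rho> :: "('n::finite) point \<Rightarrow> real" and V :: "'n point \<Rightarrow> real^'n"
    and R :: "'n point \<Rightarrow> real^'n^'n" and P :: "'n point set"
  assumes T: "T > 0" and dim: "CARD('n) \<ge> 2"
    and per: "space_periodic_on {0..T} \<rho>" "space_periodic_on {0..T} V" "space_periodic_on {0..T} R"
    and cont: "continuous_on (slab T) \<rho>" "continuous_on (slab T) V" "continuous_on (slab T) R"
    and pos: "\<And>z. z \<in> slab T \<Longrightarrow> 0 < \<rho> z" "\<And>z. z \<in> slab T \<Longrightarrow> R z \<in> Sym" "\<And>z. z \<in> slab T \<Longrightarrow> 0 \<prec> R z"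
    and region: "open_region T P"
begin

abbreviation "M \<equiv> spacetime T :: 'n point measure"
abbreviation "Adm \<equiv> X0 T P \<rho> V R"
abbreviation "D \<equiv> defect \<rho> V R"

lemma P_slab: "P \<subseteq> slab T" and P_time: "z \<in> P \<Longrightarrow> fst z \<in> {0<..<T}" and open_P: "open P"
  using region by (auto simp: open_region_def slab_def)

lemma P_wrap: "wrap z \<in> P \<longleftrightarrow> z \<in> P"
  using periodic_wrap[of UNIV "\<lambda>z. z \<in> P" z] region by (simp add: open_region_def)

lemma D_wrap: "fst z \<in> {0..T} \<Longrightarrow> D (wrap z) s = D z s"
  unfolding defect_def using per[THEN periodic_wrap] by simp

lemma X0_iff: "f \<in> Adm \<longleftrightarrow> f \<in> test_states P \<and> solves T f \<and>
    \<bar>LINT z|M. (V z \<bullet> fst (f z)) / \<rho> z\<bar> \<le> 1 / 8 * (LINT z|M. (norm (fst (f z)))\<^sup>2 / \<rho> z) \<and>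
    (\<forall>z\<in>P. 0 \<prec> D z (f z))"
  unfolding X0_def Let_def solves_def defect_eq 
  by (subst form_less_iff[where A = "_ - _"]) auto

lemma test_states_iff: "f \<in> test_states P \<longleftrightarrow> smooth f \<and> space_periodic_on UNIV f \<and>
     (\<forall>z. snd (f z) \<in> Sym0) \<and> closure {z. f z \<noteq> 0} \<subseteq> P"
  by (simp add: test_states_def)

lemma X0D:
  assumes "f \<in> Adm"
  shows "smooth f" "space_periodic_on UNIV f" "\<And>z. snd (f z) \<in> Sym0" "\<And>z. z \<in> P \<Longrightarrow> 0 \<prec> D z (f z)"
    "\<And>z. z \<notin> P \<Longrightarrow> f z = 0" "closure {z. f z \<noteq> 0} \<subseteq> P" "solves T f"
proof -
  show "f z = 0" if "z \<notin> P" for z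
    using assms that closure_subset[of "{z. f z \<noteq> 0}"] unfolding X0_iff test_states_iff by blast
qed (use assms in \<open>auto simp: X0_iff test_states_iff\<close>)

text \<open>The trace of the defect is positive and equals \<open>trace R\<close> plus the energy
  density of \<open>V\<close> minus that of the perturbed field. This bounds both the trace and the
  perturbed velocity by the data, uniformly over \<open>X0\<close>. The data are bounded on the
  compact cell, and periodicity carries the bounds to all of \<open>P\<close>.\<close>

lemma uniform_bounds:
  obtains m r K K' c where "0 < m" "0 < c" "c\<^sup>2 * K' + 2 * c * K \<le> m / 2"
    "\<And>z. z \<in> closed_unit_cell T \<Longrightarrow> m \<le> \<rho> z \<and> \<rho> z \<le> r"
    "\<And>f z. f \<in> Adm \<Longrightarrow> z \<in> P \<Longrightarrow> norm (V z + fst (f z)) \<le> K \<and> trace (D z (f z)) \<le> K'"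
proof -
  have "(0, 0) \<in> (closed_unit_cell T :: 'n point set)"
    using T by (simp add: closed_unit_cell_def mem_box_cart)
  then have cell: "closed_unit_cell T \<noteq> ({} :: 'n point set)" by blast
  obtain z0 where z0: "z0 \<in> closed_unit_cell T" "\<And>z. z \<in> closed_unit_cell T \<Longrightarrow> \<rho> z0 \<le> \<rho> z"
    using continuous_attains_inf[OF compact_closed_unit_cell cell continuous_on_subset[OF cont(1) unit_cell_subset(2)]] by blast
  define m where "m = \<rho> z0"
  have m: "m > 0" unfolding m_def using z0(1) unit_cell_subset(2) pos(1) by blast
  obtain r where r: "r \<ge> 0" "\<And>z. z \<in> closed_unit_cell T \<Longrightarrow> norm (\<rho> z) \<le> r" using continuous_slab_bounded[OF cont(1)] by blast
  obtain B where B: "B \<ge> 0" "\<And>z. z \<in> closed_unit_cell T \<Longrightarrow> norm (V z) \<le> B" using continuous_slab_bounded[OF cont(2)] by blast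
  obtain t where t: "t \<ge> 0" "\<And>z. z \<in> closed_unit_cell T \<Longrightarrow> norm (trace (R z)) \<le> t"
    using continuous_slab_bounded[OF continuous_on_trace[OF cont(3)]] by blast
  define K' where "K' = t + B\<^sup>2 / m"
  \<comment> \<open>From \<open>x\<^sup>2 \<le> r * K'\<close> and
    \<open>2 * x \<le> x\<^sup>2 + 1\<close> one gets \<open>x \<le> K\<close> without a square
    root.\<close>
  define K where "K = 1 + r * K'"
  have K0: "K' \<ge> 0" "K \<ge> 0" using t B m r by (auto simp: K'_def K_def)
  \<comment> \<open>Taking \<open>c \<le> 1\<close> replaces \<open>c\<^sup>2\<close> by
    \<open>c\<close>, after which the smallness condition of \<open>admissible_wave\<close> is
    linear in \<open>c\<close>.\<close>
  define c where "c = min 1 (m / (2 * (K' + 2 * K + 1)))"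
  have c: "c > 0" "c \<le> 1" using m K0 by (auto simp: c_def)
  have "c\<^sup>2 * K' \<le> c * K'" using c K0 by (intro mult_right_mono) (auto simp: power2_eq_square mult_left_le)
  then have "c\<^sup>2 * K' + 2 * c * K \<le> c * (K' + 2 * K + 1)" using c by (simp add: algebra_simps)
  also have "\<dots> \<le> m / (2 * (K' + 2 * K + 1)) * (K' + 2 * K + 1)" using K0 by (intro mult_right_mono) (auto simp: c_def)
  also have "\<dots> = m / 2" using K0 by (simp add: field_simps)
  finally have c2: "c\<^sup>2 * K' + 2 * c * K \<le> m / 2" .
  show ?thesis
  proof (rule that[OF m c(1) c2])
    show "m \<le> \<rho> z \<and> \<rho> z \<le> r" if "z \<in> closed_unit_cell T" for z using z0(2)[OF that] r(2)[OF that] by (auto simp: m_def)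
    fix f z assume f: "f \<in> Adm" and z: "z \<in> P"
    define y where "y = wrap z"
    have y: "y \<in> P" "y \<in> closed_unit_cell T" using z P_wrap wrap_unit_cell[OF P_time[OF z]] unit_cell_subset by (auto simp: y_def)
    have fy: "f y = f z" unfolding y_def using periodic_wrap[OF X0D(2)[OF f]] by simp
    have Vy: "V y = V z" unfolding y_def using periodic_wrap[OF per(2)] P_time[OF z] by simp
    have Dy: "D y (f y) = D z (f z)" unfolding fy unfolding y_def using D_wrap P_time[OF z] by simp
    have \<rho>: "m \<le> \<rho> y" "\<rho> y \<le> r" using z0(2)[OF y(2)] r(2)[OF y(2)] by (auto simp: m_def)
    have tr: "trace (D y (f y)) = trace (R y) + (norm (V y))\<^sup>2 / \<rho> y - (norm (V y + fst (f y)))\<^sup>2 / \<rho> y"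
      unfolding trace_defect[OF X0D(3)[OF f]]
      by (simp add: power2_norm_eq_inner inner_add_left inner_add_right inner_commute add_divide_distrib)
    have "(norm (V y))\<^sup>2 / \<rho> y \<le> B\<^sup>2 / m"
      using B y m \<rho> by (intro frac_le power_mono) auto
    moreover have "trace (R y) \<le> t" using t(2)[OF y(2)] by simp
    ultimately have tk: "trace (R y) + (norm (V y))\<^sup>2 / \<rho> y \<le> K'" by (simp add: K'_def)
    moreover have "0 \<le> (norm (V y + fst (f y)))\<^sup>2 / \<rho> y" using m \<rho> by simp
    ultimately have "trace (D y (f y)) \<le> K'" unfolding tr by simp
    moreover have "norm (V y + fst (f y)) \<le> K"
    proof -
      have "(norm (V y + fst (f y)))\<^sup>2 / \<rho> y \<le> K'"
        using posdef_trace_pos[OF X0D(4)[OF f y(1)]] tk unfolding tr by simp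
      then have "(norm (V y + fst (f y)))\<^sup>2 \<le> \<rho> y * K'" using m \<rho> by (simp add: field_simps)
      also have "\<dots> \<le> r * K'" using \<rho> K0 by (intro mult_right_mono) auto
      finally have s: "(norm (V y + fst (f y)))\<^sup>2 \<le> r * K'" .
      have "2 * norm (V y + fst (f y)) \<le> (norm (V y + fst (f y)))\<^sup>2 + 1"
        using sum_squares_ge_zero[of "norm (V y + fst (f y)) - 1" 0] by (simp add: power2_eq_square algebra_simps)
      moreover have "0 \<le> r * K'" using r K0 by simp
      ultimately show ?thesis using s unfolding K_def by linarith
    qed
    ultimately show "norm (V z + fst (f z)) \<le> K \<and> trace (D z (f z)) \<le> K'" using Dy Vy fy by simp
  qed
qed

text \<open>The interface between single waves and the global argument: \<open>B\<close> carries the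
  perturbation within the cell, \<open>E\<close> bounds its kinetic energy from below. The
  conditions that involve the size of \<open>N\<close> are only eventual, so that finitely many
  perturbations can be combined.\<close>

definition perturbs :: "('n point \<Rightarrow> 'n state) \<Rightarrow> 'n point set \<Rightarrow> real \<Rightarrow> (nat \<Rightarrow> 'n point \<Rightarrow> 'n state) \<Rightarrow> bool" where
  "perturbs f B E w \<longleftrightarrow>
     (\<forall>N. smooth (w N) \<and> space_periodic_on UNIV (w N) \<and> solves T (w N)) \<and>
     (\<forall>N z. snd (w N z) \<in> Sym0 \<and> (wrap z \<notin> B \<longrightarrow> w N z = 0)) \<and>
     (\<exists>C. \<forall>\<^sub>F N in sequentially. \<forall>z. norm (w N z) \<le> C) \<and>
     (\<forall>\<^sub>F N in sequentially. \<forall>z\<in>P. 0 \<prec> D z (f z + w N z)) \<and>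
     (\<forall>\<phi>\<in>L1_fun T. (\<lambda>N. LINT z|M. w N z \<bullet> \<phi> z) \<longlonglongrightarrow> 0) \<and>
     (\<forall>\<^sub>F N in sequentially. E \<le> (LINT z|M. (norm (fst (w N z)))\<^sup>2))"

end

text \<open>The potential is wrapped before the state is formed, so the system and the vanishing
  trace hold exactly for the cut-off wave. The only cost is the error \<open>C / N\<close> against
  the plane wave, with \<open>C\<close> independent of the frequency and the point.\<close>

lemma periodic_wave:
  fixes G :: "('n::finite) point \<Rightarrow> real" and \<beta> :: real
  assumes G: "smooth G" "\<And>z. z \<notin> K \<Longrightarrow> G z = 0" and K: "compact K" "K \<subseteq> open_cell"
    and fr: "norm \<xi> = 1" "norm a = 1" "\<xi> \<bullet> a = 0" and T: "T > 0"
  obtains w :: "nat \<Rightarrow> 'n point \<Rightarrow> 'n state" and C where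
    "\<And>N. smooth (w N)" "\<And>N. space_periodic_on UNIV (w N)" "\<And>N. solves T (w N)"
    "\<And>N z. snd (w N z) \<in> Sym0" "\<And>N z. wrap z \<notin> K \<Longrightarrow> w N z = 0" "C \<ge> 0"
    "\<And>N z. N \<ge> 1 \<Longrightarrow> norm (w N z - (G (wrap z) * - cos (real N * ((- \<beta>, \<xi>) \<bullet> wrap z))) *\<^sub>R (a, \<beta> *\<^sub>R (\<xi> \<otimes> a + a \<otimes> \<xi>))) \<le> C / real N"
proof -
  define \<phi> where "\<phi> N z = G z * (sin (real N * ((- \<beta>, \<xi>) \<bullet> z)) / real N ^ 3)" for N :: nat and z
  define w where "w N = state_of_potential \<xi> a (\<lambda>z. \<phi> N (wrap z))" for N
  have s\<phi>: "smooth (\<phi> N)" for N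
    unfolding \<phi>_def divide_inverse
    by (rule smooth_mult[OF G(1) smooth_mult[OF smooth_phase[OF smooth_sin] smooth_const]])
  have \<phi>0: "\<phi> N z = 0" if "z \<notin> K" for N z using G(2)[OF that] by (simp add: \<phi>_def)
  have sp: "smooth (\<lambda>z. \<phi> N (wrap z))" for N
    by (rule smooth_periodisation[OF K s\<phi> \<phi>0])
  have w0: "w N z = 0" if "wrap z \<notin> K" for N z
  proof -
    have "open (- {z. wrap z \<in> K})" using closed_wrap_vimage[OF K] by blast
    then have "w N z = state_of_potential \<xi> a (\<lambda>z. 0) z"
      unfolding w_def by (rule state_of_potential_cong) (use that \<phi>0 in auto)
    then show ?thesis by (simp add: state_of_potential_zero)
  qed
  have wper: "space_periodic_on UNIV (w N)" for N
    unfolding w_def by (rule periodic_state_of_potential[OF sp])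
  obtain C where C: "C \<ge> 0" "\<And>N z. N \<ge> 1 \<Longrightarrow> norm (state_of_potential \<xi> a (\<phi> N) z -
      (G z * - cos (real N * ((- \<beta>, \<xi>) \<bullet> z))) *\<^sub>R (a, \<beta> *\<^sub>R (\<xi> \<otimes> a + a \<otimes> \<xi>))) \<le> C / real N"
    using state_of_potential_wave[OF G(1) K(1) G(2) fr(1,3), of \<beta>] unfolding \<phi>_def by fastforce
  show ?thesis
  proof (rule that[OF _ wper])
    show "smooth (w N)" for N unfolding w_def by (rule smooth_state_of_potential[OF sp])
    show "solves T (w N)" for N unfolding w_def by (rule solves_state_of_potential[OF sp T])
    show "snd (w N z) \<in> Sym0" for N z unfolding w_def by (rule state_of_potential_Sym0[OF fr])
    show "0 \<le> C" by fact
    show "w N z = 0" if "wrap z \<notin> K" for N z using w0[OF that] .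
    show "norm (w N z - (G (wrap z) * - cos (real N * ((- \<beta>, \<xi>) \<bullet> wrap z))) *\<^sub>R (a, \<beta> *\<^sub>R (\<xi> \<otimes> a + a \<otimes> \<xi>))) \<le> C / real N"
      if "N \<ge> 1" for N z
    proof (cases "wrap z \<in> K")
      case True
      \<comment> \<open>By periodicity the error is examined at the wrapped point, near which the
        wrapped and the unwrapped potential coincide.\<close>
      have ww: "wrap (wrap z) = wrap z" using True K(2) wrap_open_cell by blast
      have "w N z = w N (wrap z)" using periodic_wrap[OF wper, of z N] by simp
      also have "\<dots> = state_of_potential \<xi> a (\<phi> N) (wrap z)"
        unfolding w_def
        by (rule state_of_potential_cong[OF open_open_cell]) (simp_all add: wrap_open_cell subsetD[OF K(2) True])
      finally show ?thesis using C(2)[OF that, of "wrap z"] by simp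
    next
      case False
      then show ?thesis using w0[OF False] G(2)[OF False] C(1) by simp
    qed
  qed
qed

section \<open>Oscillating integrals and the energy of the bump on the unit cell\<close>

lemma integrable_spacetime_iff:
  fixes f :: "('n::finite) point \<Rightarrow> real"
  shows "integrable (spacetime T) f \<longleftrightarrow> integrable lebesgue (\<lambda>z. indicator (unit_cell T) z * f z)"
  unfolding spacetime_eq by (subst integrable_restrict_space) (auto simp: unit_cell_lebesgue)

lemma integral_spacetime_eq:
  fixes f :: "('n::finite) point \<Rightarrow> real"
  shows "(LINT z|spacetime T. f z) = (LINT z|lebesgue. indicator (unit_cell T) z * f z)"
  unfolding spacetime_eq by (subst integral_restrict_space) (auto simp: unit_cell_lebesgue)

lemma Riemann_Lebesgue_spacetime:
  fixes f :: "('n::finite) point \<Rightarrow> real"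
  assumes "integrable (spacetime T) f" "\<nu> \<noteq> 0"
  shows "(\<lambda>N::nat. LINT z|spacetime T. f z * cos (real N * (\<nu> \<bullet> z))) \<longlonglongrightarrow> 0"
  using Riemann_Lebesgue[OF assms(1)[unfolded integrable_spacetime_iff] assms(2)]
  unfolding integral_spacetime_eq by (simp add: mult.assoc)

text \<open>On the ball of half the radius the squared bump is at least \<open>exp (- 4)\<close>; averaging the square of
  the cosine, the square of a sum and a margin for the limit account for the factor 8.\<close>

definition wave_energy :: "('n::finite) itself \<Rightarrow> real" where
  "wave_energy _ = exp (- 4) / (8 * 2 ^ DIM('n point))"

lemma wave_energy_pos: "wave_energy TYPE('n::finite) > 0"
  by (simp add: wave_energy_def)

lemma bump_energy:
  fixes z0 :: "('n::finite) point"
  assumes "0 < r" "cball z0 r \<subseteq> unit_cell T"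
  shows "8 * wave_energy TYPE('n) * measure lebesgue (cball z0 r) \<le> (LINT z|spacetime T. (bump z0 r z)\<^sup>2)"
proof -
  have bi: "integrable (spacetime T) (\<lambda>z. (bump z0 r z)\<^sup>2)"
    by (intro integrable_spacetime_continuous continuous_intros smooth_continuous smooth_bump)
  have sub: "ball z0 (r / 2) \<subseteq> unit_cell T" using assms by (auto simp: subset_iff)
  have "measure lebesgue (ball z0 (r / 2)) = measure lebesgue (cball z0 r) / 2 ^ DIM('n point)"
    using assms(1) by (simp add: content_ball content_cball power_divide measure_completion)
  then have "8 * wave_energy TYPE('n) * measure lebesgue (cball z0 r) = exp (- 4) * measure lebesgue (ball z0 (r / 2))"
    by (simp add: wave_energy_def)
  also have "measure lebesgue (ball z0 (r / 2)) = measure (spacetime T) (ball z0 (r / 2))"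
    using sub unfolding spacetime_eq by (subst measure_restrict_space) (auto simp: unit_cell_lebesgue)
  also have "exp (- 4) * \<dots> = (LINT z|spacetime T. exp (- 4) * indicator (ball z0 (r / 2)) z)"
    using sub by (simp add: space_spacetime Int_absorb2 Int_absorb1)
  also have "\<dots> \<le> (LINT z|spacetime T. (bump z0 r z)\<^sup>2)"
  proof (rule integral_mono[OF _ bi])
    have "ball z0 (r / 2) \<in> sets (spacetime T)"
      unfolding spacetime_eq using sub by (subst sets_restrict_space_iff) (auto simp: unit_cell_lebesgue)
    then show "integrable (spacetime T) (\<lambda>z. exp (- 4) * indicat_real (ball z0 (r / 2)) z)"
      using finite_measure.emeasure_finite[OF finite_measure_spacetime, of T "ball z0 (r / 2)"]
      by (intro integrable_mult_right integrable_real_indicator) (auto simp: less_top)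
    show "exp (- 4) * indicator (ball z0 (r / 2)) z \<le> (bump z0 r z)\<^sup>2" for z
    proof (cases "z \<in> ball z0 (r / 2)")
      case True
      have "exp (- 4) = (exp (- 2 :: real))\<^sup>2" by (simp add: power2_eq_square flip: exp_add)
      also have "\<dots> \<le> (bump z0 r z)\<^sup>2" by (intro power_mono bump_inside[OF True assms(1)]) auto
      finally show ?thesis using True by simp
    qed simp
  qed
  finally show ?thesis .
qed

section \<open>A wave supported in a small ball\<close>

context subsolution begin

text \<open>The wave is chosen for the values frozen at \<open>z0\<close>, where a whole segment of
  amplitudes is admissible. This segment is compact and the admissible set is open, so a
  neighbourhood of it is admissible too; the wave stays in that neighbourhood once the ball is small
  and the frequency large.\<close>

lemma ball_perturbation:
  assumes b: "0 < m" "0 < c" "c\<^sup>2 * K' + 2 * c * K \<le> m / 2" "m \<le> \<rho> z0"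
      "norm (V z0 + fst (f z0)) \<le> K" "trace (D z0 (f z0)) \<le> K'"
    and f: "f \<in> Adm" and z0: "z0 \<in> P" "z0 \<in> open_cell"
  shows "\<exists>d>0. \<forall>r. 0 < r \<longrightarrow> r < d \<longrightarrow> (\<exists>w. perturbs f (cball z0 r)
      (wave_energy TYPE('n) * (c * trace (D z0 (f z0)) / real CARD('n))\<^sup>2 * measure lebesgue (cball z0 r)) w)"
proof -
  have zs: "z0 \<in> slab T" using z0 P_slab by blast
  have Ds: "D z0 (f z0) \<in> Sym" by (intro defect_Sym pos(2) zs X0D(3)[OF f])
  have Dp: "0 \<prec> D z0 (f z0)" by (rule X0D(4)[OF f z0(1)])
  obtain \<xi> a :: "real^'n" and \<beta> A where fr: "norm \<xi> = 1" "norm a = 1" "\<xi> \<bullet> a = 0"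
    and A: "c * trace (D z0 (f z0)) / real CARD('n) \<le> A"
    and adm: "\<And>s. \<bar>s\<bar> \<le> A \<Longrightarrow> 0 \<prec> D z0 (f z0) + (s * \<beta>) *\<^sub>R (\<xi> \<otimes> a + a \<otimes> \<xi>) - (1 / \<rho> z0) *\<^sub>R (s *\<^sub>R ((V z0 + fst (f z0)) \<otimes> a + a \<otimes> (V z0 + fst (f z0))) + s\<^sup>2 *\<^sub>R (a \<otimes> a))"
    using admissible_wave[OF dim Ds Dp b(1,4,5,6,2,3)] by metis
  have A0: "A > 0"
  proof -
    have "0 < c * trace (D z0 (f z0)) / real CARD('n)" using b(2) posdef_trace_pos[OF Dp] by simp
    then show ?thesis using A by linarith
  qed
  define e where "e = (a, \<beta> *\<^sub>R (\<xi> \<otimes> a + a \<otimes> \<xi>))"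
  \<comment> \<open>All admissible pairs of a point in \<open>P\<close> and a state.\<close>
  define Op where "Op = (P \<times> UNIV) \<inter> (\<lambda>y. D (fst y) (snd y)) -` {A. 0 \<prec> A}"
  have "continuous_on (P \<times> UNIV) (\<lambda>y. D (fst y) (snd y))"
    by (rule continuous_on_defect) (use cont P_slab pos(1) in \<open>auto intro: continuous_on_subset simp: subset_iff less_le\<close>)
  then have Oo: "open Op"
    unfolding Op_def by (rule continuous_open_preimage[OF _ _ open_posdef]) (auto intro: open_Times open_P)
  define Q where "Q = (\<lambda>s. (z0, f z0 + s *\<^sub>R e)) ` {- A..A}"
  have Qc: "compact Q" unfolding Q_def by (intro compact_continuous_image continuous_intros compact_Icc)
  have QO: "Q \<subseteq> Op"
  proof -
    have "0 \<prec> D z0 (f z0 + s *\<^sub>R e)" if "\<bar>s\<bar> \<le> A" for s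
      using adm[OF that] unfolding e_def defect_add scaleR_scaleR .
    then show ?thesis using z0(1) unfolding Q_def Op_def by fastforce
  qed
  obtain \<epsilon> where \<epsilon>: "\<epsilon> > 0" "(\<Union>y\<in>Q. ball y \<epsilon>) \<subseteq> Op"
    using compact_subset_open_imp_ball_epsilon_subset[OF Qc Oo QO] by blast
  have "isCont f z0" using smooth_continuous[OF X0D(1)[OF f], of UNIV]
    using continuous_on_eq_continuous_at[OF open_UNIV] by blast
  then obtain \<delta>1 where \<delta>1: "\<delta>1 > 0" "\<And>z. dist z z0 < \<delta>1 \<Longrightarrow> dist (f z) (f z0) < \<epsilon> / 4"
    using \<epsilon>(1) unfolding continuous_at_eps_delta by (metis divide_pos_pos zero_less_numeral)
  have "open (P \<inter> open_cell)" using open_P open_open_cell by blast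
  then obtain \<delta>2 where \<delta>2: "\<delta>2 > 0" "ball z0 \<delta>2 \<subseteq> P \<inter> open_cell" using z0 openE by blast
  \<comment> \<open>The budget \<epsilon> is shared by the distance to the centre, the oscillation
    of \<open>f\<close> and the error of the wave, a quarter for each.\<close>
  define d where "d = Min {\<delta>1, \<delta>2, \<epsilon> / 4}"
  have d: "d > 0" "d \<le> \<delta>1" "d \<le> \<delta>2" "d \<le> \<epsilon> / 4" using \<delta>1 \<delta>2 \<epsilon> by (auto simp: d_def)
  show ?thesis
  proof (intro exI[of _ d] conjI allI impI d(1))
    fix r assume r: "0 < r" "r < d"
    define K0 where "K0 = cball z0 r"
    have K0: "compact K0" "K0 \<subseteq> open_cell" "K0 \<subseteq> P"
      using \<delta>2(2) r d by (auto simp: K0_def subset_iff)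
    have K0c: "K0 \<subseteq> unit_cell T"
    proof
      fix z assume "z \<in> K0"
      then have "z \<in> P" "z \<in> open_cell" using K0 by auto
      then show "z \<in> unit_cell T" using P_time[of z] by (cases z) (auto simp: unit_cell_def open_cell_def less_imp_le)
    qed
    \<comment> \<open>The bump takes values in the unit interval, so every value of the wave
      corresponds to an amplitude in the admissible segment.\<close>
    define G where "G z = A * bump z0 r z" for z
    have Gs: "smooth G" unfolding G_def by (intro smooth_cmult smooth_bump)
    have G0: "G z = 0" if "z \<notin> K0" for z using bump_outside[of z z0 r] that r by (simp add: G_def K0_def)
    have GA: "\<bar>G z\<bar> \<le> A" for z
      using bump_nonneg[of z0 r z] bump_le_1[of z0 r z] A0 by (simp add: G_def abs_mult mult_left_le)
    obtain w C where w: "\<And>N. smooth (w N)" "\<And>N. space_periodic_on UNIV (w N)" "\<And>N. solves T (w N)"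
      "\<And>N z. snd (w N z) \<in> Sym0" "\<And>N z. wrap z \<notin> K0 \<Longrightarrow> w N z = 0" and C: "C \<ge> 0"
      "\<And>N z. N \<ge> 1 \<Longrightarrow> norm (w N z - (G (wrap z) * - cos (real N * ((- \<beta>, \<xi>) \<bullet> wrap z))) *\<^sub>R e) \<le> C / real N"
      using periodic_wave[OF Gs G0 K0(1,2) fr T, of \<beta>] unfolding e_def by blast
    define \<nu> where "\<nu> = (- \<beta>, \<xi>)"
    have \<nu>: "\<nu> \<noteq> 0" using fr by (auto simp: \<nu>_def zero_prod_def)
    have C': "norm (w N z - (G z * - cos (real N * (\<nu> \<bullet> z))) *\<^sub>R e) \<le> C / real N" if "N \<ge> 1" "z \<in> unit_cell T" for N z
    proof -
      have "wrap z = z" using that(2) by (cases z) (auto simp: wrap_def unit_cell_def vec_eq_iff frac_eq)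
      then show ?thesis using C(2)[OF that(1), of z] by (simp add: \<nu>_def)
    qed
    have C0: "(\<lambda>N. C / real N) \<longlonglongrightarrow> 0" by (rule lim_const_over_n)
    have sG: "\<bar>G z * - cos x\<bar> \<le> A" for z x
      using mult_mono[OF GA[of z] abs_cos_le_one[of x]] A0 by (simp add: abs_mult)
    have e1: "\<exists>C. \<forall>\<^sub>F N in sequentially. \<forall>z. norm (w N z) \<le> C"
    proof (intro exI eventually_sequentiallyI[of 1] allI)
      fix N :: nat and z assume N: "1 \<le> N"
      let ?s = "G (wrap z) * - cos (real N * ((- \<beta>, \<xi>) \<bullet> wrap z))"
      have "norm (w N z) \<le> norm (w N z - ?s *\<^sub>R e) + norm (?s *\<^sub>R e)" using norm_triangle_ineq[of "w N z - ?s *\<^sub>R e" "?s *\<^sub>R e"] by simp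
      moreover have "norm (w N z - ?s *\<^sub>R e) \<le> C"
        by (rule order_trans[OF C(2)[OF N]]) (use C(1) N in \<open>simp add: divide_le_eq mult_right_le_one_le mult_le_cancel_left1\<close>)
      moreover have "norm (?s *\<^sub>R e) \<le> A * norm e" unfolding norm_scaleR using sG by (intro mult_right_mono) auto
      ultimately show "norm (w N z) \<le> C + A * norm e" by linarith
    qed
    have e2: "\<forall>\<^sub>F N in sequentially. \<forall>z\<in>P. 0 \<prec> D z (f z + w N z)"
    proof -
      have "\<forall>\<^sub>F N in sequentially. C / real N < \<epsilon> / 4" using C0 \<epsilon>(1) by (intro order_tendstoD(2)) auto
      then show ?thesis using eventually_ge_at_top[of 1]
      proof eventually_elim
        case (elim N)
        show ?case
        proof
          fix z assume z: "z \<in> P"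
          define y where "y = wrap z"
          have yP: "y \<in> P" using z P_wrap by (simp add: y_def)
          have fy: "f y = f z" "w N y = w N z" unfolding y_def using periodic_wrap[OF X0D(2)[OF f]] periodic_wrap[OF w(2)] by simp_all
          have "0 \<prec> D y (f y + w N y)"
          proof (cases "y \<in> K0")
            case False
            then have "w N y = 0" using w(5)[of z] fy(2) by (simp add: y_def)
            then show ?thesis using X0D(4)[OF f yP] by simp
          next
            case True
            then have dy: "dist y z0 < d" using r by (simp add: K0_def dist_commute)
            define s where "s = G y * - cos (real N * ((- \<beta>, \<xi>) \<bullet> y))"
            have s: "\<bar>s\<bar> \<le> A" unfolding s_def by (rule sG)
            have wy: "norm (w N y - s *\<^sub>R e) < \<epsilon> / 4"
              using C(2)[OF elim(2), of z] elim(1) fy(2) unfolding s_def y_def by (simp only:)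
            have "dist (z0, f z0 + s *\<^sub>R e) (y, f y + w N y) \<le> dist z0 y + dist (f z0 + s *\<^sub>R e) (f y + w N y)"
              unfolding dist_Pair_Pair by (rule sqrt_sum_squares_le_sum) auto
            also have "dist (f z0 + s *\<^sub>R e) (f y + w N y) = norm ((f z0 - f y) - (w N y - s *\<^sub>R e))"
              unfolding dist_norm by (rule arg_cong[of _ _ norm]) simp
            also have "\<dots> \<le> norm (f z0 - f y) + norm (w N y - s *\<^sub>R e)" by (rule norm_triangle_ineq4)
            also have "norm (f z0 - f y) < \<epsilon> / 4" using \<delta>1(2)[of y] dy d by (simp add: dist_norm norm_minus_commute)
            finally have "dist (z0, f z0 + s *\<^sub>R e) (y, f y + w N y) < \<epsilon>"
              using wy dy d(4) \<epsilon>(1) by (simp add: dist_commute)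
            moreover have "(z0, f z0 + s *\<^sub>R e) \<in> Q" using s by (auto simp: Q_def abs_le_iff)
            ultimately have "(y, f y + w N y) \<in> Op"
              using \<epsilon>(2) mem_ball by blast
            then show ?thesis by (simp add: Op_def)
          qed
          then show "0 \<prec> D z (f z + w N z)"
            using D_wrap[of z] P_time[OF z] fy unfolding y_def by simp
        qed
      qed
    qed
    have wm: "w N \<in> borel_measurable M" for N by (rule smooth_measurable[OF w(1)])
    have sm: "(\<lambda>z. (G z * - cos (real N * (\<nu> \<bullet> z))) *\<^sub>R e) \<in> borel_measurable M" for N
      by (rule measurable_spacetime[of UNIV]) (auto intro!: continuous_intros smooth_continuous[OF Gs])
    have e3: "(\<lambda>N. LINT z|M. w N z \<bullet> \<phi> z) \<longlonglongrightarrow> 0" if "\<phi> \<in> L1_fun T" for \<phi>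
    proof -
      have \<phi>: "integrable M \<phi>" using that by (simp add: L1_fun_def)
      have \<phi>m[measurable]: "\<phi> \<in> borel_measurable M" using \<phi> by auto
      have Ge: "integrable M (\<lambda>z. G z * (e \<bullet> \<phi> z))"
      proof (rule Bochner_Integration.integrable_bound)
        show "integrable M (\<lambda>z. A * norm e * norm (\<phi> z))" using \<phi> by (intro integrable_mult_right integrable_norm)
        show "(\<lambda>z. G z * (e \<bullet> \<phi> z)) \<in> borel_measurable M" using smooth_measurable[OF Gs, of T] by measurable
        have "\<bar>G z\<bar> * \<bar>e \<bullet> \<phi> z\<bar> \<le> A * (norm e * norm (\<phi> z))" for z
          using GA Cauchy_Schwarz_ineq2[of e "\<phi> z"] A0 by (intro mult_mono) auto
        then show "AE z in M. norm (G z * (e \<bullet> \<phi> z)) \<le> norm (A * norm e * norm (\<phi> z))"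
          using A0 by (intro AE_I2) (simp add: abs_mult mult.assoc)
      qed
      \<comment> \<open>The plane wave part is killed by the Riemann-Lebesgue lemma, since
        \<open>G\<close> times a component of the test function is integrable; the error part is at
        most \<open>C / N\<close> times the norm of the test function in L^1.\<close>
      have lim: "(\<lambda>N. \<bar>LINT z|M. G z * (e \<bullet> \<phi> z) * cos (real N * (\<nu> \<bullet> z))\<bar> + C / real N * (LINT z|M. norm (\<phi> z))) \<longlonglongrightarrow> 0"
        using tendsto_add[OF tendsto_rabs[OF Riemann_Lebesgue_spacetime[OF Ge \<nu>]] tendsto_mult_right[OF C0, of "LINT z|M. norm (\<phi> z)"]] by simp
      show ?thesis
      proof (rule Lim_null_comparison[OF _ lim], rule eventually_sequentiallyI[of 1])
        fix N :: nat assume N: "1 \<le> N"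
        define s where "s z = G z * - cos (real N * (\<nu> \<bullet> z))" for z
        have sAm: "\<bar>s z\<bar> \<le> A" for z unfolding s_def by (rule sG)
        have i1: "integrable M (\<lambda>z. s z * (e \<bullet> \<phi> z))"
        proof (rule Bochner_Integration.integrable_bound[OF Ge])
          show "(\<lambda>z. s z * (e \<bullet> \<phi> z)) \<in> borel_measurable M"
            unfolding s_def by (intro borel_measurable_times borel_measurable_inner borel_measurable_const \<phi>m
               measurable_spacetime[of UNIV] continuous_intros smooth_continuous[OF Gs]) auto
          show "AE z in M. norm (s z * (e \<bullet> \<phi> z)) \<le> norm (G z * (e \<bullet> \<phi> z))"
            unfolding s_def by (intro AE_I2) (simp add: abs_mult mult_right_mono mult_left_le)
        qed
        have i2: "integrable M (\<lambda>z. (w N z - s z *\<^sub>R e) \<bullet> \<phi> z)"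
        proof (rule Bochner_Integration.integrable_bound)
          show "integrable M (\<lambda>z. C / real N * norm (\<phi> z))" using \<phi> by (intro integrable_mult_right integrable_norm)
          show "(\<lambda>z. (w N z - s z *\<^sub>R e) \<bullet> \<phi> z) \<in> borel_measurable M"
            unfolding s_def by (intro borel_measurable_inner borel_measurable_diff wm sm \<phi>m)
          show "AE z in M. norm ((w N z - s z *\<^sub>R e) \<bullet> \<phi> z) \<le> norm (C / real N * norm (\<phi> z))"
          proof (intro AE_I2)
            fix z assume "z \<in> space M"
            then have "norm (w N z - s z *\<^sub>R e) \<le> C / real N" unfolding s_def by (intro C'[OF N]) (simp add: space_spacetime)
            then have "norm (w N z - s z *\<^sub>R e) * norm (\<phi> z) \<le> C / real N * norm (\<phi> z)" by (intro mult_right_mono) auto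
            then show "norm ((w N z - s z *\<^sub>R e) \<bullet> \<phi> z) \<le> norm (C / real N * norm (\<phi> z))"
              using Cauchy_Schwarz_ineq2[of "w N z - s z *\<^sub>R e" "\<phi> z"] C(1) by simp
          qed
        qed
        have "(LINT z|M. w N z \<bullet> \<phi> z) = (LINT z|M. s z * (e \<bullet> \<phi> z) + (w N z - s z *\<^sub>R e) \<bullet> \<phi> z)"
          by (simp add: inner_diff_left)
        also have "\<dots> = (LINT z|M. s z * (e \<bullet> \<phi> z)) + (LINT z|M. (w N z - s z *\<^sub>R e) \<bullet> \<phi> z)"
          by (rule Bochner_Integration.integral_add[OF i1 i2])
        also have "(LINT z|M. s z * (e \<bullet> \<phi> z)) = - (LINT z|M. G z * (e \<bullet> \<phi> z) * cos (real N * (\<nu> \<bullet> z)))"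
          unfolding s_def by (subst Bochner_Integration.integral_minus[symmetric]) (simp add: mult_ac)
        finally have eq: "(LINT z|M. w N z \<bullet> \<phi> z) = - (LINT z|M. G z * (e \<bullet> \<phi> z) * cos (real N * (\<nu> \<bullet> z)))
            + (LINT z|M. (w N z - s z *\<^sub>R e) \<bullet> \<phi> z)" .
        have "norm (LINT z|M. (w N z - s z *\<^sub>R e) \<bullet> \<phi> z) \<le> (LINT z|M. C / real N * norm (\<phi> z))"
        proof (rule Bochner_Integration.integral_norm_bound_integral[OF i2])
          show "integrable M (\<lambda>z. C / real N * norm (\<phi> z))" using \<phi> by (intro integrable_mult_right integrable_norm)
          fix z assume "z \<in> space M"
          then have "norm (w N z - s z *\<^sub>R e) \<le> C / real N" unfolding s_def by (intro C'[OF N]) (simp add: space_spacetime)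
          then have "norm (w N z - s z *\<^sub>R e) * norm (\<phi> z) \<le> C / real N * norm (\<phi> z)" by (intro mult_right_mono) auto
          then show "norm ((w N z - s z *\<^sub>R e) \<bullet> \<phi> z) \<le> C / real N * norm (\<phi> z)"
            using Cauchy_Schwarz_ineq2[of "w N z - s z *\<^sub>R e" "\<phi> z"] by simp
        qed
        then show "norm (LINT z|M. w N z \<bullet> \<phi> z) \<le> \<bar>LINT z|M. G z * (e \<bullet> \<phi> z) * cos (real N * (\<nu> \<bullet> z))\<bar> + C / real N * (LINT z|M. norm (\<phi> z))"
          unfolding eq by simp
      qed
    qed
    define I where "I = (LINT z|M. (G z)\<^sup>2)"
    have Gi: "integrable M (\<lambda>z. (G z)\<^sup>2)"
      by (intro integrable_spacetime_continuous continuous_intros smooth_continuous[OF Gs])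
    define E where "E = wave_energy TYPE('n) * (c * trace (D z0 (f z0)) / real CARD('n))\<^sup>2 * measure lebesgue (cball z0 r)"
    have mpos: "measure lebesgue (cball z0 r) > 0" using r by (simp add: content_cball measure_completion)
    have EI: "8 * E \<le> I"
    proof -
      have "(c * trace (D z0 (f z0)) / real CARD('n))\<^sup>2 \<le> A\<^sup>2"
        using A b(2) posdef_trace_pos[OF Dp] by (intro power_mono) auto
      then have "8 * E \<le> A\<^sup>2 * (8 * wave_energy TYPE('n) * measure lebesgue (cball z0 r))"
        using wave_energy_pos[where 'n='n] mpos by (simp add: E_def mult_ac mult_left_mono)
      also have "\<dots> \<le> A\<^sup>2 * (LINT z|M. (bump z0 r z)\<^sup>2)"
        by (intro mult_left_mono bump_energy) (use r K0c in \<open>auto simp: K0_def\<close>)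
      also have "\<dots> = I" by (simp add: I_def G_def power_mult_distrib)
      finally show ?thesis .
    qed
    have E0: "E > 0" using wave_energy_pos[where 'n='n] mpos b(2) posdef_trace_pos[OF Dp] by (simp add: E_def)
    have e4: "\<forall>\<^sub>F N in sequentially. E \<le> (LINT z|M. (norm (fst (w N z)))\<^sup>2)"
    proof -
      have \<nu>2: "2 *\<^sub>R \<nu> \<noteq> 0" using \<nu> by simp
      \<comment> \<open>The squared velocity is at least half the squared plane wave minus the
        squared error, and the squared cosine averages to one half: together the limit
        \<open>I / 4\<close>. By \<open>EI\<close> this is at least \<open>2 * E\<close>, hence
        strictly above \<open>E\<close>.\<close>
      have "(\<lambda>N. I / 4 + (LINT z|M. (G z)\<^sup>2 * cos (real N * ((2 *\<^sub>R \<nu>) \<bullet> z))) / 4 - (C / real N)\<^sup>2 * measure M (space M))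
         \<longlonglongrightarrow> I / 4 + 0 / 4 - 0\<^sup>2 * measure M (space M)"
        by (intro tendsto_intros Riemann_Lebesgue_spacetime Gi \<nu>2 C0) simp_all
      moreover have "E < I / 4 + 0 / 4 - 0\<^sup>2 * measure M (space M)" using EI E0 by simp
      ultimately have "\<forall>\<^sub>F N in sequentially. E < I / 4 + (LINT z|M. (G z)\<^sup>2 * cos (real N * ((2 *\<^sub>R \<nu>) \<bullet> z))) / 4 - (C / real N)\<^sup>2 * measure M (space M)"
        by (rule order_tendstoD(1))
      then show ?thesis using eventually_ge_at_top[of 1]
      proof eventually_elim
        case (elim N)
        have gc: "integrable M (\<lambda>z. (G z)\<^sup>2 * cos (real N * ((2 *\<^sub>R \<nu>) \<bullet> z)))"
          by (intro integrable_spacetime_continuous continuous_intros smooth_continuous[OF Gs])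
        have cst: "integrable M (\<lambda>z. (C / real N)\<^sup>2)"
          using finite_measure.integrable_const[OF finite_measure_spacetime] .
        have "I / 4 + (LINT z|M. (G z)\<^sup>2 * cos (real N * ((2 *\<^sub>R \<nu>) \<bullet> z))) / 4 - (C / real N)\<^sup>2 * measure M (space M)
          = (LINT z|M. (G z)\<^sup>2 / 4 + (G z)\<^sup>2 * cos (real N * ((2 *\<^sub>R \<nu>) \<bullet> z)) / 4 - (C / real N)\<^sup>2)"
          using Gi gc cst by (simp add: I_def)
        also have "\<dots> \<le> (LINT z|M. (norm (fst (w N z)))\<^sup>2)"
        proof (rule integral_mono)
          show "integrable M (\<lambda>z. (norm (fst (w N z)))\<^sup>2)"
            by (intro integrable_spacetime_continuous continuous_intros smooth_continuous[OF smooth_fst[OF w(1)]])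
          show "integrable M (\<lambda>z. (G z)\<^sup>2 / 4 + (G z)\<^sup>2 * cos (real N * ((2 *\<^sub>R \<nu>) \<bullet> z)) / 4 - (C / real N)\<^sup>2)"
            using Gi gc cst by simp
          fix z assume "z \<in> space M"
          then have z: "z \<in> unit_cell T" by (simp add: space_spacetime)
          define s where "s = G z * - cos (real N * (\<nu> \<bullet> z))"
          have "norm (fst (w N z - s *\<^sub>R e)) \<le> C / real N"
            using norm_fst_le[of "fst (w N z - s *\<^sub>R e)" "snd (w N z - s *\<^sub>R e)"] C'[OF elim(2) z]
            unfolding prod.collapse s_def by (rule order_trans)
          moreover have "fst e = a" by (simp add: e_def)
          moreover have "norm (s *\<^sub>R a) \<le> norm (fst (w N z)) + norm (fst (w N z) - s *\<^sub>R a)"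
            using norm_triangle_ineq4[of "fst (w N z)" "fst (w N z) - s *\<^sub>R a"] by simp
          ultimately have "\<bar>s\<bar> \<le> norm (fst (w N z)) + C / real N" using fr(2) by (simp add: fst_diff)
          then have "s\<^sup>2 \<le> (norm (fst (w N z)) + C / real N)\<^sup>2" by (rule abs_le_square_iff[THEN iffD1, OF order_trans[OF _ abs_ge_self]])
          also have "\<dots> \<le> 2 * (norm (fst (w N z)))\<^sup>2 + 2 * (C / real N)\<^sup>2"
            using sum_squares_bound[of "norm (fst (w N z))" "C / real N"] by (simp add: power2_sum)
          finally have "s\<^sup>2 / 2 - (C / real N)\<^sup>2 \<le> (norm (fst (w N z)))\<^sup>2" by simp
          moreover have "s\<^sup>2 = (G z)\<^sup>2 / 2 + (G z)\<^sup>2 * cos (real N * ((2 *\<^sub>R \<nu>) \<bullet> z)) / 2"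
          proof -
            have "cos (real N * ((2 *\<^sub>R \<nu>) \<bullet> z)) = 2 * (cos (real N * (\<nu> \<bullet> z)))\<^sup>2 - 1"
              using cos_double_cos[of "real N * (\<nu> \<bullet> z)"] by (simp add: mult.left_commute)
            then show ?thesis unfolding s_def power_mult_distrib by (simp only:) (simp add: field_simps)
          qed
          ultimately show "(G z)\<^sup>2 / 4 + (G z)\<^sup>2 * cos (real N * ((2 *\<^sub>R \<nu>) \<bullet> z)) / 4 - (C / real N)\<^sup>2 \<le> (norm (fst (w N z)))\<^sup>2"
            by linarith
        qed
        finally show ?case using elim(1) by linarith
      qed
    qed
    have "perturbs f K0 E w"
      unfolding perturbs_def using w e1 e2 e3 e4 by blast
    then show "\<exists>w. perturbs f (cball z0 r) (wave_energy TYPE('n) * (c * trace (D z0 (f z0)) / real CARD('n))\<^sup>2 * measure lebesgue (cball z0 r)) w"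
      unfolding E_def K0_def by blast
  qed
qed

end

lemma Sym0_zero: "0 \<in> Sym0" and Sym0_add: "A \<in> Sym0 \<Longrightarrow> B \<in> Sym0 \<Longrightarrow> A + B \<in> Sym0"
  by (auto simp: Sym0_def Sym_def transpose_def trace_def vec_eq_iff sum.distrib)

section \<open>Superposition of perturbations with disjoint supports\<close>

context subsolution begin

lemma perturbsD:
  assumes "perturbs f B E w"
  shows "smooth (w N)" "space_periodic_on UNIV (w N)" "solves T (w N)" "snd (w N z) \<in> Sym0"
    "wrap z \<notin> B \<Longrightarrow> w N z = 0" "\<exists>C. \<forall>\<^sub>F N in sequentially. \<forall>z. norm (w N z) \<le> C"
    "\<forall>\<^sub>F N in sequentially. \<forall>z\<in>P. 0 \<prec> D z (f z + w N z)"
    "\<phi> \<in> L1_fun T \<Longrightarrow> (\<lambda>N. LINT z|M. w N z \<bullet> \<phi> z) \<longlonglongrightarrow> 0"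
    "\<forall>\<^sub>F N in sequentially. E \<le> (LINT z|M. (norm (fst (w N z)))\<^sup>2)"
  using assms unfolding perturbs_def by blast+

lemma integrable_smooth_inner_L1:
  assumes "smooth g" "\<phi> \<in> L1_fun T"
  shows "integrable M (\<lambda>z. g z \<bullet> \<phi> z)"
proof -
  have \<phi>: "integrable M \<phi>" using assms(2) by (simp add: L1_fun_def)
  then have \<phi>m[measurable]: "\<phi> \<in> borel_measurable M" by auto
  have gm[measurable]: "g \<in> borel_measurable M" by (rule smooth_measurable[OF assms(1)])
  obtain C where C: "C \<ge> 0" "\<And>z. z \<in> closed_unit_cell T \<Longrightarrow> norm (g z) \<le> C"
    using continuous_slab_bounded[OF smooth_continuous[OF assms(1)]] by blast
  show ?thesis
  proof (rule Bochner_Integration.integrable_bound)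
    show "integrable M (\<lambda>z. C * norm (\<phi> z))" using \<phi> by (intro integrable_mult_right integrable_norm)
    show "(\<lambda>z. g z \<bullet> \<phi> z) \<in> borel_measurable M" by measurable
    show "AE z in M. norm (g z \<bullet> \<phi> z) \<le> norm (C * norm (\<phi> z))"
    proof (intro AE_I2)
      fix z assume "z \<in> space M"
      then have "z \<in> closed_unit_cell T" unfolding space_spacetime using unit_cell_subset(1) by blast
      then have "norm (g z) \<le> C" by (rule C(2))
      then have "norm (g z) * norm (\<phi> z) \<le> C * norm (\<phi> z)" by (intro mult_right_mono) auto
      then show "norm (g z \<bullet> \<phi> z) \<le> norm (C * norm (\<phi> z))"
        using Cauchy_Schwarz_ineq2[of "g z" "\<phi> z"] C(1) by simp
    qed
  qed
qed

lemma perturbs_empty: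
  assumes "f \<in> Adm"
  shows "perturbs f {} 0 (\<lambda>N z. 0)"
proof -
  have "solves T (\<lambda>z. 0 :: 'n state)"
    unfolding solves_iff_ddir[OF smooth_const T] by (simp add: ddir_const)
  then show ?thesis
    unfolding perturbs_def using X0D(4)[OF assms]
    by (auto simp: smooth_const space_periodic_on_def Sym0_zero)
qed

text \<open>At every point at most one of the two summands is nonzero. The nonlinear requirement on
  the defect therefore reduces to a single summand, and the energies add without cross
  terms.\<close>

lemma perturbs_Un:
  assumes 1: "perturbs f B1 E1 w1" and 2: "perturbs f B2 E2 w2" and dj: "B1 \<inter> B2 = {}"
  shows "perturbs f (B1 \<union> B2) (E1 + E2) (\<lambda>N z. w1 N z + w2 N z)"
proof -
  note p1 = perturbsD[OF 1] and p2 = perturbsD[OF 2]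
  have or: "w1 N z = 0 \<or> w2 N z = 0" for N z using p1(5) p2(5) dj by blast
  have a: "smooth (\<lambda>z. w1 N z + w2 N z) \<and> space_periodic_on UNIV (\<lambda>z. w1 N z + w2 N z) \<and> solves T (\<lambda>z. w1 N z + w2 N z)" for N
    using smooth_add[OF p1(1) p2(1)] solves_add[OF p1(1) p2(1) p1(3) p2(3) T] p1(2)[of N] p2(2)[of N]
    by (simp add: space_periodic_on_def)
  have b: "snd (w1 N z + w2 N z) \<in> Sym0 \<and> (wrap z \<notin> B1 \<union> B2 \<longrightarrow> w1 N z + w2 N z = 0)" for N z
    using p1(4,5)[where N=N and z=z] p2(4,5)[where N=N and z=z] by (auto intro: Sym0_add)
  have c: "\<exists>C. \<forall>\<^sub>F N in sequentially. \<forall>z. norm (w1 N z + w2 N z) \<le> C"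
  proof -
    obtain C1 where C1: "\<forall>\<^sub>F N in sequentially. \<forall>z. norm (w1 N z) \<le> C1" using p1(6) by blast
    obtain C2 where C2: "\<forall>\<^sub>F N in sequentially. \<forall>z. norm (w2 N z) \<le> C2" using p2(6) by blast
    have "\<forall>\<^sub>F N in sequentially. \<forall>z. norm (w1 N z + w2 N z) \<le> C1 + C2"
      using C1 C2 by eventually_elim (auto intro: norm_triangle_mono)
    then show ?thesis by blast
  qed
  have d: "\<forall>\<^sub>F N in sequentially. \<forall>z\<in>P. 0 \<prec> D z (f z + (w1 N z + w2 N z))"
    using p1(7) p2(7)
  proof eventually_elim
    case (elim N)
    show ?case
    proof
      fix z assume "z \<in> P"
      then show "0 \<prec> D z (f z + (w1 N z + w2 N z))" using elim or[of N z] by auto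
    qed
  qed
  have e: "(\<lambda>N. LINT z|M. (w1 N z + w2 N z) \<bullet> \<phi> z) \<longlonglongrightarrow> 0" if "\<phi> \<in> L1_fun T" for \<phi>
    using tendsto_add[OF p1(8)[OF that] p2(8)[OF that]]
    by (simp add: inner_add_left integrable_smooth_inner_L1[OF p1(1) that] integrable_smooth_inner_L1[OF p2(1) that])
  have i: "integrable M (\<lambda>z. (norm (fst (g z)))\<^sup>2)" if "smooth g" for g :: "'n point \<Rightarrow> 'n state"
    by (intro integrable_spacetime_continuous continuous_intros smooth_continuous[OF smooth_fst[OF that]])
  have s: "(norm (fst (w1 N z + w2 N z)))\<^sup>2 = (norm (fst (w1 N z)))\<^sup>2 + (norm (fst (w2 N z)))\<^sup>2" for N z
    using or[of N z] by auto
  have g: "\<forall>\<^sub>F N in sequentially. E1 + E2 \<le> (LINT z|M. (norm (fst (w1 N z + w2 N z)))\<^sup>2)"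
    using p1(9) p2(9)
    by eventually_elim (simp add: s Bochner_Integration.integral_add[OF i[OF p1(1)] i[OF p2(1)]] del: fst_add)
  show ?thesis unfolding perturbs_def using a b c d e g by blast
qed

lemma perturbs_UN:
  assumes "finite I" "disjoint_family_on B I" "\<And>i. i \<in> I \<Longrightarrow> \<exists>w. perturbs f (B i) (E i) w" "f \<in> Adm"
  shows "\<exists>w. perturbs f (\<Union>i\<in>I. B i) (\<Sum>i\<in>I. E i) w"
  using assms(1-3)
proof (induction I)
  case empty
  then show ?case using perturbs_empty[OF assms(4)] by auto
next
  case (insert i I)
  then obtain w1 where w1: "perturbs f (\<Union>i\<in>I. B i) (\<Sum>i\<in>I. E i) w1"
    by (auto simp: disjoint_family_on_def)
  obtain w2 where w2: "perturbs f (B i) (E i) w2" using insert.prems by blast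
  have "B i \<inter> (\<Union>i\<in>I. B i) = {}" using insert by (auto simp: disjoint_family_on_def)
  from perturbs_Un[OF w2 w1 this] show ?case using insert by auto
qed

text \<open>Squared because the admissible amplitude is proportional to the trace, so this integral
  is comparable to the energy that waves can add.\<close>

definition gap :: "('n point \<Rightarrow> 'n state) \<Rightarrow> real" where
  "gap f = (LINT z|M. indicator P z * (trace (D z (f z)))\<^sup>2)"

section \<open>Filling the domain with balls\<close>

lemma interior_cell: "z \<in> P \<Longrightarrow> z \<in> open_cell \<Longrightarrow> z \<in> unit_cell T"
  using P_time[of z] by (cases z) (auto simp: unit_cell_def open_cell_def less_imp_le)

text \<open>The half-open cell differs from the open one by faces in hyperplanes, which are null
  sets; waves can be placed only away from these faces.\<close>

lemma AE_open_cell: "AE z in M. z \<in> open_cell"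
proof -
  have "negligible {z::'n point. (0, axis i 1) \<bullet> z = 0}" for i
    by (rule negligible_hyperplane) (simp add: zero_prod_def axis_eq_0_iff)
  then have "negligible (\<Union>i\<in>UNIV. {z::'n point. (0, axis i 1) \<bullet> z = 0})"
    by (intro negligible_Union) auto
  then have "AE z in lebesgue. z \<notin> (\<Union>i\<in>UNIV. {z::'n point. (0, axis i 1) \<bullet> z = 0})"
    unfolding negligible_iff_null_sets by (rule AE_not_in)
  then have "AE z in lebesgue. z \<in> unit_cell T \<longrightarrow> z \<in> (open_cell :: 'n point set)"
  proof eventually_elim
    case (elim z)
    then have "snd z $ i \<noteq> 0" for i by (cases z) (simp add: inner_axis')
    then show ?case by (auto simp: unit_cell_def open_cell_def less_le)
  qed
  then show ?thesis unfolding spacetime_eq by (subst AE_restrict_space_iff) (auto simp: unit_cell_lebesgue)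
qed

lemma trace_D_continuous: "smooth f \<Longrightarrow> continuous_on (slab T) (\<lambda>z. trace (D z (f z)))"
  unfolding defect_def
  by (intro continuous_on_trace continuous_intros continuous_on_tensor cont
      smooth_continuous[OF smooth_fst] smooth_continuous[OF smooth_snd]) (use pos(1) in \<open>auto simp: less_le\<close>)

lemma P_sets [measurable]: "P \<in> sets lebesgue"
  using open_P by (simp add: lebesgue_openin borel_open)

lemma indicator_P_measurable: "indicat_real P \<in> borel_measurable M"
  unfolding spacetime_eq by (intro measurable_restrict_space1 borel_measurable_indicator P_sets)

text \<open>Disjoint balls exhaust \<open>P\<close> within the cell up to a null set, finitely many
  of them up to small measure. On each ball the trace is at most twice its value at the centre, so
  the energy of the waves on the balls controls the gap there.\<close>

lemma perturbation_on_balls: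
  assumes b: "0 < m" "0 < c" "c\<^sup>2 * K' + 2 * c * K \<le> m / 2"
      "\<And>z. z \<in> closed_unit_cell T \<Longrightarrow> m \<le> \<rho> z"
      "\<And>z. z \<in> P \<Longrightarrow> norm (V z + fst (f z)) \<le> K \<and> trace (D z (f z)) \<le> K'"
    and f: "f \<in> Adm" and J: "gap f > 0"
  shows "\<exists>B E w. compact B \<and> B \<subseteq> P \<inter> open_cell \<and> perturbs f B E w \<and>
     wave_energy TYPE('n) * (c / real CARD('n))\<^sup>2 / 8 * gap f \<le> E"
proof -
  define q where "q z = trace (D z (f z))" for z
  have qp: "q z > 0" if "z \<in> P" for z unfolding q_def by (rule posdef_trace_pos[OF X0D(4)[OF f that]])
  have qK: "q z \<le> K'" if "z \<in> P" for z using b(5)[OF that] by (simp add: q_def)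
  define k where "k = wave_energy TYPE('n) * (c / real CARD('n))\<^sup>2"
  have k: "k > 0" using wave_energy_pos[where 'n='n] b(2) by (simp add: k_def)
  define S where "S = P \<inter> (open_cell :: 'n point set)"
  have So: "open S" unfolding S_def using open_P open_open_cell by blast
  have Sc: "S \<subseteq> unit_cell T" unfolding S_def using interior_cell by blast
  \<comment> \<open>Pairs of a centre and a radius. The doubling condition compares the trace on the
    ball with the amplitude, which is set at the centre.\<close>
  define Kk where "Kk = {i. 0 < snd i \<and> fst i \<in> S \<and> cball (fst i) (snd i) \<subseteq> S \<and> (\<forall>z\<in>cball (fst i) (snd i). q z \<le> 2 * q (fst i))
     \<and> (\<exists>w. perturbs f (cball (fst i) (snd i)) (k * (q (fst i))\<^sup>2 * measure lebesgue (cball (fst i) (snd i))) w)}"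
  have ex: "\<exists>i. i \<in> Kk \<and> x \<in> cball (fst i) (snd i) \<and> snd i < d" if x: "x \<in> S" and d: "0 < d" for x d
  proof -
    have xP: "x \<in> P" "x \<in> open_cell" using x by (auto simp: S_def)
    have xc: "x \<in> closed_unit_cell T" using x Sc unit_cell_subset by blast
    obtain d1 where d1: "d1 > 0" "\<And>r. 0 < r \<Longrightarrow> r < d1 \<Longrightarrow> \<exists>w. perturbs f (cball x r) (k * (q x)\<^sup>2 * measure lebesgue (cball x r)) w"
      using ball_perturbation[OF b(1,2,3) b(4)[OF xc] conjunct1[OF b(5)[OF xP(1)]] conjunct2[OF b(5)[OF xP(1)]] f xP]
      unfolding q_def[symmetric] k_def by (auto simp: power_mult_distrib power_divide mult_ac)
    obtain d2 where d2: "d2 > 0" "ball x d2 \<subseteq> S" using So x openE by blast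
    have "continuous_on S q"
      using trace_D_continuous[OF X0D(1)[OF f]] Sc unit_cell_subset unfolding q_def by (meson continuous_on_subset)
    then have "isCont q x" using So x continuous_on_eq_continuous_at by blast
    then obtain d3 where d3: "d3 > 0" "\<And>z. dist z x < d3 \<Longrightarrow> dist (q z) (q x) < q x"
      using qp[OF xP(1)] unfolding continuous_at_eps_delta by blast
    \<comment> \<open>Half of the minimum, since all four inequalities must be strict.\<close>
    define r where "r = Min {d, d1, d2, d3} / 2"
    have "Min {d, d1, d2, d3} > 0" using d d1 d2 d3 by auto
    moreover have "Min {d, d1, d2, d3} \<le> d" "Min {d, d1, d2, d3} \<le> d1" "Min {d, d1, d2, d3} \<le> d2" "Min {d, d1, d2, d3} \<le> d3" by auto
    ultimately have r: "r > 0" "r < d" "r < d1" "r < d2" "r < d3" unfolding r_def by linarith+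
    have "q z \<le> 2 * q x" if "z \<in> cball x r" for z
      using d3(2)[of z] that r by (auto simp: dist_commute dist_real_def)
    moreover have "cball x r \<subseteq> S" using d2 r by auto
    ultimately show ?thesis
      using d1(2)[OF r(1,3)] x r by (intro exI[of _ "(x, r)"]) (auto simp: Kk_def)
  qed
  have "\<And>i. i \<in> Kk \<Longrightarrow> 0 < snd i" by (auto simp: Kk_def)
  then obtain C where C: "countable C" "C \<subseteq> Kk"
     "pairwise (\<lambda>i j. disjnt (cball (fst i) (snd i)) (cball (fst j) (snd j))) C"
     "negligible (S - (\<Union>i\<in>C. cball (fst i) (snd i)))"
    using Vitali_covering_theorem_cballs[of Kk snd S fst] ex by blast
  define B where "B i = cball (fst i) (snd i)" for i :: "'n point \<times> real"
  have BS: "B i \<subseteq> S" if "i \<in> C" for i using C(2) that unfolding Kk_def B_def by blast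
  have Bl: "B i \<in> lmeasurable" for i unfolding B_def by simp
  have Sl: "S \<in> lmeasurable"
  proof (rule fmeasurableI2[OF _ Sc])
    show "unit_cell T \<in> fmeasurable lebesgue"
      by (rule fmeasurableI2[OF lmeasurable_compact[OF compact_closed_unit_cell] unit_cell_subset(1) unit_cell_lebesgue])
    show "S \<in> sets lebesgue" using So by (simp add: borel_open)
  qed
  \<comment> \<open>The squared trace is at most \<open>K'\<^sup>2\<close>, so the uncovered
    remainder of measure below \<epsilon> carries at most half of the gap.\<close>
  define \<epsilon> where "\<epsilon> = gap f / (2 * (K'\<^sup>2 + 1))"
  have K'1: "K'\<^sup>2 + 1 > 0" by (simp add: add_nonneg_pos)
  have \<epsilon>: "\<epsilon> > 0" "K'\<^sup>2 * \<epsilon> \<le> gap f / 2"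
    using J K'1 by (auto simp: \<epsilon>_def field_simps)
  have "\<exists>F. finite F \<and> F \<subseteq> C \<and> measure lebesgue (S - (\<Union>i\<in>F. B i)) < \<epsilon>"
  proof -
    \<comment> \<open>Only finitely many perturbations can be superposed, because each becomes
      admissible from its own frequency on.\<close>
    obtain D' where D': "D' \<subseteq> B ` C" "finite D'" "measure lebesgue (\<Union>(B ` C)) - \<epsilon> < measure lebesgue (\<Union>D')"
    proof (rule measure_countable_Union_approachable[of "B ` C" \<epsilon> "measure lebesgue S"])
      show "countable (B ` C)" using C(1) by simp
      show "d \<in> lmeasurable" if "d \<in> B ` C" for d using that Bl by auto
      show "measure lebesgue (\<Union>D') \<le> measure lebesgue S" if "D' \<subseteq> B ` C" "finite D'" for D'
      proof (rule measure_mono_fmeasurable[OF _ _ Sl])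
        show "\<Union>D' \<subseteq> S" using that(1) BS by blast
        have "d \<in> sets lebesgue" if "d \<in> D'" for d
          using that \<open>D' \<subseteq> B ` C\<close> Bl by (auto simp: fmeasurableD)
        then show "\<Union>D' \<in> sets lebesgue" using that(2) by (intro sets.finite_Union) auto
      qed
    qed (use \<epsilon>(1) in auto)
    obtain F where F: "finite F" "F \<subseteq> C" "D' = B ` F" using finite_subset_image[OF D'(2,1)] by blast
    have UC: "\<Union>(B ` C) \<in> sets lebesgue" using C(1) Bl by (intro sets.countable_UN'') (auto simp: fmeasurableD)
    have UF: "\<Union>(B ` F) \<in> sets lebesgue" using F(1) Bl by (intro sets.finite_UN) (auto simp: fmeasurableD)
    have "measure lebesgue S \<le> measure lebesgue (\<Union>(B ` C)) + measure lebesgue (S - \<Union>(B ` C))"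
    proof -
      have "measure lebesgue S = measure lebesgue (\<Union>(B ` C) \<union> (S - \<Union>(B ` C)))"
        using BS by (intro arg_cong[of _ _ "measure lebesgue"]) auto
      also have "\<dots> \<le> measure lebesgue (\<Union>(B ` C)) + measure lebesgue (S - \<Union>(B ` C))"
      proof (rule measure_Un_le)
        show "S - \<Union>(B ` C) \<in> sets lebesgue" using UC Sl by (auto simp: fmeasurableD)
      qed (rule UC)
      finally show ?thesis .
    qed
    moreover have "measure lebesgue (S - \<Union>(B ` C)) = 0"
      using C(4) by (simp add: B_def negligible_imp_measure0)
    moreover have "measure lebesgue (S - \<Union>(B ` F)) = measure lebesgue S - measure lebesgue (\<Union>(B ` F))"
      by (rule measurable_measure_Diff[OF Sl UF]) (use BS F in blast)
    ultimately have "measure lebesgue (S - (\<Union>i\<in>F. B i)) < \<epsilon>" using D'(3) F(3) by simp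
    then show ?thesis using F by blast
  qed
  then obtain F where F: "finite F" "F \<subseteq> C" "measure lebesgue (S - (\<Union>i\<in>F. B i)) < \<epsilon>" by blast
  define E where "E i = k * (q (fst i))\<^sup>2 * measure lebesgue (B i)" for i
  have "disjoint_family_on B F"
    using C(3) F(2) unfolding disjoint_family_on_def pairwise_def disjnt_def B_def by (meson subsetD)
  moreover have "\<exists>w. perturbs f (B i) (E i) w" if "i \<in> F" for i
    using that F(2) C(2) unfolding Kk_def B_def E_def by blast
  ultimately obtain w where w: "perturbs f (\<Union>i\<in>F. B i) (\<Sum>i\<in>F. E i) w"
    using perturbs_UN[OF F(1) _ _ f] by blast
  have mM: "measure M A = measure lebesgue A" "A \<in> sets M" if "A \<subseteq> S" "A \<in> sets lebesgue" for A
    using that Sc unfolding spacetime_eq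
    by (auto simp: measure_restrict_space sets_restrict_space_iff unit_cell_lebesgue)
  have iM: "integrable M (\<lambda>z. c * indicat_real A z)" "(LINT z|M. c * indicat_real A z) = c * measure lebesgue A"
    if "A \<subseteq> S" "A \<in> sets lebesgue" for A c
  proof -
    have "integrable M (indicat_real A)"
      using mM(2)[OF that] finite_measure.emeasure_finite[OF finite_measure_spacetime, of T A]
      by (intro integrable_real_indicator) (auto simp: less_top)
    then show "integrable M (\<lambda>z. c * indicat_real A z)" by (rule integrable_mult_right)
    show "(LINT z|M. c * indicat_real A z) = c * measure lebesgue A"
      using mM[OF that] Sc that by (simp add: Int_absorb2 space_spacetime subset_trans)
  qed
  define Rr where "Rr = S - (\<Union>i\<in>F. B i)"
  have Rs: "Rr \<subseteq> S" "Rr \<in> sets lebesgue"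
    unfolding Rr_def by (auto intro: sets.Diff[OF fmeasurableD[OF Sl] sets.finite_UN[OF F(1) fmeasurableD[OF Bl]]])
  have Bs: "B i \<subseteq> S" "B i \<in> sets lebesgue" if "i \<in> F" for i
    using BS[of i] that F(2) fmeasurableD[OF Bl] by blast+
  have "gap f \<le> (LINT z|M. (\<Sum>i\<in>F. 4 * (q (fst i))\<^sup>2 * indicat_real (B i) z) + K'\<^sup>2 * indicat_real Rr z)"
    unfolding gap_def q_def[symmetric]
  proof (rule integral_mono_AE)
    show "integrable M (\<lambda>z. indicat_real P z * (q z)\<^sup>2)"
    proof (rule Bochner_Integration.integrable_bound)
      show "integrable M (\<lambda>z. (q z)\<^sup>2)"
        unfolding q_def by (intro integrable_spacetime_continuous continuous_intros trace_D_continuous X0D(1)[OF f])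
      then have [measurable]: "(\<lambda>z. (q z)\<^sup>2) \<in> borel_measurable M" by auto
      show "(\<lambda>z. indicat_real P z * (q z)\<^sup>2) \<in> borel_measurable M" using indicator_P_measurable by measurable
    qed (auto simp: indicator_def)
    show "integrable M (\<lambda>z. (\<Sum>i\<in>F. 4 * (q (fst i))\<^sup>2 * indicat_real (B i) z) + K'\<^sup>2 * indicat_real Rr z)"
      by (intro Bochner_Integration.integrable_add Bochner_Integration.integrable_sum iM Rs Bs)
    show "AE z in M. indicat_real P z * (q z)\<^sup>2 \<le> (\<Sum>i\<in>F. 4 * (q (fst i))\<^sup>2 * indicat_real (B i) z) + K'\<^sup>2 * indicat_real Rr z"
      using AE_open_cell
    proof eventually_elim
      case (elim z)
      have nn: "0 \<le> (\<Sum>i\<in>F. 4 * (q (fst i))\<^sup>2 * indicat_real (B i) z)" by (intro sum_nonneg) auto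
      show ?case
      proof (cases "z \<in> P")
        case True
        then have zS: "z \<in> S" using elim by (simp add: S_def)
        show ?thesis
        proof (cases "z \<in> Rr")
          case False
          then obtain i where i: "i \<in> F" "z \<in> B i" using zS by (auto simp: Rr_def)
          then have "q z \<le> 2 * q (fst i)" using F(2) C(2) unfolding Kk_def B_def by blast
          then have "(q z)\<^sup>2 \<le> (2 * q (fst i))\<^sup>2" using qp[OF True] by (intro power_mono) auto
          also have "\<dots> = 4 * (q (fst i))\<^sup>2 * indicat_real (B i) z" using i by (simp add: power_mult_distrib)
          also have "\<dots> \<le> (\<Sum>i\<in>F. 4 * (q (fst i))\<^sup>2 * indicat_real (B i) z)"
            by (rule member_le_sum[OF i(1)]) (use F(1) in auto)
          finally show ?thesis using True False by simp
        next
          case inR: True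
          have "(q z)\<^sup>2 \<le> K'\<^sup>2" using qp[OF True] qK[OF True] by (intro power_mono) auto
          then show ?thesis using True inR nn by simp
        qed
      qed (use nn in auto)
    qed
  qed
  also have "\<dots> = (\<Sum>i\<in>F. 4 * (q (fst i))\<^sup>2 * measure lebesgue (B i)) + K'\<^sup>2 * measure lebesgue Rr"
  proof -
    have i: "integrable M (\<lambda>z. 4 * (q (fst i))\<^sup>2 * indicat_real (B i) z)" if "i \<in> F" for i
      by (rule iM(1)[OF Bs[OF that]])
    show ?thesis
      by (subst Bochner_Integration.integral_add, rule Bochner_Integration.integrable_sum, erule i, rule iM(1)[OF Rs],
          subst Bochner_Integration.integral_sum, erule i) (simp only: iM(2)[OF Rs] iM(2)[OF Bs] cong: sum.cong)
  qed
  also have "(\<Sum>i\<in>F. 4 * (q (fst i))\<^sup>2 * measure lebesgue (B i)) = 4 / k * (\<Sum>i\<in>F. E i)"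
    using k by (simp add: E_def sum_distrib_left mult.assoc)
  also have "K'\<^sup>2 * measure lebesgue Rr \<le> K'\<^sup>2 * \<epsilon>" using F(3) by (intro mult_left_mono) (auto simp: Rr_def)
  \<comment> \<open>The 4 is the square of the doubling factor. Absorbing half of the gap on the
    left turns it into the 8 of the statement.\<close>
  finally have "gap f \<le> 4 / k * (\<Sum>i\<in>F. E i) + gap f / 2" using \<epsilon>(2) by linarith
  then have "k / 8 * gap f \<le> (\<Sum>i\<in>F. E i)" using k by (simp add: field_simps)
  moreover have "compact (\<Union>i\<in>F. B i)" using F(1) by (intro compact_UN) (auto simp: B_def)
  moreover have "(\<Union>i\<in>F. B i) \<subseteq> P \<inter> open_cell" using BS F(2) unfolding S_def by blast
  ultimately show ?thesis using w unfolding k_def by blast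
qed

text \<open>With this test function the pairing becomes the integral of the velocity against
  \<open>g\<close>, weighted by \<open>1 / \<rho>\<close>; weak convergence then handles the mixed
  terms.\<close>

lemma L1_fst:
  assumes "continuous_on (slab T) (g :: 'n point \<Rightarrow> real^'n)"
  shows "(\<lambda>z. ((1 / \<rho> z) *\<^sub>R g z, 0)) \<in> L1_fun T"
proof -
  have "continuous_on (slab T) (\<lambda>z. ((1 / \<rho> z) *\<^sub>R g z, 0 :: real^'n^'n))"
    by (intro continuous_intros assms cont) (use pos(1) in \<open>auto simp: less_le\<close>)
  from integrable_spacetime_continuous[OF this] show ?thesis by (simp add: L1_fun_def Sym0_zero)
qed

text \<open>The delicate point is the mixed-term condition. Its left side changes by
  \<open>a N\<close>, which tends to 0, whereas its right side gains an eighth of the energy of the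
  wave, at least \<open>E / r\<close>, up to the vanishing cross term \<open>d N\<close>. Thus
  \<open>E > 0\<close> leaves room even if \<open>f\<close> satisfies the condition with
  equality.\<close>

lemma X0_perturbation:
  assumes f: "f \<in> Adm" and B: "compact B" "B \<subseteq> P \<inter> open_cell" and w: "perturbs f B E w" and E: "E > 0"
  shows "\<forall>\<^sub>F N in sequentially. (\<lambda>z. f z + w N z) \<in> Adm"
proof -
  note p = perturbsD[OF w]
  obtain m r K K' c where b: "0 < m" "\<And>z. z \<in> closed_unit_cell T \<Longrightarrow> m \<le> \<rho> z \<and> \<rho> z \<le> r"
    using uniform_bounds by metis
  have \<rho>r: "0 < \<rho> z" "\<rho> z \<le> r" if "z \<in> unit_cell T" for z
  proof -
    have "z \<in> closed_unit_cell T" using that unit_cell_subset(1) by blast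
    then show "0 < \<rho> z" "\<rho> z \<le> r" using b(1) b(2)[of z] by linarith+
  qed
  have r: "r > 0"
  proof -
    have "(0, 0) \<in> (closed_unit_cell T :: 'n point set)" using T by (simp add: closed_unit_cell_def mem_box_cart)
    then show ?thesis using b(1) b(2)[of "(0,0)"] by linarith
  qed
  define a where "a N = (LINT z|M. (V z \<bullet> fst (w N z)) / \<rho> z)" for N
  define d where "d N = (LINT z|M. (fst (f z) \<bullet> fst (w N z)) / \<rho> z)" for N
  have a0: "a \<longlonglongrightarrow> 0"
    using p(8)[OF L1_fst[OF cont(2)]] unfolding a_def by (simp add: inner_prod_def inner_commute)
  have d0: "d \<longlonglongrightarrow> 0"
    using p(8)[OF L1_fst[OF smooth_continuous[OF smooth_fst[OF X0D(1)[OF f]]]]] unfolding d_def by (simp add: inner_prod_def inner_commute)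
  have "(\<lambda>N. \<bar>a N\<bar> + \<bar>d N\<bar> / 4) \<longlonglongrightarrow> \<bar>0\<bar> + \<bar>0\<bar> / 4"
    by (intro tendsto_intros a0 d0) simp
  \<comment> \<open>The cross term enters the energy as \<open>2 * d N\<close>; the weight 1/8 turns
    this into the quarter used here.\<close>
  then have "\<forall>\<^sub>F N in sequentially. \<bar>a N\<bar> + \<bar>d N\<bar> / 4 < E / r / 8"
    using E r by (intro order_tendstoD(2)) auto
  then show ?thesis using p(7,9)
  proof eventually_elim
    case (elim N)
    define g where "g z = f z + w N z" for z
    have sg: "smooth g" unfolding g_def by (rule smooth_add[OF X0D(1)[OF f] p(1)])
    have ts: "g \<in> test_states P" unfolding test_states_iff
    proof (intro conjI allI)
      show "smooth g" by (rule sg)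
      show "space_periodic_on UNIV g"
        using X0D(2)[OF f] p(2)[of N] by (simp add: g_def space_periodic_on_def)
      show "snd (g z) \<in> Sym0" for z using X0D(3)[OF f, of z] p(4)[of N z] by (simp add: g_def Sym0_add)
      \<comment> \<open>The support of the sum lies in a union of two closed subsets of
        \<open>P\<close>; the second one consists of all translates of \<open>B\<close>.\<close>
      have "closed {z. wrap z \<in> B}" using closed_wrap_vimage[OF B(1)] B(2) by blast
      moreover have "{z. g z \<noteq> 0} \<subseteq> closure {z. f z \<noteq> 0} \<union> {z. wrap z \<in> B}"
      proof
        fix z assume "z \<in> {z. g z \<noteq> 0}"
        then have "f z \<noteq> 0 \<or> wrap z \<in> B" using p(5)[of z N] by (cases "wrap z \<in> B") (auto simp: g_def)
        then show "z \<in> closure {z. f z \<noteq> 0} \<union> {z. wrap z \<in> B}" using closure_subset[of "{z. f z \<noteq> 0}"] by blast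
      qed
      ultimately have "closure {z. g z \<noteq> 0} \<subseteq> closure {z. f z \<noteq> 0} \<union> {z. wrap z \<in> B}"
        by (intro closure_minimal closed_Un) auto
      also have "\<dots> \<subseteq> P" using X0D(6)[OF f] B(2) P_wrap by blast
      finally show "closure {z. g z \<noteq> 0} \<subseteq> P" .
    qed
    have int: "integrable M (\<lambda>z. (u z \<bullet> v z) / \<rho> z)" if "continuous_on (slab T) u" "continuous_on (slab T) v"
      for u v :: "'n point \<Rightarrow> real^'n"
      by (intro integrable_spacetime_continuous continuous_intros that cont) (use pos(1) in \<open>auto simp: less_le\<close>)
    note cf = smooth_continuous[OF smooth_fst[OF X0D(1)[OF f]], of "slab T"]
    note cw = smooth_continuous[OF smooth_fst[OF p(1)], of "slab T" N]
    have 1: "(LINT z|M. (V z \<bullet> fst (g z)) / \<rho> z) = (LINT z|M. (V z \<bullet> fst (f z)) / \<rho> z) + a N"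
      unfolding a_def g_def using int[OF cont(2) cf] int[OF cont(2) cw]
      by (simp add: inner_add_right add_divide_distrib)
    have "(norm (fst (g z)))\<^sup>2 / \<rho> z = (fst (f z) \<bullet> fst (f z)) / \<rho> z + 2 * ((fst (f z) \<bullet> fst (w N z)) / \<rho> z) + (fst (w N z) \<bullet> fst (w N z)) / \<rho> z" for z
      unfolding g_def power2_norm_eq_inner by (simp add: inner_add_left inner_add_right inner_commute add_divide_distrib)
    then have 2: "(LINT z|M. (norm (fst (g z)))\<^sup>2 / \<rho> z) = (LINT z|M. (norm (fst (f z)))\<^sup>2 / \<rho> z) + 2 * d N
        + (LINT z|M. (fst (w N z) \<bullet> fst (w N z)) / \<rho> z)"
      unfolding d_def power2_norm_eq_inner using int[OF cf cf] int[OF cf cw] int[OF cw cw] by (simp del: times_divide_eq_right)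
    have "E / r \<le> (LINT z|M. (norm (fst (w N z)))\<^sup>2) / r" using elim(3) r by (intro divide_right_mono) auto
    also have "\<dots> = (LINT z|M. (norm (fst (w N z)))\<^sup>2 / r)" by simp
    also have "\<dots> \<le> (LINT z|M. (fst (w N z) \<bullet> fst (w N z)) / \<rho> z)"
    proof (rule integral_mono[OF _ int[OF cw cw]])
      show "integrable M (\<lambda>z. (norm (fst (w N z)))\<^sup>2 / r)"
        by (intro integrable_spacetime_continuous continuous_intros cw) (use r in auto)
      show "(norm (fst (w N z)))\<^sup>2 / r \<le> (fst (w N z) \<bullet> fst (w N z)) / \<rho> z" if "z \<in> space M" for z
        using \<rho>r[of z] that r unfolding space_spacetime by (simp add: power2_norm_eq_inner divide_left_mono)
    qed
    finally have 3: "E / r \<le> (LINT z|M. (fst (w N z) \<bullet> fst (w N z)) / \<rho> z)" .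
    have fb: "\<bar>LINT z|M. (V z \<bullet> fst (f z)) / \<rho> z\<bar> \<le> 1 / 8 * (LINT z|M. (norm (fst (f z)))\<^sup>2 / \<rho> z)"
      using f unfolding X0_iff by blast
    have "\<bar>LINT z|M. (V z \<bullet> fst (g z)) / \<rho> z\<bar> \<le> 1 / 8 * (LINT z|M. (norm (fst (g z)))\<^sup>2 / \<rho> z)"
    proof -
      have "\<bar>x + a\<bar> \<le> 1 / 8 * (y + 2 * d + s)" if "\<bar>x\<bar> \<le> 1 / 8 * y" "q \<le> s" "\<bar>a\<bar> + \<bar>d\<bar> / 4 < q / 8" for x a y d s q :: real
        using that by (simp add: abs_le_iff abs_less_iff) argo
      from this[OF fb 3 elim(1)] show ?thesis unfolding 1 2 .
    qed
    moreover have "solves T g" unfolding g_def by (rule solves_add[OF X0D(1)[OF f] p(1) X0D(7)[OF f] p(3) T])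
    moreover have "\<forall>z\<in>P. 0 \<prec> D z (g z)" using elim(2) by (simp add: g_def)
    ultimately have "g \<in> Adm" using ts unfolding X0_iff by blast
    then show ?case by (simp add: g_def[abs_def])
  qed
qed

section \<open>Weakly convergent sequences that stay away from their limit\<close>

definition weakly_to :: "(nat \<Rightarrow> 'n point \<Rightarrow> 'n state) \<Rightarrow> ('n point \<Rightarrow> 'n state) \<Rightarrow> bool" where
  "weakly_to g f \<longleftrightarrow> (\<forall>\<phi>\<in>L1_fun T. (\<lambda>N. LINT z|M. g N z \<bullet> \<phi> z) \<longlonglongrightarrow> (LINT z|M. f z \<bullet> \<phi> z))"

definition has_gap :: "real \<Rightarrow> ('n point \<Rightarrow> 'n state) \<Rightarrow> bool" where
  "has_gap \<kappa> f \<longleftrightarrow> (\<exists>g. (\<forall>N. g N \<in> Adm \<and> \<kappa> * gap f \<le> (LINT z|M. (norm (g N z - f z))\<^sup>2)) \<and> weakly_to g f)"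

text \<open>The factor depends on the dimension and the constant \<open>c\<close> of
  \<open>uniform_bounds\<close> only, hence not on \<open>f\<close>. If the gap of \<open>f\<close>
  is not positive, the constant sequence suffices.\<close>

lemma X0_weak_gap:
  obtains \<kappa> where "\<kappa> > 0" "\<And>f. f \<in> Adm \<Longrightarrow> has_gap \<kappa> f"
proof -
  obtain m r K K' c where b: "0 < m" "0 < c" "c\<^sup>2 * K' + 2 * c * K \<le> m / 2"
    "\<And>z. z \<in> closed_unit_cell T \<Longrightarrow> m \<le> \<rho> z \<and> \<rho> z \<le> r"
    "\<And>f z. f \<in> Adm \<Longrightarrow> z \<in> P \<Longrightarrow> norm (V z + fst (f z)) \<le> K \<and> trace (D z (f z)) \<le> K'"
    using uniform_bounds by metis
  define \<kappa> where "\<kappa> = wave_energy TYPE('n) * (c / real CARD('n))\<^sup>2 / 8"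
  have \<kappa>: "\<kappa> > 0" using wave_energy_pos[where 'n='n] b(2) by (simp add: \<kappa>_def)
  show ?thesis
  proof (rule that[OF \<kappa>])
    fix f assume f: "f \<in> Adm"
    show "has_gap \<kappa> f"
    proof (cases "gap f > 0")
      case False
      then have "\<kappa> * gap f \<le> 0" using \<kappa> by (simp add: mult_le_0_iff)
      then show ?thesis unfolding has_gap_def weakly_to_def using f by (intro exI[of _ "\<lambda>N. f"]) auto
    next
      case True
      obtain B E w where w: "compact B" "B \<subseteq> P \<inter> open_cell" "perturbs f B E w" "\<kappa> * gap f \<le> E"
        using perturbation_on_balls[OF b(1-3) conjunct1[OF b(4)] b(5)[OF f] f True] unfolding \<kappa>_def by blast
      have E: "E > 0" using w(4) True \<kappa> mult_pos_pos[OF \<kappa> True] by linarith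
      note p = perturbsD[OF w(3)]
      have "\<forall>\<^sub>F N in sequentially. (\<lambda>z. f z + w N z) \<in> Adm \<and> E \<le> (LINT z|M. (norm (fst (w N z)))\<^sup>2)"
        using X0_perturbation[OF f w(1-3) E] p(9) by (rule eventually_conj)
      then obtain N0 where N0: "\<And>N. N \<ge> N0 \<Longrightarrow> (\<lambda>z. f z + w N z) \<in> Adm" "\<And>N. N \<ge> N0 \<Longrightarrow> E \<le> (LINT z|M. (norm (fst (w N z)))\<^sup>2)"
        by (auto simp: eventually_sequentially)
      show ?thesis unfolding has_gap_def weakly_to_def
      \<comment> \<open>Starting the sequence at \<open>N0\<close> makes the eventual properties
        hold for every index.\<close>
      proof (intro exI[of _ "\<lambda>N z. f z + w (N + N0) z"] conjI allI ballI)
        show "(\<lambda>z. f z + w (N + N0) z) \<in> Adm" for N by (rule N0) simp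
        show "(\<lambda>N. LINT z|M. (f z + w (N + N0) z) \<bullet> \<phi> z) \<longlonglongrightarrow> (LINT z|M. f z \<bullet> \<phi> z)" if "\<phi> \<in> L1_fun T" for \<phi>
          using tendsto_add[OF tendsto_const LIMSEQ_ignore_initial_segment[OF p(8)[OF that], of N0], of "LINT z|M. f z \<bullet> \<phi> z"]
          by (simp add: inner_add_left integrable_smooth_inner_L1[OF X0D(1)[OF f] that] integrable_smooth_inner_L1[OF p(1) that])
        show "\<kappa> * gap f \<le> (LINT z|M. (norm (f z + w (N + N0) z - f z))\<^sup>2)" for N
        proof -
          have "E \<le> (LINT z|M. (norm (fst (w (N + N0) z)))\<^sup>2)" by (rule N0) simp
          also have "\<dots> \<le> (LINT z|M. (norm (f z + w (N + N0) z - f z))\<^sup>2)"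
          proof (rule integral_mono)
            show "integrable M (\<lambda>z. (norm (fst (w (N + N0) z)))\<^sup>2)"
              by (intro integrable_spacetime_continuous continuous_intros smooth_continuous[OF smooth_fst[OF p(1)]])
            show "integrable M (\<lambda>z. (norm (f z + w (N + N0) z - f z))\<^sup>2)"
              by (intro integrable_spacetime_continuous continuous_intros smooth_continuous[OF X0D(1)[OF f]] smooth_continuous[OF p(1)])
            show "(norm (fst (w (N + N0) z)))\<^sup>2 \<le> (norm (f z + w (N + N0) z - f z))\<^sup>2" for z
              using norm_fst_le[of "fst (w (N + N0) z)" "snd (w (N + N0) z)"] by (intro power_mono) auto
          qed
          finally show ?thesis using w(4) by linarith
        qed
      qed
    qed
  qed
qed

end

subsection \<open>The weak-star topology\<close>

lemma Linf_fun_ae_class: "f \<in> Linf_fun T \<Longrightarrow> f \<in> ae_class T f"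
  by (simp add: ae_class_def ae_rel_def)

lemma ae_class_in_Linf: "f \<in> Linf_fun T \<Longrightarrow> ae_class T f \<in> Linf T"
  unfolding ae_class_def Linf_def by (rule quotientI)

text \<open>The class of a function outside \<open>Linf_fun\<close> is empty, whereas every element
  of \<open>Linf\<close> contains its representative.\<close>

lemma in_Linf_imp_Linf_fun:
  assumes "ae_class T f \<in> Linf T" shows "f \<in> Linf_fun T"
proof -
  obtain h where h: "h \<in> Linf_fun T" "ae_class T f = ae_class T h"
    using assms unfolding Linf_def ae_class_def quotient_def by blast
  then have "h \<in> ae_class T f" using Linf_fun_ae_class by blast
  then show ?thesis by (simp add: ae_class_def ae_rel_def)
qed

lemma topspace_weak_star: "topspace (weak_star T :: ('n::finite point \<Rightarrow> 'n state) set topology) = Linf T"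
proof
  show "topspace (weak_star T) \<subseteq> (Linf T :: ('n point \<Rightarrow> 'n state) set set)"
    unfolding weak_star_def topology_generated_by_topspace by blast
  show "(Linf T :: ('n point \<Rightarrow> 'n state) set set) \<subseteq> topspace (weak_star T)"
  proof
    fix u :: "('n point \<Rightarrow> 'n state) set" assume u: "u \<in> Linf T"
    then obtain f where f: "f \<in> Linf_fun T" "u = ae_class T f" unfolding Linf_def ae_class_def quotient_def by blast
    have "f \<in> u" using Linf_fun_ae_class f by blast
    \<comment> \<open>The zero test function with \<open>G = UNIV\<close> gives a subbasic set equal
      to all of \<open>Linf T\<close>.\<close>
    moreover have "(\<lambda>z. 0 :: 'n state) \<in> L1_fun T" by (simp add: L1_fun_def Sym0_zero)
    ultimately show "u \<in> topspace (weak_star T)"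
      unfolding weak_star_def topology_generated_by_topspace using u open_UNIV by blast
  qed
qed

text \<open>Induction over the generation of open sets: eventual membership passes through finite
  intersections and arbitrary unions. For a subbasic set it is the assumed convergence, once the
  pairing is seen not to depend on the representative.\<close>

lemma weak_star_limit:
  fixes f :: "('n::finite) point \<Rightarrow> 'n state"
  assumes g: "\<And>N. g N \<in> Linf_fun T" and f: "f \<in> Linf_fun T"
    and lim: "\<And>\<phi>. \<phi> \<in> L1_fun T \<Longrightarrow> (\<lambda>N::nat. LINT z|spacetime T. g N z \<bullet> \<phi> z) \<longlonglongrightarrow> (LINT z|spacetime T. f z \<bullet> \<phi> z)"
    and U: "openin (weak_star T) U" "ae_class T f \<in> U"
  shows "\<forall>\<^sub>F N in sequentially. ae_class T (g N) \<in> U"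
proof -
  have "generate_topology_on {{u \<in> Linf T. \<exists>f\<in>u. (LINT z|spacetime T. f z \<bullet> \<phi> z) \<in> G} | \<phi> G. \<phi> \<in> L1_fun T \<and> open G} U"
    using U(1) unfolding weak_star_def openin_topology_generated_by_iff .
  then show ?thesis using U(2)
  proof (induction rule: generate_topology_on.induct)
    case (Int a b)
    then have "\<forall>\<^sub>F N in sequentially. ae_class T (g N) \<in> a" "\<forall>\<^sub>F N in sequentially. ae_class T (g N) \<in> b" by auto
    then show ?case by eventually_elim auto
  next
    case (UN K)
    then obtain k where k: "k \<in> K" "ae_class T f \<in> k" by blast
    then have "\<forall>\<^sub>F N in sequentially. ae_class T (g N) \<in> k" using UN by blast
    then show ?case by eventually_elim (use k in auto)
  next
    case (Basis s)
    then obtain \<phi> G where s: "s = {u \<in> Linf T. \<exists>f\<in>u. (LINT z|spacetime T. f z \<bullet> \<phi> z) \<in> G}" "\<phi> \<in> L1_fun T" "open G" by blast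
    obtain h where h: "h \<in> ae_class T f" "(LINT z|spacetime T. h z \<bullet> \<phi> z) \<in> G" using Basis(2) s(1) by blast
    have hm: "h \<in> borel_measurable (spacetime T)" "f \<in> borel_measurable (spacetime T)" "AE z in spacetime T. f z = h z"
      using h(1) f by (auto simp: ae_class_def ae_rel_def Linf_fun_def)
    have \<phi>m: "\<phi> \<in> borel_measurable (spacetime T)" using s(2) by (auto simp: L1_fun_def)
    have "(LINT z|spacetime T. f z \<bullet> \<phi> z) = (LINT z|spacetime T. h z \<bullet> \<phi> z)"
      by (rule integral_cong_AE) (use hm \<phi>m in auto)
    then have "(LINT z|spacetime T. f z \<bullet> \<phi> z) \<in> G" using h(2) by simp
    then have "\<forall>\<^sub>F N in sequentially. (LINT z|spacetime T. g N z \<bullet> \<phi> z) \<in> G"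
      using topological_tendstoD[OF lim[OF s(2)] s(3)] by blast
    then show ?case
      by eventually_elim (use s(1) ae_class_in_Linf[OF g] Linf_fun_ae_class[OF g] in blast)
  qed simp
qed

section \<open>Consequences at a point of continuity\<close>

context subsolution begin

lemma X0_Linf_fun: "f \<in> Adm \<Longrightarrow> f \<in> Linf_fun T"
proof -
  assume f: "f \<in> Adm"
  obtain C where C: "\<And>z. z \<in> closed_unit_cell T \<Longrightarrow> norm (f z) \<le> C"
    using continuous_slab_bounded[OF smooth_continuous[OF X0D(1)[OF f]]] by blast
  have "AE z in M. norm (f z) \<le> C"
  proof (intro AE_I2)
    fix z assume "z \<in> space M"
    then have "z \<in> closed_unit_cell T" unfolding space_spacetime using unit_cell_subset(1) by blast
    then show "norm (f z) \<le> C" by (rule C)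
  qed
  then show ?thesis
    unfolding Linf_fun_def using smooth_measurable[OF X0D(1)[OF f]] X0D(3)[OF f] by blast
qed

lemma L2_dist_less:
  assumes "L2_dist T f g < e" "0 < e"
  shows "(LINT z|M. (norm (f z - g z))\<^sup>2) < e\<^sup>2"
  using assms unfolding L2_dist_def by (smt (verit) real_le_lsqrt real_le_rsqrt real_sqrt_less_iff real_sqrt_unique)

lemma Linf_fun_L2:
  assumes "f \<in> Linf_fun T" "g \<in> Linf_fun T"
  shows "integrable M (\<lambda>z. (norm (f z - g z))\<^sup>2)"
proof -
  obtain C1 C2 where C: "AE z in M. norm (f z) \<le> C1" "AE z in M. norm (g z) \<le> C2"
    using assms by (auto simp: Linf_fun_def)
  have [measurable]: "f \<in> borel_measurable M" "g \<in> borel_measurable M" using assms by (auto simp: Linf_fun_def)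
  show ?thesis
  proof (rule integrable_spacetime_bounded)
    show "(\<lambda>z. (norm (f z - g z))\<^sup>2) \<in> borel_measurable M" by measurable
    show "AE z in M. norm ((norm (f z - g z))\<^sup>2) \<le> (C1 + C2)\<^sup>2"
      using C
    proof eventually_elim
      case (elim z)
      have "norm (f z - g z) \<le> C1 + C2" using norm_triangle_ineq4[of "f z" "g z"] elim by linarith
      then have "(norm (f z - g z))\<^sup>2 \<le> (C1 + C2)\<^sup>2" by (intro power_mono) auto
      then show ?case by simp
    qed
  qed
qed

text \<open>A small metric ball around \<open>h\<close> is also a weak-star neighbourhood. It
  contains the class of some \<open>f\<close> in \<open>X0\<close>, and then also late members of
  the sequence that converges weakly to \<open>f\<close>. By continuity both are \<epsilon>-close to
  \<open>h\<close> in L^2, hence close to each other, which bounds the gap between them.\<close>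

lemma approximation:
  assumes d: "complete_metric_for (weak_star T) (X T P \<rho> V R) d"
    and h: "L2_continuity_point T (X T P \<rho> V R) d h"
    and \<kappa>: "\<And>f. f \<in> Adm \<Longrightarrow> has_gap \<kappa> f"
    and \<epsilon>: "\<epsilon> > 0"
  obtains f where "f \<in> Adm" "(LINT z|M. (norm (f z - h z))\<^sup>2) < \<epsilon>\<^sup>2" "\<kappa> * gap f \<le> 4 * \<epsilon>\<^sup>2" "h \<in> Linf_fun T"
proof -
  interpret Metric_space "X T P \<rho> V R" d using d by (simp add: complete_metric_for_def)
  have mt: "mtopology = subtopology (weak_star T) (X T P \<rho> V R)" using d by (simp add: complete_metric_for_def)
  have hX: "ae_class T h \<in> X T P \<rho> V R" using h by (simp add: L2_continuity_point_def)
  have XL: "X T P \<rho> V R \<subseteq> Linf T" 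
    unfolding X_def using closure_of_subset_topspace[of "weak_star T"] unfolding topspace_weak_star .
  have hL: "h \<in> Linf_fun T" using hX XL in_Linf_imp_Linf_fun by blast
  have X0X: "ae_class T f \<in> X T P \<rho> V R" if "f \<in> Adm" for f
  proof -
    have "ae_class T ` Adm \<subseteq> topspace (weak_star T)"
      unfolding topspace_weak_star using X0_Linf_fun ae_class_in_Linf by blast
    then show ?thesis unfolding X_def using closure_of_subset that by blast
  qed
  obtain \<eta> where \<eta>: "\<eta> > 0" "\<And>g. ae_class T g \<in> X T P \<rho> V R \<Longrightarrow> d (ae_class T h) (ae_class T g) < \<eta> \<Longrightarrow> L2_dist T h g < \<epsilon>"
    using h \<epsilon> unfolding L2_continuity_point_def by blast
  have "openin (subtopology (weak_star T) (X T P \<rho> V R)) (mball (ae_class T h) \<eta>)"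
    using openin_mball unfolding mt .
  \<comment> \<open>The metric induces the subspace topology, so its ball is the trace on
    \<open>X\<close> of a weak-star open set.\<close>
  then obtain U where U: "openin (weak_star T) U" "mball (ae_class T h) \<eta> = U \<inter> X T P \<rho> V R"
    unfolding openin_subtopology by blast
  have "ae_class T h \<in> U" using U(2) hX \<eta>(1) centre_in_mball_iff[of "ae_class T h" \<eta>] by blast
  then obtain f where f: "f \<in> Adm" "ae_class T f \<in> U"
    using hX U(1) unfolding X_def in_closure_of by blast
  have close: "L2_dist T h g < \<epsilon>" if "g \<in> Adm" "ae_class T g \<in> U" for g
  proof -
    have "ae_class T g \<in> mball (ae_class T h) \<eta>" using U(2) that X0X by blast
    then show ?thesis using \<eta>(2) by simp
  qed
  obtain g where g: "\<And>N. g N \<in> Adm" "\<And>\<phi>. \<phi> \<in> L1_fun T \<Longrightarrow> (\<lambda>N::nat. LINT z|M. g N z \<bullet> \<phi> z) \<longlonglongrightarrow> (LINT z|M. f z \<bullet> \<phi> z)"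
    "\<And>N. \<kappa> * gap f \<le> (LINT z|M. (norm (g N z - f z))\<^sup>2)" 
    using \<kappa>[OF f(1)] unfolding has_gap_def weakly_to_def by blast
  have "\<forall>\<^sub>F N in sequentially. ae_class T (g N) \<in> U"
    by (rule weak_star_limit[OF X0_Linf_fun[OF g(1)] X0_Linf_fun[OF f(1)] g(2) U(1) f(2)])
  then obtain N where N: "ae_class T (g N) \<in> U" by (auto simp: eventually_sequentially)
  have c1: "(LINT z|M. (norm (h z - f z))\<^sup>2) < \<epsilon>\<^sup>2" by (rule L2_dist_less[OF close[OF f] \<epsilon>])
  have c2: "(LINT z|M. (norm (h z - g N z))\<^sup>2) < \<epsilon>\<^sup>2" by (rule L2_dist_less[OF close[OF g(1) N] \<epsilon>])
  note i1 = Linf_fun_L2[OF hL X0_Linf_fun[OF f(1)]]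
  note i2 = Linf_fun_L2[OF hL X0_Linf_fun[OF g(1)], of N]
  have "\<kappa> * gap f \<le> (LINT z|M. (norm (g N z - f z))\<^sup>2)" by (rule g(3))
  \<comment> \<open>The triangle inequality through \<open>h\<close>, squared; two terms with factor
    2 give the \<open>4 * \<epsilon>\<^sup>2\<close>.\<close>
  also have "\<dots> \<le> (LINT z|M. 2 * (norm (h z - f z))\<^sup>2 + 2 * (norm (h z - g N z))\<^sup>2)"
  proof (rule integral_mono[OF Linf_fun_L2[OF X0_Linf_fun[OF g(1)] X0_Linf_fun[OF f(1)]]])
    show "integrable M (\<lambda>z. 2 * (norm (h z - f z))\<^sup>2 + 2 * (norm (h z - g N z))\<^sup>2)" using i1 i2 by simp
    fix z
    have "norm (g N z - f z) \<le> norm (h z - f z) + norm (h z - g N z)"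
      using norm_triangle_ineq4[of "h z - f z" "h z - g N z"] by simp
    then have "(norm (g N z - f z))\<^sup>2 \<le> (norm (h z - f z) + norm (h z - g N z))\<^sup>2" by (intro power_mono) auto
    also have "\<dots> \<le> 2 * (norm (h z - f z))\<^sup>2 + 2 * (norm (h z - g N z))\<^sup>2"
      using sum_squares_bound[of "norm (h z - f z)" "norm (h z - g N z)"] by (simp add: power2_sum)
    finally show "(norm (g N z - f z))\<^sup>2 \<le> 2 * (norm (h z - f z))\<^sup>2 + 2 * (norm (h z - g N z))\<^sup>2" .
  qed
  also have "\<dots> = 2 * (LINT z|M. (norm (h z - f z))\<^sup>2) + 2 * (LINT z|M. (norm (h z - g N z))\<^sup>2)" using i1 i2 by simp
  finally have "\<kappa> * gap f \<le> 4 * \<epsilon>\<^sup>2" using c1 c2 by linarith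
  then show ?thesis using that f(1) c1 hL by (simp add: norm_minus_commute)
qed

text \<open>Twice the mixed term is at most a quarter of the energy, so integrating the nonnegative
  trace leaves three quarters of the energy below the integral of \<open>trace R\<close>. Outside
  \<open>P\<close> the field vanishes and the integrand is \<open>trace R\<close> itself.\<close>

lemma energy_bound:
  assumes f: "f \<in> Adm"
  shows "(LINT z|M. (norm (fst (f z)))\<^sup>2 / \<rho> z) \<le> 4 / 3 * (LINT z|M. trace (R z))"
proof -
  note cf = smooth_continuous[OF smooth_fst[OF X0D(1)[OF f]], of "slab T"]
  have i1: "integrable M (\<lambda>z. (norm (fst (f z)))\<^sup>2 / \<rho> z)"
    by (intro integrable_spacetime_continuous continuous_intros cf cont) (use pos(1) in \<open>auto simp: less_le\<close>)
  have i2: "integrable M (\<lambda>z. (V z \<bullet> fst (f z)) / \<rho> z)"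
    by (intro integrable_spacetime_continuous continuous_intros cf cont) (use pos(1) in \<open>auto simp: less_le\<close>)
  have i3: "integrable M (\<lambda>z. trace (R z))"
    by (intro integrable_spacetime_continuous continuous_on_trace cont)
  have "0 \<le> (LINT z|M. trace (R z) - 2 * ((V z \<bullet> fst (f z)) / \<rho> z) - (norm (fst (f z)))\<^sup>2 / \<rho> z)"
  proof (rule integral_nonneg_AE, rule AE_I2)
    fix z assume "z \<in> space M"
    then have z: "z \<in> slab T" unfolding space_spacetime using unit_cell_subset by blast
    show "0 \<le> trace (R z) - 2 * ((V z \<bullet> fst (f z)) / \<rho> z) - (norm (fst (f z)))\<^sup>2 / \<rho> z"
    proof (cases "z \<in> P")
      case True
      then show ?thesis using posdef_trace_pos[OF X0D(4)[OF f True]] unfolding trace_defect[OF X0D(3)[OF f]] by simp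
    next
      case False
      then show ?thesis using X0D(5)[OF f False] posdef_trace_pos[OF pos(3)[OF z]] by simp
    qed
  qed
  also have "\<dots> = (LINT z|M. trace (R z)) - 2 * (LINT z|M. (V z \<bullet> fst (f z)) / \<rho> z) - (LINT z|M. (norm (fst (f z)))\<^sup>2 / \<rho> z)"
    using i1 i2 i3 by (simp del: times_divide_eq_right)
  finally show ?thesis using f unfolding X0_iff by linarith
qed

lemma continuity_point_properties:
  assumes d: "complete_metric_for (weak_star T) (X T P \<rho> V R) d"
    and h: "L2_continuity_point T (X T P \<rho> V R) d h"
  shows "AE z in M. z \<in> P \<longrightarrow> D z (h z) = 0"
    and "(LINT z|M. (norm (fst (h z)))\<^sup>2 / \<rho> z) \<le> 4 / 3 * (LINT z|M. trace (R z))"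
proof -
  obtain \<kappa> where \<kappa>: "\<kappa> > 0" "\<And>f. f \<in> Adm \<Longrightarrow> has_gap \<kappa> f"
    using X0_weak_gap by blast
  define e where "e k = 1 / real (Suc k)" for k
  have e: "e k > 0" for k by (simp add: e_def)
  have e0: "e \<longlonglongrightarrow> 0" unfolding e_def by (rule LIMSEQ_Suc) (rule lim_1_over_n)
  have "\<exists>f. f \<in> Adm \<and> (LINT z|M. (norm (f z - h z))\<^sup>2) < (e k)\<^sup>2 \<and> \<kappa> * gap f \<le> 4 * (e k)\<^sup>2 \<and> h \<in> Linf_fun T" for k
    by (rule approximation[OF d h \<kappa>(2) e[of k]]) blast+
  then have "\<exists>f. \<forall>k. f k \<in> Adm \<and> (LINT z|M. (norm (f k z - h z))\<^sup>2) < (e k)\<^sup>2 \<and> \<kappa> * gap (f k) \<le> 4 * (e k)\<^sup>2 \<and> h \<in> Linf_fun T"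
    by (intro choice allI)
  then obtain f where f: "\<And>k. f k \<in> Adm" "\<And>k. (LINT z|M. (norm (f k z - h z))\<^sup>2) < (e k)\<^sup>2"
     "\<And>k. \<kappa> * gap (f k) \<le> 4 * (e k)\<^sup>2" and hL: "h \<in> Linf_fun T" by blast
  have hm[measurable]: "h \<in> borel_measurable M" using hL by (simp add: Linf_fun_def)
  \<comment> \<open>Both quantities tend to 0 in L^1; adding them yields one subsequence along which
    both tend to 0 almost everywhere.\<close>
  define s where "s k z = (norm (f k z - h z))\<^sup>2 + indicat_real P z * (trace (D z (f k z)))\<^sup>2" for k z
  note i1 = Linf_fun_L2[OF X0_Linf_fun[OF f(1)] hL]
  have i2: "integrable M (\<lambda>z. indicat_real P z * (trace (D z (f k z)))\<^sup>2)" for k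
  proof (rule Bochner_Integration.integrable_bound)
    show "integrable M (\<lambda>z. (trace (D z (f k z)))\<^sup>2)"
      by (intro integrable_spacetime_continuous continuous_intros trace_D_continuous X0D(1)[OF f(1)])
    then have [measurable]: "(\<lambda>z. (trace (D z (f k z)))\<^sup>2) \<in> borel_measurable M" by auto
    show "(\<lambda>z. indicat_real P z * (trace (D z (f k z)))\<^sup>2) \<in> borel_measurable M" using indicator_P_measurable by measurable
  qed (auto simp: indicator_def)
  have si: "integrable M (s k)" for k unfolding s_def by (intro Bochner_Integration.integrable_add i1 i2)
  have "(\<lambda>k. LINT z|M. norm (s k z)) \<longlonglongrightarrow> 0"
  proof (rule Lim_null_comparison)
    show "(\<lambda>k. (1 + 4 / \<kappa>) * (e k)\<^sup>2) \<longlonglongrightarrow> 0"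
      by (rule tendsto_eq_intros e0 refl)+ simp
    show "\<forall>\<^sub>F k in sequentially. norm (LINT z|M. norm (s k z)) \<le> (1 + 4 / \<kappa>) * (e k)\<^sup>2"
    proof (intro always_eventually allI)
      fix k
      have "0 \<le> s k z" for z by (simp add: s_def)
      then have "norm (LINT z|M. norm (s k z)) = (LINT z|M. s k z)" by (simp add: integral_nonneg_AE)
      also have "\<dots> = (LINT z|M. (norm (f k z - h z))\<^sup>2) + gap (f k)"
        unfolding s_def gap_def by (rule Bochner_Integration.integral_add[OF i1 i2])
      also have "\<dots> \<le> (e k)\<^sup>2 + 4 / \<kappa> * (e k)\<^sup>2"
        using f(2)[of k] f(3)[of k] \<kappa>(1) by (intro add_mono) (auto simp: field_simps)
      finally show "norm (LINT z|M. norm (s k z)) \<le> (1 + 4 / \<kappa>) * (e k)\<^sup>2" by (simp add: algebra_simps)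
    qed
  qed
  then obtain r where r: "strict_mono r" "AE z in M. (\<lambda>k. s (r k) z) \<longlonglongrightarrow> 0"
    using tendsto_L1_AE_subseq[of M s] si by blast
  have conv: "AE z in M. (\<lambda>k. f (r k) z) \<longlonglongrightarrow> h z \<and> (z \<in> P \<longrightarrow> (\<lambda>k. trace (D z (f (r k) z))) \<longlonglongrightarrow> 0)"
    using r(2)
  proof eventually_elim
    case (elim z)
    have "(\<lambda>k. (norm (f (r k) z - h z))\<^sup>2) \<longlonglongrightarrow> 0"
      by (rule tendsto_sandwich[OF _ _ tendsto_const elim]) (auto simp: s_def)
    then have "(\<lambda>k. norm (f (r k) z - h z)) \<longlonglongrightarrow> 0" using tendsto_real_sqrt[of "\<lambda>k. (norm (f (r k) z - h z))\<^sup>2" 0] by simp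
    then have 1: "(\<lambda>k. f (r k) z) \<longlonglongrightarrow> h z" using Lim_null tendsto_norm_zero_iff by blast
    have 2: "(\<lambda>k. trace (D z (f (r k) z))) \<longlonglongrightarrow> 0" if "z \<in> P"
    proof -
      have "(\<lambda>k. (trace (D z (f (r k) z)))\<^sup>2) \<longlonglongrightarrow> 0"
        by (rule tendsto_sandwich[OF _ _ tendsto_const elim]) (use that in \<open>auto simp: s_def\<close>)
      then have "(\<lambda>k. \<bar>trace (D z (f (r k) z))\<bar>) \<longlonglongrightarrow> 0" using tendsto_real_sqrt[of "\<lambda>k. (trace (D z (f (r k) z)))\<^sup>2" 0] by simp
      then show ?thesis by (rule tendsto_rabs_zero_cancel)
    qed
    show ?case using 1 2 by blast
  qed
  show "AE z in M. z \<in> P \<longrightarrow> D z (h z) = 0"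
    using conv
  proof eventually_elim
    case (elim z)
    show ?case
    proof
      assume z: "z \<in> P"
      then have "\<rho> z > 0" using pos(1) P_slab by blast
      then have \<rho>z: "\<rho> z \<noteq> 0" by simp
      have "D z (h z) $ i $ j = 0" for i j
      proof -
        have "(\<lambda>k. D z (f (r k) z) $ i $ j) \<longlonglongrightarrow> D z (h z) $ i $ j"
          unfolding defect_def tensor_def using elim \<rho>z by (auto intro!: tendsto_intros)
        moreover have "(\<lambda>k. D z (f (r k) z) $ i $ j) \<longlonglongrightarrow> 0"
        \<comment> \<open>Positive definiteness of the approximating defects lets their traces
          dominate all entries.\<close>
        proof (rule Lim_null_comparison)
          show "(\<lambda>k. trace (D z (f (r k) z))) \<longlonglongrightarrow> 0" using elim z by blast
          show "\<forall>\<^sub>F k in sequentially. norm (D z (f (r k) z) $ i $ j) \<le> trace (D z (f (r k) z))"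
            using posdef_entry_le_trace[OF defect_Sym[OF pos(2) X0D(3)[OF f(1)]] X0D(4)[OF f(1) z]] z P_slab by (auto intro: always_eventually)
        qed
        ultimately show ?thesis by (rule LIMSEQ_unique)
      qed
      then show "D z (h z) = 0" by (simp add: vec_eq_iff)
    qed
  qed
  obtain m r' K K' c where b: "0 < m" "\<And>z. z \<in> closed_unit_cell T \<Longrightarrow> m \<le> \<rho> z \<and> \<rho> z \<le> r'"
     "\<And>f z. f \<in> Adm \<Longrightarrow> z \<in> P \<Longrightarrow> norm (V z + fst (f z)) \<le> K \<and> trace (D z (f z)) \<le> K'"
    using uniform_bounds by metis
  obtain B where B: "B \<ge> 0" "\<And>z. z \<in> closed_unit_cell T \<Longrightarrow> norm (V z) \<le> B" using continuous_slab_bounded[OF cont(2)] by blast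
  have "(\<lambda>k. LINT z|M. (norm (fst (f (r k) z)))\<^sup>2 / \<rho> z) \<longlonglongrightarrow> (LINT z|M. (norm (fst (h z)))\<^sup>2 / \<rho> z)"
  \<comment> \<open>The energy passes to the limit because the velocities in \<open>X0\<close> are
    uniformly bounded. \<open>uniform_bounds\<close> says nothing about the sign of \<open>K\<close>
    if \<open>P\<close> is empty, hence the absolute value.\<close>
  proof (rule integral_dominated_convergence[where w = "\<lambda>z. (\<bar>K\<bar> + B)\<^sup>2 / m"])
    have \<rho>m: "\<rho> \<in> borel_measurable M" by (rule measurable_spacetime[OF cont(1)]) (use unit_cell_subset in blast)
    have fm: "(\<lambda>z. fst (g z)) \<in> borel_measurable M" if "g \<in> borel_measurable M" for g :: "'n point \<Rightarrow> 'n state"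
      by (rule measurable_compose[OF that]) (intro borel_measurable_continuous_onI continuous_intros)
    have qm: "(\<lambda>z. (norm (fst (g z)))\<^sup>2 / \<rho> z) \<in> borel_measurable M" if "g \<in> borel_measurable M" for g :: "'n point \<Rightarrow> 'n state"
      by (intro borel_measurable_divide borel_measurable_power measurable_compose[OF fm[OF that] borel_measurable_norm] \<rho>m)
    show "(\<lambda>z. (norm (fst (h z)))\<^sup>2 / \<rho> z) \<in> borel_measurable M" by (rule qm[OF hm])
    show "(\<lambda>z. (norm (fst (f (r k) z)))\<^sup>2 / \<rho> z) \<in> borel_measurable M" for k
      by (rule qm[OF smooth_measurable[OF X0D(1)[OF f(1)]]])
    show "integrable M (\<lambda>z. (\<bar>K\<bar> + B)\<^sup>2 / m)" using finite_measure.integrable_const[OF finite_measure_spacetime] .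
    show "AE z in M. (\<lambda>k. (norm (fst (f (r k) z)))\<^sup>2 / \<rho> z) \<longlonglongrightarrow> (norm (fst (h z)))\<^sup>2 / \<rho> z"
      using conv AE_space
    proof eventually_elim
      case (elim z)
      then have "z \<in> slab T" unfolding space_spacetime using unit_cell_subset by blast
      then have "\<rho> z \<noteq> 0" using pos(1) by fastforce
      then show ?case using elim(1) by (intro tendsto_intros) blast+
    qed
    show "AE z in M. norm ((norm (fst (f (r k) z)))\<^sup>2 / \<rho> z) \<le> (\<bar>K\<bar> + B)\<^sup>2 / m" for k
    proof (intro AE_I2)
      fix z assume "z \<in> space M"
      then have z: "z \<in> closed_unit_cell T" unfolding space_spacetime using unit_cell_subset(1) by blast
      have \<rho>: "m \<le> \<rho> z" using b(2)[OF z] by blast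
      have "norm (fst (f (r k) z)) \<le> \<bar>K\<bar> + B"
      proof (cases "z \<in> P")
        case True
        have "norm (fst (f (r k) z)) \<le> norm (V z + fst (f (r k) z)) + norm (V z)"
          using norm_triangle_ineq4[of "V z + fst (f (r k) z)" "V z"] by simp
        then show ?thesis using b(3)[OF f(1) True, of "r k"] B(2)[OF z] by linarith
      next
        case False
        then show ?thesis using X0D(5)[OF f(1) False] B(1) by simp
      qed
      then have "(norm (fst (f (r k) z)))\<^sup>2 / \<rho> z \<le> (\<bar>K\<bar> + B)\<^sup>2 / m"
        using b(1) \<rho> by (intro frac_le power_mono) auto
      then show "norm ((norm (fst (f (r k) z)))\<^sup>2 / \<rho> z) \<le> (\<bar>K\<bar> + B)\<^sup>2 / m" using b(1) \<rho> by simp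
    qed
  qed
  then show "(LINT z|M. (norm (fst (h z)))\<^sup>2 / \<rho> z) \<le> 4 / 3 * (LINT z|M. trace (R z))"
    by (rule LIMSEQ_le_const2) (use energy_bound[OF f(1)] in blast)
qed

end

lemma smooth_fun_on_continuous: "smooth_fun_on S f \<Longrightarrow> continuous_on S f"
  unfolding smooth_fun_on_def using Ck_on.simps(1) by blast

text \<open>The constant is quantified before all data: \<open>4 / 3\<close> comes solely from the
  factor 1/8 in the mixed-term condition.\<close>

theorem proposition3p1:
  assumes dim: "CARD('n::finite) \<in> {2, 3}"
  shows "\<exists>C0>0. \<forall>T \<gamma> \<delta> \<Lambda> (\<rho>0 :: 'n point \<Rightarrow> real) V0 R0 P d Vh Uh.
    T > 0 \<longrightarrow> \<gamma> > 1 \<longrightarrow> \<delta> > 0 \<longrightarrow>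
    smooth_subsolution T \<gamma> \<delta> \<rho>0 V0 R0 \<longrightarrow>
    open_region T P \<longrightarrow>
    0 < inverse (\<Lambda>\<^sup>2) \<longrightarrow> (\<forall>z\<in>P. inverse (\<Lambda>\<^sup>2) \<le> \<rho>0 z \<and> \<rho>0 z \<le> \<Lambda>\<^sup>2) \<longrightarrow>
    complete_metric_for (weak_star T) (X T P \<rho>0 V0 R0) d \<longrightarrow>
    L2_continuity_point T (X T P \<rho>0 V0 R0) d (\<lambda>z. (Vh z, Uh z)) \<longrightarrow>
      (AE z in spacetime T. z \<in> P \<longrightarrow>
         (1 / \<rho>0 z) *\<^sub>R ((V0 z + Vh z) \<otimes> (V0 z + Vh z)) - (U_of \<rho>0 V0 z + Uh z)
           = ((norm (V0 z))\<^sup>2 / (real CARD('n) * \<rho>0 z)) *\<^sub>R mat 1 + R0 z) \<and>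
      (LINT z|spacetime T. (norm (Vh z))\<^sup>2 / \<rho>0 z)
        \<le> C0 * (LINT z|spacetime T. trace (R0 z))"
proof (intro exI[of _ "4 / 3"] conjI[of "_ < _"] allI impI)
  fix T \<gamma> \<delta> \<Lambda> :: real and \<rho>0 :: "'n point \<Rightarrow> real" and V0 R0 P d Vh Uh
  assume T: "T > 0" and ss: "smooth_subsolution T \<gamma> \<delta> \<rho>0 V0 R0" and P: "open_region T P"
    and d: "complete_metric_for (weak_star T) (X T P \<rho>0 V0 R0) d"
    and h: "L2_continuity_point T (X T P \<rho>0 V0 R0) d (\<lambda>z. (Vh z, Uh z))"
  interpret subsolution T \<rho>0 V0 R0 P
    by unfold_locales (use T ss P dim in \<open>auto simp: smooth_subsolution_def smooth_fun_on_continuous\<close>)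
  show "(AE z in spacetime T. z \<in> P \<longrightarrow>
         (1 / \<rho>0 z) *\<^sub>R ((V0 z + Vh z) \<otimes> (V0 z + Vh z)) - (U_of \<rho>0 V0 z + Uh z)
           = ((norm (V0 z))\<^sup>2 / (real CARD('n) * \<rho>0 z)) *\<^sub>R mat 1 + R0 z) \<and>
      (LINT z|spacetime T. (norm (Vh z))\<^sup>2 / \<rho>0 z)
        \<le> 4 / 3 * (LINT z|spacetime T. trace (R0 z))"
    using continuity_point_properties[OF d h] unfolding defect_eq by (auto elim!: eventually_mono)
qed simp

end
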